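(* Let $(\mathcal{G}_N)_N$ be a sequence of (finite) truncated propagating graphs with strictly increasing lengths and uniformly bounded maximal degree. Then $(\mathcal{G}_N)_N$ has asymptotically dense delocalization.
   Context: A graph $\mathcal{G}$ is $\mathbb{Z}$-invariant if there is a graph automorphism $f:\mathcal{V}(\mathcal{G})\to\mathcal{V}(\mathcal{G})$ generating a free $\mathbb{Z}$-action on $\mathcal{V}(\mathcal{G})$; it has finite section if $f$ has finitely many distinct orbits. $\mathcal{G}$ is propagating if it is $\mathbb{Z}$-invariant with finite section and there is a partial order $\le$ on $\mathcal{V}(\mathcal{G})$ for which $f$ is a strictly increasing order automorphism (so $v<f(v)$ for all $v$) such that: (i) $f(v)$ and $v$ are adjacent for every $v$; (ii) for every neighbour $w$ of $v$, $f^{-1}(v)\le w\le f(v)$. A set $X\subset\mathcal{V}(\mathcal{G})$ is a fundamental domain if every orbit of $f$ meets $X$ in exactly one vertex. A subset $Y\subset\mathcal{V}(\mathcal{G})$ is convex if $v,z\in Y$ and $v\le w\le z$ imply $w\in Y$. A truncated propagating graph is the subgraph $\mathcal{G}_Y$ induced by a (finite) convex $Y$ in a propagating graph $\mathcal{G}$; its length is the maximal number of pairwise disjoint fundamental domains contained in $Y$. (The ambient propagating graph may vary with $N$.) For a finite graph $\mathcal{G}$ and $V:\mathcal{V}(\mathcal{G})\to[-\lambda,\lambda]$, $H_{\mathcal{G},V}$ acts on $\ell^2(\mathcal{V}(\mathcal{G}))$ by $(H_{\mathcal{G},V}\phi)(v)=\sum_{v'\sim v}[\phi(v')-\phi(v)]+V(v)\phi(v)$,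 and $\sigma_{V,v}$ is its spectral measure at $\delta_v$: $\langle\delta_v,g(H_{\mathcal{G},V})\delta_v\rangle=\int g\,d\sigma_{V,v}$. A family $\mathcal{F}$ of finite graphs has asymptotically dense delocalization if for all $\lambda,\varepsilon,\delta>0$ there is $N_{\mathcal{F}}(\lambda,\varepsilon,\delta)>0$ such that for every $\mathcal{G}\in\mathcal{F}$ with $\#\mathcal{V}(\mathcal{G})>N_{\mathcal{F}}(\lambda,\varepsilon,\delta)$ and every $V:\mathcal{V}(\mathcal{G})\to[-\lambda,\lambda]$ there is a potential $W:\mathcal{V}(\mathcal{G})\to[-\lambda,\lambda]$ with $\|V-W\|_\infty<\delta$ such that, for at least $(1-\delta)\#\mathcal{V}(\mathcal{G})$ vertices $v$, the spectral measure $\sigma_{W,v}$ has no atom of weight larger than $\varepsilon$. *)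

theory Defs
  imports "HOL-Analysis.Analysis" "Graph_Theory.Digraph_Component"
begin

section \<open>Propagating graphs and their truncations\<close>

text \<open>
  As in \<^theory>\<open>Graph_Theory.Digraph\<close>, undirected graphs are symmetric digraphs.  The locale
  \<^locale>\<open>graph\<close> of that theory describes simple graphs but includes finiteness, which fails for
  propagating graphs.
\<close>

locale simple_graph = loopfree_digraph G + nomulti_digraph G + sym_digraph G
  for G :: "('a, 'b) pre_digraph" (structure)

definition graph_automorphism :: "('a, 'b) pre_digraph \<Rightarrow> ('a \<Rightarrow> 'a) \<Rightarrow> bool" where
  "graph_automorphism G f \<longleftrightarrow>
     bij_betw f (verts G) (verts G) \<and>
     (\<forall>u \<in> verts G. \<forall>v \<in> verts G. f u \<rightarrow>\<^bsub>G\<^esub> f v \<longleftrightarrow> u \<rightarrow>\<^bsub>G\<^esub> v)"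

text \<open>The \<open>n\<close>-th power (\<open>n\<close> a possibly negative integer) of a bijection \<open>f\<close> of \<open>A\<close>.\<close>

definition zpower :: "'a set \<Rightarrow> ('a \<Rightarrow> 'a) \<Rightarrow> int \<Rightarrow> 'a \<Rightarrow> 'a" where
  "zpower A f n = (if n \<ge> 0 then f ^^ nat n else inv_into A f ^^ nat (- n))"

definition zorbit :: "'a set \<Rightarrow> ('a \<Rightarrow> 'a) \<Rightarrow> 'a \<Rightarrow> 'a set" where
  "zorbit A f v = range (\<lambda>n. zpower A f n v)"

locale propagating_graph = simple_graph G
  for G :: "('a, 'b) pre_digraph" (structure) and f :: "'a \<Rightarrow> 'a" and r :: "'a rel" +
  assumes automorphism: "graph_automorphism G f"
    and free_action: "\<And>v n. v \<in> verts G \<Longrightarrow> zpower (verts G) f n v = v \<Longrightarrow> n = 0"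
    and finite_section: "finite (zorbit (verts G) f ` verts G)"
    and partial_order: "partial_order_on (verts G) r"
    and order_automorphism:
      "\<And>u v. u \<in> verts G \<Longrightarrow> v \<in> verts G \<Longrightarrow> (f u, f v) \<in> r \<longleftrightarrow> (u, v) \<in> r"
    and increasing: "\<And>v. v \<in> verts G \<Longrightarrow> (v, f v) \<in> r \<and> v \<noteq> f v"
    and adjacent_image: "\<And>v. v \<in> verts G \<Longrightarrow> f v \<rightarrow> v"
    and neighbour_bounds:
      "\<And>v w. v \<rightarrow> w \<Longrightarrow> (inv_into (verts G) f v, w) \<in> r \<and> (w, f v) \<in> r"

definition order_convex :: "'a rel \<Rightarrow> 'a set \<Rightarrow> bool" where
  "order_convex r Y \<longleftrightarrow>
     (\<forall>v w z. v \<in> Y \<longrightarrow> z \<in> Y \<longrightarrow> (v, w) \<in> r \<longrightarrow> (w, z) \<in> r \<longrightarrow> w \<in> Y)"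

text \<open>The truncated propagating graph described by these data is \<open>G \<restriction> Y\<close>.\<close>

locale truncated_propagating_graph = propagating_graph G f r
  for G :: "('a, 'b) pre_digraph" (structure) and f r +
  fixes Y :: "'a set"
  assumes finite_Y: "finite Y"
    and Y_subset: "Y \<subseteq> verts G"
    and convex_Y: "order_convex r Y"
begin

lemma graph_truncation: "graph (G \<restriction> Y)"
proof -
  have "inj_on (arc_to_ends G) (arcs (G \<restriction> Y))"
    by (auto intro!: inj_onI no_multi_arcs)
  moreover have "arc_to_ends G ` arcs (G \<restriction> Y) \<subseteq> Y \<times> Y"
    by (auto simp: arc_to_ends_def)
  ultimately have fin: "finite (arcs (G \<restriction> Y))"
    by (meson finite_Y finite_SigmaI finite_imageD finite_subset)
  have sym: "symmetric (G \<restriction> Y)"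
    using sym_arcs unfolding symmetric_def sym_def arcs_ends_def arc_to_ends_def
    by (fastforce simp: image_iff)
  show ?thesis
    by unfold_locales (use fin sym finite_Y no_loops no_multi_arcs in auto)
qed

end

definition fundamental_domain :: "('a, 'b) pre_digraph \<Rightarrow> ('a \<Rightarrow> 'a) \<Rightarrow> 'a set \<Rightarrow> bool" where
  "fundamental_domain G f X \<longleftrightarrow>
     X \<subseteq> verts G \<and> (\<forall>v \<in> verts G. \<exists>!x. x \<in> X \<inter> zorbit (verts G) f v)"

definition truncation_length :: "('a, 'b) pre_digraph \<Rightarrow> ('a \<Rightarrow> 'a) \<Rightarrow> 'a set \<Rightarrow> nat" where
  "truncation_length G f Y =
     Max (card ` {P. disjoint P \<and> (\<forall>X \<in> P. fundamental_domain G f X \<and> X \<subseteq> Y)})"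


section \<open>Functional calculus and spectral measures\<close>

text \<open>
  For a finite set \<open>S\<close>, the Hilbert space \<open>\<ell>\<^sup>2(S)\<close> is represented by the complex functions
  vanishing outside \<open>S\<close>.
\<close>

definition l2_space :: "'a set \<Rightarrow> ('a \<Rightarrow> complex) set" where
  "l2_space S = {\<phi>. \<forall>v. v \<notin> S \<longrightarrow> \<phi> v = 0}"

definition l2_inner :: "'a set \<Rightarrow> ('a \<Rightarrow> complex) \<Rightarrow> ('a \<Rightarrow> complex) \<Rightarrow> complex" where
  "l2_inner S \<phi> \<psi> = (\<Sum>v\<in>S. cnj (\<phi> v) * \<psi> v)"

definition l2_delta :: "'a \<Rightarrow> 'a \<Rightarrow> complex" where
  "l2_delta v = (\<lambda>w. if w = v then 1 else 0)"

definition l2_projection ::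
    "'a set \<Rightarrow> ('a \<Rightarrow> complex) set \<Rightarrow> ('a \<Rightarrow> complex) \<Rightarrow> ('a \<Rightarrow> complex)" where
  "l2_projection S U \<phi> =
     (THE \<psi>. \<psi> \<in> U \<and> (\<forall>\<eta> \<in> U. l2_inner S \<eta> (\<lambda>v. \<phi> v - \<psi> v) = 0))"

definition eigenspace ::
    "'a set \<Rightarrow> (('a \<Rightarrow> complex) \<Rightarrow> ('a \<Rightarrow> complex)) \<Rightarrow> real \<Rightarrow> ('a \<Rightarrow> complex) set" where
  "eigenspace S T E = {\<phi> \<in> l2_space S. T \<phi> = (\<lambda>v. of_real E * \<phi> v)}"

text \<open>All operators considered here are self-adjoint, so only real eigenvalues are needed.\<close>

definition eigenvalues :: "'a set \<Rightarrow> (('a \<Rightarrow> complex) \<Rightarrow> ('a \<Rightarrow> complex)) \<Rightarrow> real set" where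
  "eigenvalues S T = {E. \<exists>\<phi> \<in> eigenspace S T E. \<phi> \<noteq> (\<lambda>v. 0)}"

text \<open>
  The operator \<open>g(T)\<close> for a self-adjoint operator \<open>T\<close> on the finite-dimensional space \<open>\<ell>\<^sup>2(S)\<close>,
  namely \<open>\<Sum>\<^sub>E g(E) P\<^sub>E\<close> where \<open>P\<^sub>E\<close> is the orthogonal projection onto the eigenspace of \<open>E\<close>.
\<close>

definition functional_calculus ::
    "'a set \<Rightarrow> (('a \<Rightarrow> complex) \<Rightarrow> ('a \<Rightarrow> complex)) \<Rightarrow> (real \<Rightarrow> complex)
      \<Rightarrow> ('a \<Rightarrow> complex) \<Rightarrow> ('a \<Rightarrow> complex)" where
  "functional_calculus S T g \<phi> =
     (\<lambda>v. \<Sum>E \<in> eigenvalues S T. g E * l2_projection S (eigenspace S T E) \<phi> v)"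

definition spectral_measure ::
    "'a set \<Rightarrow> (('a \<Rightarrow> complex) \<Rightarrow> ('a \<Rightarrow> complex)) \<Rightarrow> 'a \<Rightarrow> real measure" where
  "spectral_measure S T v =
     (THE \<sigma>. finite_measure \<sigma> \<and> sets \<sigma> = sets borel \<and>
        (\<forall>g \<in> borel_measurable borel. bounded (range g) \<longrightarrow>
           l2_inner S (l2_delta v) (functional_calculus S T g (l2_delta v)) = (LINT E|\<sigma>. g E)))"


section \<open>Schroedinger operators and asymptotically dense delocalization\<close>

definition schroedinger_op ::
    "('a, 'b) pre_digraph \<Rightarrow> ('a \<Rightarrow> real) \<Rightarrow> ('a \<Rightarrow> complex) \<Rightarrow> ('a \<Rightarrow> complex)" where
  "schroedinger_op G V \<phi> =
     (\<lambda>v. if v \<in> verts G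
          then (\<Sum>w | v \<rightarrow>\<^bsub>G\<^esub> w. \<phi> w - \<phi> v) + of_real (V v) * \<phi> v
          else 0)"

definition asymptotically_dense_delocalization :: "('a, 'b) pre_digraph set \<Rightarrow> bool" where
  "asymptotically_dense_delocalization F \<longleftrightarrow>
     (\<forall>lam > 0. \<forall>eps > 0. \<forall>\<delta> > 0. \<exists>N::nat. N > 0 \<and>
        (\<forall>G \<in> F. card (verts G) > N \<longrightarrow>
          (\<forall>V \<in> verts G \<rightarrow> {- lam..lam}. \<exists>W \<in> verts G \<rightarrow> {- lam..lam}.
             (SUP v\<in>verts G. \<bar>V v - W v\<bar>) < \<delta> \<and>
             real (card {v \<in> verts G.
               \<not> (\<exists>E. measure (spectral_measure (verts G) (schroedinger_op G W) v) {E} > eps)})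
             \<ge> (1 - \<delta>) * real (card (verts G)))))"

end

theory Submission
  imports Defs "Jordan_Normal_Form.Spectral_Radius"
begin

text \<open>
  Write \<open>\<langle>g\<rangle>\<^sub>v\<close> for the integral of \<open>g\<close> against the spectral measure of \<open>H\<^sub>W\<close> at \<open>v\<close>. If \<open>g\<close> oscillates
  rapidly and is small, a near minimiser \<open>W\<close> of \<open>Tr g(H\<^sub>W) + a |W - V|\<^sup>2\<close> is close to \<open>V\<close>, and vanishing
  of the gradient says that \<open>\<langle>g'\<rangle>\<^sub>v\<close> is small for most \<open>v\<close>. With \<open>g' \<approx> \<eta> s\<close>, where \<open>s\<close> is
  almost a square wave with values \<open>\<plusminus>1\<close>, this splits the mass \<open>\<langle>\<eta>\<rangle>\<^sub>v\<close> evenly between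
  \<open>\<eta> (1 + s) / 2\<close> and \<open>\<eta> (1 - s) / 2\<close>. Repeating this on ever finer scales gives a partition of unity
  whose members all have small mass at most vertices, so an atom of weight larger than \<open>\<epsilon>\<close> must sit where
  some \<open>s\<close> jumps.

  Few eigenvalues lie there: the eigenvalue equation at \<open>f\<^sup>-\<^sup>1(u)\<close> determines the value at \<open>u\<close> from
  smaller vertices, so replacing few rows of \<open>H\<^sub>W - E\<close> and permuting the others produces a unitriangular
  matrix. Its determinant is \<open>1\<close> for every \<open>W\<close>, and Hadamard's inequality in an eigenbasis bounds
  the number of eigenvalues near \<open>E\<close> uniformly.
\<close>

section \<open>Real orthonormal eigenbases\<close>

text \<open>The threshold on the number of vertices may depend neither on the graph nor on V, so all
  frequencies, sharpnesses and the ratio \<open>L\<close> are fixed before \<open>S\<close>,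
  \<open>A\<close> and \<open>V\<close> appear. This works because the two parameters of a wave
  decouple: the size of its primitive depends on \<omega> alone, so a single \<omega> balances for
  every b in (0,1), and only then is b pushed towards 1 until the energies with |s| < 1/2 fill
  windows too narrow for many eigenvalues. Counting eigenvalues is enough: each eigenvector has
  total mass 1, so the mass of a set of energies, averaged over the vertices, is the fraction of
  eigenvalues in it. Elsewhere an atom keeps a factor 3/4 at each refinement on a suitable branch,
  while the mass of a node is halved up to an error; the ratio (2/3)^d becomes small. Near
  minimisers replace minimisers because an infimum exists without any continuity of the spectrum in
  the potential. The replaced rows sit at the first vertex of each orbit in Y; a fundamental domain
  inside Y meets every such orbit, so growing lengths make their proportion tend to 0.\<close>

definition orthobasis :: "'a set \<Rightarrow> ('a \<Rightarrow> 'a \<Rightarrow> real) \<Rightarrow> bool" where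
  "orthobasis S \<phi> \<longleftrightarrow>
     (\<forall>j\<in>S. \<forall>k\<in>S. (\<Sum>v\<in>S. \<phi> j v * \<phi> k v) = of_bool (j = k)) \<and>
     (\<forall>v\<in>S. \<forall>w\<in>S. (\<Sum>j\<in>S. \<phi> j v * \<phi> j w) = of_bool (v = w))"

text \<open>The basis is indexed by \<open>S\<close> itself, which makes \<open>\<phi>\<close> a
  square orthogonal matrix: determinants apply to it, and \<open>orthobasis\<close> can record row
  and column orthonormality side by side.\<close>

definition eigenbasis ::
    "'a set \<Rightarrow> ('a \<Rightarrow> 'a \<Rightarrow> real) \<Rightarrow> ('a \<Rightarrow> 'a \<Rightarrow> real) \<Rightarrow> ('a \<Rightarrow> real) \<Rightarrow> bool" where
  "eigenbasis S h \<phi> E \<longleftrightarrow> orthobasis S \<phi> \<and>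
     (\<forall>j\<in>S. \<forall>v\<in>S. (\<Sum>w\<in>S. h v w * \<phi> j w) = E j * \<phi> j v)"

lemma sum_mult_of_bool:
  fixes f :: "'a \<Rightarrow> 'b::semiring_1"
  assumes "finite S" "j \<in> S"
  shows "(\<Sum>k\<in>S. f k * of_bool (k = j)) = f j" "(\<Sum>k\<in>S. f k * of_bool (j = k)) = f j"
    "(\<Sum>k\<in>S. of_bool (k = j) * f k) = f j" "(\<Sum>k\<in>S. of_bool (j = k) * f k) = f j"
proof -
  have "(\<Sum>k\<in>S. f k * of_bool (k = j)) = (\<Sum>k\<in>S. if k = j then f k else 0)"
    "(\<Sum>k\<in>S. f k * of_bool (j = k)) = (\<Sum>k\<in>S. if k = j then f k else 0)"
    "(\<Sum>k\<in>S. of_bool (k = j) * f k) = (\<Sum>k\<in>S. if k = j then f k else 0)"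
    "(\<Sum>k\<in>S. of_bool (j = k) * f k) = (\<Sum>k\<in>S. if k = j then f k else 0)"
    by (auto intro!: sum.cong)
  then show "(\<Sum>k\<in>S. f k * of_bool (k = j)) = f j" "(\<Sum>k\<in>S. f k * of_bool (j = k)) = f j"
    "(\<Sum>k\<in>S. of_bool (k = j) * f k) = f j" "(\<Sum>k\<in>S. of_bool (j = k) * f k) = f j"
    using assms by simp_all
qed

lemma orthobasisD:
  assumes "orthobasis S \<phi>"
  shows "\<And>j k. j \<in> S \<Longrightarrow> k \<in> S \<Longrightarrow> (\<Sum>v\<in>S. \<phi> j v * \<phi> k v) = of_bool (j = k)"
    and "\<And>v w. v \<in> S \<Longrightarrow> w \<in> S \<Longrightarrow> (\<Sum>j\<in>S. \<phi> j v * \<phi> j w) = of_bool (v = w)"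
  using assms by (auto simp: orthobasis_def)

lemma eigenbasisD:
  assumes "eigenbasis S h \<phi> E"
  shows "orthobasis S \<phi>"
    and "\<And>j v. j \<in> S \<Longrightarrow> v \<in> S \<Longrightarrow> (\<Sum>w\<in>S. h v w * \<phi> j w) = E j * \<phi> j v"
  using assms by (auto simp: eigenbasis_def)

lemma exists_complex_eigenvector:
  fixes h :: "'a \<Rightarrow> 'a \<Rightarrow> complex"
  assumes S: "finite S" "S \<noteq> {}"
  shows "\<exists>z k. (\<forall>v\<in>S. (\<Sum>w\<in>S. h v w * z w) = k * z v) \<and> (\<exists>v\<in>S. z v \<noteq> 0)"
proof -
  define n where "n = card S"
  obtain e where e: "bij_betw e {..<n} S"
    using ex_bij_betw_nat_finite[OF S(1)] by (auto simp: n_def atLeast0LessThan)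
  define A where "A = mat n n (\<lambda>(i, j). h (e i) (e j))"
  have A: "A \<in> carrier_mat n n" by (simp add: A_def)
  have "n > 0" using S by (simp add: n_def card_gt_0_iff)
  then obtain k where "eigenvalue A k"
    using spectrum_non_empty[OF A] by (auto simp: spectrum_def)
  then obtain x where x: "x \<in> carrier_vec n" "x \<noteq> 0\<^sub>v n" "A *\<^sub>v x = k \<cdot>\<^sub>v x"
    using A by (auto simp: eigenvalue_def eigenvector_def)
  define z where "z w = x $ inv_into {..<n} e w" for w
  have z: "z (e i) = x $ i" if "i < n" for i
    using e that by (simp add: z_def bij_betw_inv_into_left)
  show ?thesis
  proof (intro exI[of _ z] exI[of _ k] conjI ballI)
    fix v assume "v \<in> S"
    then obtain i where i: "i < n" "v = e i" using e by (auto simp: bij_betw_def)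
    have "(\<Sum>w\<in>S. h v w * z w) = (\<Sum>j<n. h (e i) (e j) * x $ j)"
      unfolding sum.reindex_bij_betw[OF e, symmetric] i(2) by (rule sum.cong) (auto simp: z)
    also have "\<dots> = (A *\<^sub>v x) $ i"
      using i x(1) by (simp add: A_def scalar_prod_def atLeast0LessThan)
    also have "\<dots> = k * z v" using x i by (simp add: z)
    finally show "(\<Sum>w\<in>S. h v w * z w) = k * z v" .
  next
    obtain i where "i < n" "x $ i \<noteq> 0" using x(1,2) by (metis carrier_vecD eq_vecI index_zero_vec)
    then show "\<exists>v\<in>S. z v \<noteq> 0" using e z by (auto simp: bij_betw_def intro!: bexI[of _ "e i"])
  qed
qed

text \<open>Pairing \<open>z\<close> with its image under the symmetric real \<open>h\<close> gives
  a number equal to its own conjugate, so the complex eigenvalue is real. Then the real and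
  imaginary parts of \<open>z\<close> solve the equation separately, and one of them is
  nonzero.\<close>

lemma exists_real_eigenvector:
  fixes h :: "'a \<Rightarrow> 'a \<Rightarrow> real"
  assumes S: "finite S" "S \<noteq> {}" and sym: "\<And>v w. v \<in> S \<Longrightarrow> w \<in> S \<Longrightarrow> h v w = h w v"
  obtains x E where "\<And>v. v \<in> S \<Longrightarrow> (\<Sum>w\<in>S. h v w * x w) = E * x v" "(\<Sum>v\<in>S. (x v)\<^sup>2) = 1"
proof -
  obtain z :: "'a \<Rightarrow> complex" and k where z: "\<And>v. v \<in> S \<Longrightarrow> (\<Sum>w\<in>S. of_real (h v w) * z w) = k * z v" "\<exists>v\<in>S. z v \<noteq> 0"
    using exists_complex_eigenvector[OF S, of "\<lambda>v w. of_real (h v w)"] by auto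
  define q where "q = (\<Sum>v\<in>S. (cmod (z v))\<^sup>2)"
  have q: "q > 0"
  proof -
    obtain v where "v \<in> S" "z v \<noteq> 0" using z(2) by blast
    then show ?thesis unfolding q_def using S(1) by (intro sum_pos2[of _ v]) auto
  qed
  have qz: "of_real q = (\<Sum>v\<in>S. cnj (z v) * z v)"
    unfolding q_def of_real_sum by (intro sum.cong refl) (metis complex_norm_square mult.commute)
  have kq: "k * of_real q = (\<Sum>v\<in>S. cnj (z v) * (\<Sum>w\<in>S. of_real (h v w) * z w))"
    unfolding qz sum_distrib_left[of k]
    by (intro sum.cong refl) (simp only: z(1) mult.left_commute)
  note kq
  also have "\<dots> = (\<Sum>v\<in>S. \<Sum>w\<in>S. of_real (h v w) * (cnj (z v) * z w))"
    by (simp add: sum_distrib_left mult_ac)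
  also have "\<dots> = (\<Sum>v\<in>S. \<Sum>w\<in>S. of_real (h w v) * (cnj (z w) * z v))"
    by (rule sum.swap)
  also have "\<dots> = (\<Sum>v\<in>S. \<Sum>w\<in>S. of_real (h v w) * (cnj (z w) * z v))"
    by (intro sum.cong refl) (simp only: sym)
  also have "\<dots> = cnj (\<Sum>v\<in>S. \<Sum>w\<in>S. of_real (h v w) * (cnj (z v) * z w))"
    by (simp add: mult_ac)
  also have "(\<Sum>v\<in>S. \<Sum>w\<in>S. of_real (h v w) * (cnj (z v) * z w)) =
      (\<Sum>v\<in>S. cnj (z v) * (\<Sum>w\<in>S. of_real (h v w) * z w))"
    by (simp add: sum_distrib_left mult_ac)
  also have "\<dots> = k * of_real q"
    by (rule kq[symmetric])
  finally have "k = cnj k" using q by simp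
  then have Im_k: "Im k = 0" by (simp add: complex_eq_iff)
  have "\<exists>y. (\<forall>v\<in>S. (\<Sum>w\<in>S. h v w * y w) = Re k * y v) \<and> (\<exists>v\<in>S. y v \<noteq> 0)"
  proof -
    have re: "(\<Sum>w\<in>S. h v w * Re (z w)) = Re k * Re (z v)" if "v \<in> S" for v
      using arg_cong[OF z(1)[OF that], of Re] Im_k by simp
    have im: "(\<Sum>w\<in>S. h v w * Im (z w)) = Re k * Im (z v)" if "v \<in> S" for v
      using arg_cong[OF z(1)[OF that], of Im] Im_k by simp
    from z(2) obtain v where "v \<in> S" "Re (z v) \<noteq> 0 \<or> Im (z v) \<noteq> 0"
      by (auto simp: complex_eq_iff)
    then show ?thesis
      using re im by (elim disjE) (rule exI[of _ "\<lambda>w. Re (z w)"], auto, rule exI[of _ "\<lambda>w. Im (z w)"], auto)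
  qed
  then obtain y where y: "\<And>v. v \<in> S \<Longrightarrow> (\<Sum>w\<in>S. h v w * y w) = Re k * y v" "\<exists>v\<in>S. y v \<noteq> 0"
    by auto
  define p where "p = (\<Sum>v\<in>S. (y v)\<^sup>2)"
  have p: "p > 0"
  proof -
    obtain v where "v \<in> S" "y v \<noteq> 0" using y(2) by blast
    then show ?thesis unfolding p_def using S(1) by (intro sum_pos2[of _ v]) auto
  qed
  show ?thesis
  proof (rule that)
    show "(\<Sum>w\<in>S. h v w * (y w / sqrt p)) = Re k * (y v / sqrt p)" if "v \<in> S" for v
      using y(1)[OF that] by (simp flip: sum_divide_distrib)
    show "(\<Sum>v\<in>S. (y v / sqrt p)\<^sup>2) = 1"
      using p by (simp add: power_divide p_def flip: sum_divide_distrib)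
  qed
qed

text \<open>The Householder reflection in the hyperplane orthogonal to u = x - delta_s, which
  exchanges x and delta_s. It degenerates when the two agree; then the identity serves.\<close>

lemma exists_reflection:
  fixes x :: "'a \<Rightarrow> real"
  assumes S: "finite S" "s \<in> S" and x: "(\<Sum>v\<in>S. (x v)\<^sup>2) = 1"
  shows "\<exists>U. (\<forall>v w. U v w = U w v) \<and>
    (\<forall>v\<in>S. \<forall>w\<in>S. (\<Sum>a\<in>S. U v a * U a w) = of_bool (v = w)) \<and> (\<forall>v\<in>S. U v s = x v)"
proof (cases "\<forall>v\<in>S. x v = of_bool (v = s)")
  case True
  then show ?thesis
    using S by (intro exI[of _ "\<lambda>v w. of_bool (v = w)"]) (auto simp: sum_mult_of_bool)
next
  case False
  define u where "u v = x v - of_bool (v = s)" for v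
  define p where "p = (\<Sum>v\<in>S. (u v)\<^sup>2)"
  have p: "p > 0" unfolding p_def
  proof -
    obtain v where "v \<in> S" "u v \<noteq> 0" using False by (auto simp: u_def)
    then show "0 < (\<Sum>v\<in>S. (u v)\<^sup>2)" using S(1) by (intro sum_pos2[of _ v]) auto
  qed
  have "p = (\<Sum>v\<in>S. (x v)\<^sup>2) + (\<Sum>v\<in>S. of_bool (v = s)) - 2 * (\<Sum>v\<in>S. x v * of_bool (v = s))"
    unfolding p_def u_def sum_distrib_left sum.distrib[symmetric] sum_subtractf[symmetric]
    by (intro sum.cong) (auto simp: power2_eq_square algebra_simps)
  also have "(\<Sum>v\<in>S. of_bool (v = s)) = (1::real)"
    using sum_mult_of_bool(1)[OF S, of "\<lambda>_. 1::real"] by simp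
  finally have p2: "p = 2 - 2 * x s"
    using x S by (simp add: sum_mult_of_bool)
  define U where "U v w = of_bool (v = w) - 2 / p * u v * u w" for v w
  show ?thesis
  proof (intro exI[of _ U] conjI allI ballI)
    show "U v w = U w v" for v w by (auto simp: U_def)
    show "(\<Sum>a\<in>S. U v a * U a w) = of_bool (v = w)" if vw: "v \<in> S" "w \<in> S" for v w
    proof -
      have "(\<Sum>a\<in>S. U v a * U a w) = (\<Sum>a\<in>S. of_bool (v = a) * of_bool (a = w))
          - 2 / p * u w * (\<Sum>a\<in>S. of_bool (v = a) * u a) - 2 / p * u v * (\<Sum>a\<in>S. u a * of_bool (a = w))
          + 4 / p\<^sup>2 * u v * u w * (\<Sum>a\<in>S. (u a)\<^sup>2)"
        unfolding sum_distrib_left sum.distrib[symmetric] sum_subtractf[symmetric]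
        by (intro sum.cong) (auto simp: U_def power2_eq_square algebra_simps)
      also have "\<dots> = of_bool (v = w)"
        using p vw S by (simp add: sum_mult_of_bool flip: p_def) (simp add: power2_eq_square)
      finally show ?thesis .
    qed
    show "U v s = x v" if "v \<in> S" for v
    proof -
      have "2 / p * u s = -1" using p p2 by (simp add: u_def field_simps)
      then have "2 / p * u v * u s = - u v"
        by (metis mult.commute mult.left_commute mult_minus1_right)
      then have "U v s = of_bool (v = s) + u v" by (simp add: U_def)
      then show ?thesis by (simp add: u_def)
    qed
  qed
qed

lemma eigenbasis_conjugate:
  assumes S: "finite S" and sym: "\<And>v w. U v w = U w v"
    and inv: "\<And>v w. v \<in> S \<Longrightarrow> w \<in> S \<Longrightarrow> (\<Sum>a\<in>S. U v a * U a w) = of_bool (v = w)"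
    and eb: "eigenbasis S (\<lambda>v w. \<Sum>a\<in>S. \<Sum>b\<in>S. U v a * h a b * U b w) \<psi> E"
  shows "eigenbasis S h (\<lambda>j v. \<Sum>a\<in>S. U v a * \<psi> j a) E"
proof -
  note ob = orthobasisD[OF eigenbasisD(1)[OF eb]]
  have U2: "(\<Sum>v\<in>S. U v a * U v b) = of_bool (a = b)" if "a \<in> S" "b \<in> S" for a b
    using inv[OF that] by (simp add: sym[of _ a])
  have U3: "(\<Sum>a\<in>S. U v a * U w a) = of_bool (v = w)" if "v \<in> S" "w \<in> S" for v w
    using inv[OF that] by (simp add: sym[of w])
  have 1: "(\<Sum>v\<in>S. (\<Sum>a\<in>S. U v a * \<psi> j a) * (\<Sum>b\<in>S. U v b * \<psi> k b)) = of_bool (j = k)"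
    if jk: "j \<in> S" "k \<in> S" for j k
  proof -
    have "(\<Sum>v\<in>S. (\<Sum>a\<in>S. U v a * \<psi> j a) * (\<Sum>b\<in>S. U v b * \<psi> k b))
        = (\<Sum>v\<in>S. \<Sum>a\<in>S. \<Sum>b\<in>S. \<psi> j a * \<psi> k b * (U v a * U v b))"
      by (simp add: sum_product mult_ac)
    also have "\<dots> = (\<Sum>a\<in>S. \<Sum>v\<in>S. \<Sum>b\<in>S. \<psi> j a * \<psi> k b * (U v a * U v b))"
      by (rule sum.swap)
    also have "\<dots> = (\<Sum>a\<in>S. \<Sum>b\<in>S. \<Sum>v\<in>S. \<psi> j a * \<psi> k b * (U v a * U v b))"
      by (intro sum.cong refl sum.swap)
    also have "\<dots> = (\<Sum>a\<in>S. \<Sum>b\<in>S. \<psi> j a * \<psi> k b * of_bool (a = b))"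
      by (intro sum.cong refl) (simp add: U2 flip: sum_distrib_left)
    also have "\<dots> = (\<Sum>a\<in>S. \<psi> j a * \<psi> k a)"
      using S by (intro sum.cong refl) (simp add: sum_mult_of_bool)
    finally show ?thesis using ob(1)[OF jk] by simp
  qed
  have 2: "(\<Sum>j\<in>S. (\<Sum>a\<in>S. U v a * \<psi> j a) * (\<Sum>b\<in>S. U w b * \<psi> j b)) = of_bool (v = w)"
    if vw: "v \<in> S" "w \<in> S" for v w
  proof -
    have "(\<Sum>j\<in>S. (\<Sum>a\<in>S. U v a * \<psi> j a) * (\<Sum>b\<in>S. U w b * \<psi> j b))
        = (\<Sum>j\<in>S. \<Sum>a\<in>S. \<Sum>b\<in>S. U v a * U w b * (\<psi> j a * \<psi> j b))"
      by (simp add: sum_product mult_ac)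
    also have "\<dots> = (\<Sum>a\<in>S. \<Sum>j\<in>S. \<Sum>b\<in>S. U v a * U w b * (\<psi> j a * \<psi> j b))"
      by (rule sum.swap)
    also have "\<dots> = (\<Sum>a\<in>S. \<Sum>b\<in>S. \<Sum>j\<in>S. U v a * U w b * (\<psi> j a * \<psi> j b))"
      by (intro sum.cong refl sum.swap)
    also have "\<dots> = (\<Sum>a\<in>S. \<Sum>b\<in>S. U v a * U w b * of_bool (a = b))"
      by (intro sum.cong refl) (simp add: ob(2) flip: sum_distrib_left)
    also have "\<dots> = (\<Sum>a\<in>S. U v a * U w a)"
      using S by (intro sum.cong refl) (simp add: sum_mult_of_bool)
    finally show ?thesis using U3[OF vw] by simp
  qed
  have 3: "(\<Sum>w\<in>S. h v w * (\<Sum>b\<in>S. U w b * \<psi> j b)) = E j * (\<Sum>a\<in>S. U v a * \<psi> j a)"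
    if vj: "v \<in> S" "j \<in> S" for v j
  proof -
    have ev: "(\<Sum>w\<in>S. (\<Sum>a\<in>S. \<Sum>b\<in>S. U c a * h a b * U b w) * \<psi> j w) = E j * \<psi> j c"
      if "c \<in> S" for c using eigenbasisD(2)[OF eb vj(2) that] .
    define g where "g a = (\<Sum>b\<in>S. h a b * (\<Sum>w\<in>S. U b w * \<psi> j w))" for a
    have g: "(\<Sum>a\<in>S. U c a * g a) = E j * \<psi> j c" if "c \<in> S" for c
    proof -
      have "(\<Sum>a\<in>S. U c a * g a) = (\<Sum>a\<in>S. \<Sum>b\<in>S. \<Sum>w\<in>S. U c a * h a b * U b w * \<psi> j w)"
        by (simp add: g_def sum_distrib_left mult_ac)
      also have "\<dots> = (\<Sum>a\<in>S. \<Sum>w\<in>S. \<Sum>b\<in>S. U c a * h a b * U b w * \<psi> j w)"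
        by (intro sum.cong refl sum.swap)
      also have "\<dots> = (\<Sum>w\<in>S. \<Sum>a\<in>S. \<Sum>b\<in>S. U c a * h a b * U b w * \<psi> j w)"
        by (rule sum.swap)
      also have "\<dots> = (\<Sum>w\<in>S. (\<Sum>a\<in>S. \<Sum>b\<in>S. U c a * h a b * U b w) * \<psi> j w)"
        by (simp add: sum_distrib_right)
      finally show ?thesis using ev[OF that] by simp
    qed
    have "E j * (\<Sum>c\<in>S. U v c * \<psi> j c) = (\<Sum>c\<in>S. U v c * (\<Sum>a\<in>S. U c a * g a))"
      unfolding sum_distrib_left[of "E j"] by (intro sum.cong refl) (simp add: g)
    also have "\<dots> = (\<Sum>c\<in>S. \<Sum>a\<in>S. U v c * U c a * g a)"
      by (simp add: sum_distrib_left mult_ac)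
    also have "\<dots> = (\<Sum>a\<in>S. (\<Sum>c\<in>S. U v c * U c a) * g a)"
      by (subst sum.swap) (simp add: sum_distrib_right)
    also have "\<dots> = (\<Sum>a\<in>S. of_bool (v = a) * g a)"
      using vj by (intro sum.cong refl) (simp add: inv)
    also have "\<dots> = g v" using S vj by (simp add: sum_mult_of_bool)
    finally show ?thesis by (simp add: g_def)
  qed
  show ?thesis unfolding eigenbasis_def orthobasis_def using 1 2 3 by blast
qed

text \<open>Deflation: conjugating by a reflection that sends the coordinate vector at
  \<open>s\<close> to an eigenvector makes column \<open>s\<close> of the matrix diagonal; symmetry
  clears row \<open>s\<close>, and the induction hypothesis handles \<open>S - {s}\<close>.\<close>

theorem exists_eigenbasis:
  fixes h :: "'a \<Rightarrow> 'a \<Rightarrow> real"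
  assumes "finite S" and "\<And>v w. v \<in> S \<Longrightarrow> w \<in> S \<Longrightarrow> h v w = h w v"
  shows "\<exists>\<phi> E. eigenbasis S h \<phi> E"
  using assms
proof (induction "card S" arbitrary: S h)
  case 0
  then show ?case by (auto simp: eigenbasis_def orthobasis_def)
next
  case (Suc n)
  note S = Suc.prems(1) and sym = Suc.prems(2)
  obtain s where s: "s \<in> S" using Suc.hyps(2) by fastforce
  obtain x E0 where x: "\<And>v. v \<in> S \<Longrightarrow> (\<Sum>w\<in>S. h v w * x w) = E0 * x v" "(\<Sum>v\<in>S. (x v)\<^sup>2) = 1"
    by (rule exists_real_eigenvector[of S h]) (use S s sym in auto)
  obtain U where U': "\<forall>v w. U v w = U w v"
    "\<forall>v\<in>S. \<forall>w\<in>S. (\<Sum>a\<in>S. U v a * U a w) = of_bool (v = w)" "\<forall>v\<in>S. U v s = x v"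
    using exists_reflection[OF S s x(2)] by (elim exE conjE)
  have U: "\<And>v w. U v w = U w v"
    "\<And>v w. v \<in> S \<Longrightarrow> w \<in> S \<Longrightarrow> (\<Sum>a\<in>S. U v a * U a w) = of_bool (v = w)"
    "\<And>v. v \<in> S \<Longrightarrow> U v s = x v"
    by (fact U'(1)[rule_format], fact U'(2)[rule_format], fact U'(3)[rule_format])
  define g where "g v w = (\<Sum>a\<in>S. \<Sum>b\<in>S. U v a * h a b * U b w)" for v w
  have gsym: "g v w = g w v" for v w
  proof -
    have "g v w = (\<Sum>b\<in>S. \<Sum>a\<in>S. U v a * h a b * U b w)"
      unfolding g_def by (rule sum.swap)
    also have "\<dots> = (\<Sum>b\<in>S. \<Sum>a\<in>S. U w b * h b a * U a v)"
    proof (intro sum.cong refl)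
      fix b a assume "b \<in> S" "a \<in> S"
      then show "U v a * h a b * U b w = U w b * h b a * U a v"
        using sym[of a b] U(1)[of v a] U(1)[of b w] by simp
    qed
    finally show ?thesis by (simp add: g_def)
  qed
  have gs: "g v s = E0 * of_bool (v = s)" if "v \<in> S" for v
  proof -
    have "g v s = (\<Sum>a\<in>S. U v a * (\<Sum>b\<in>S. h a b * x b))"
      unfolding g_def sum_distrib_left by (intro sum.cong refl) (simp add: U(3) mult_ac)
    also have "\<dots> = E0 * (\<Sum>a\<in>S. U v a * U a s)"
      unfolding sum_distrib_left[of E0] by (intro sum.cong refl) (simp add: x(1) U(3))
    finally show ?thesis using U(2)[OF that s] by simp
  qed
  define S' where "S' = S - {s}"
  have S': "finite S'" "card S' = n" using S s Suc.hyps(2) by (auto simp: S'_def)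
  obtain \<psi> F where eb: "eigenbasis S' g \<psi> F"
    using Suc.hyps(1)[of S' g] S' gsym by blast
  note ob = orthobasisD[OF eigenbasisD(1)[OF eb]]
  have split: "sum f S = f s + sum f S'" for f :: "'a \<Rightarrow> real"
    using sum.remove[OF S s] by (simp add: S'_def)
  \<comment> \<open>The smaller basis is padded by zeros at \<open>s\<close> and completed by the
    coordinate vector at \<open>s\<close>.\<close>
  define \<psi>' where "\<psi>' j v = (if j = s \<or> v = s then of_bool (j = v) else \<psi> j v)" for j v
  have in_S': "j \<in> S' \<longleftrightarrow> j \<in> S \<and> j \<noteq> s" for j by (auto simp: S'_def)
  have \<psi>'s: "\<psi>' s v = of_bool (s = v)" "\<psi>' v s = of_bool (v = s)" for v by (auto simp: \<psi>'_def)
  have \<psi>'1: "(\<Sum>v\<in>S'. \<psi>' j v * f v) = (\<Sum>v\<in>S'. \<psi> j v * f v)"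
    "(\<Sum>v\<in>S'. f v * \<psi>' j v) = (\<Sum>v\<in>S'. f v * \<psi> j v)"
    "(\<Sum>v\<in>S'. \<psi>' v j * f v) = (\<Sum>v\<in>S'. \<psi> v j * f v)"
    "(\<Sum>v\<in>S'. f v * \<psi>' v j) = (\<Sum>v\<in>S'. f v * \<psi> v j)" if "j \<in> S'" for f j
    using that by (auto intro!: sum.cong simp: \<psi>'_def S'_def)
  have \<psi>'0: "(\<Sum>v\<in>S'. of_bool (s = v) * f v) = 0" "(\<Sum>v\<in>S'. f v * of_bool (s = v)) = 0"
    "(\<Sum>v\<in>S'. of_bool (v = s) * f v) = 0" "(\<Sum>v\<in>S'. f v * of_bool (v = s)) = 0" for f :: "'a \<Rightarrow> real"
    by (auto intro!: sum.neutral simp: S'_def)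
  have "eigenbasis S g \<psi>' (F(s := E0))"
    unfolding eigenbasis_def orthobasis_def
  proof (intro conjI ballI)
    fix j k assume jk: "j \<in> S" "k \<in> S"
    show "(\<Sum>v\<in>S. \<psi>' j v * \<psi>' k v) = of_bool (j = k)"
    proof (cases "j = s \<or> k = s")
      case True then show ?thesis
        by (elim disjE; hypsubst) (simp_all add: split \<psi>'s \<psi>'0)
    next
      case False then show ?thesis using jk ob(1)[of j k] unfolding split \<psi>'s
        by (simp add: \<psi>'1 in_S')
    qed
    show "(\<Sum>i\<in>S. \<psi>' i j * \<psi>' i k) = of_bool (j = k)"
    proof (cases "j = s \<or> k = s")
      case True then show ?thesis
        by (elim disjE; hypsubst) (simp_all add: split \<psi>'s \<psi>'0)
    next
      case False then show ?thesis using jk ob(2)[of j k] unfolding split \<psi>'s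
        by (auto simp: \<psi>'1 in_S')
    qed
  next
    fix j v assume jv: "j \<in> S" "v \<in> S"
    show "(\<Sum>w\<in>S. g v w * \<psi>' j w) = (F(s := E0)) j * \<psi>' j v"
    proof (cases "j = s")
      case True then show ?thesis
        using gs[OF jv(2)] by (cases "v = s"; hypsubst) (simp_all add: split \<psi>'s \<psi>'0)
    next
      case j: False
      then have jS: "j \<in> S'" using jv by (simp add: in_S')
      show ?thesis
      proof (cases "v = s")
        case True
        have "g s w = 0" if "w \<in> S'" for w using gs[of w] gsym[of s w] that by (simp add: in_S')
        then show ?thesis using True j unfolding split by (simp add: \<psi>'s)
      next
        case False
        then show ?thesis unfolding split \<psi>'s \<psi>'1(2)[OF jS]
          using eigenbasisD(2)[OF eb jS, of v] jv j gs by (simp add: in_S' \<psi>'_def)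
      qed
    qed
  qed
  then show ?case
    unfolding g_def by (intro exI) (rule eigenbasis_conjugate[OF S U(1,2)])
qed

section \<open>Perturbation of the potential\<close>

lemma orthobasis_inner:
  assumes S: "finite S" and ob: "orthobasis S \<psi>"
  shows "(\<Sum>k\<in>S. (\<Sum>v\<in>S. x v * \<psi> k v) * (\<Sum>v\<in>S. y v * \<psi> k v)) = (\<Sum>v\<in>S. x v * y v)"
proof -
  have "(\<Sum>k\<in>S. (\<Sum>v\<in>S. x v * \<psi> k v) * (\<Sum>v\<in>S. y v * \<psi> k v))
      = (\<Sum>k\<in>S. \<Sum>v\<in>S. \<Sum>w\<in>S. x v * y w * (\<psi> k v * \<psi> k w))"
    by (simp add: sum_product mult_ac)
  also have "\<dots> = (\<Sum>v\<in>S. \<Sum>k\<in>S. \<Sum>w\<in>S. x v * y w * (\<psi> k v * \<psi> k w))"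
    by (rule sum.swap)
  also have "\<dots> = (\<Sum>v\<in>S. \<Sum>w\<in>S. \<Sum>k\<in>S. x v * y w * (\<psi> k v * \<psi> k w))"
    by (intro sum.cong refl sum.swap)
  also have "\<dots> = (\<Sum>v\<in>S. \<Sum>w\<in>S. x v * y w * of_bool (v = w))"
    by (intro sum.cong refl) (simp add: orthobasisD(2)[OF ob] flip: sum_distrib_left)
  also have "\<dots> = (\<Sum>v\<in>S. x v * y v)"
    using S by (intro sum.cong refl) (simp add: sum_mult_of_bool)
  finally show ?thesis .
qed

lemma orthobasis_parseval:
  assumes "finite S" "orthobasis S \<psi>"
  shows "(\<Sum>k\<in>S. (\<Sum>v\<in>S. x v * \<psi> k v)\<^sup>2) = (\<Sum>v\<in>S. (x v)\<^sup>2)"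
  using orthobasis_inner[OF assms, of x x] by (simp add: power2_eq_square)

lemma orthobasis_expansion:
  assumes S: "finite S" and ob: "orthobasis S \<psi>" and v: "v \<in> S"
  shows "(\<Sum>k\<in>S. (\<Sum>w\<in>S. x w * \<psi> k w) * \<psi> k v) = x v"
  using orthobasis_inner[OF S ob, of x "\<lambda>w. of_bool (w = v)"] S v
  by (simp add: sum_mult_of_bool)

lemma orthobasis_swap: "orthobasis S \<phi> \<Longrightarrow> orthobasis S (\<lambda>v j. \<phi> j v)"
  by (simp add: orthobasis_def)

definition perturb :: "('a \<Rightarrow> 'a \<Rightarrow> real) \<Rightarrow> ('a \<Rightarrow> real) \<Rightarrow> 'a \<Rightarrow> 'a \<Rightarrow> real" where
  "perturb A W v w = A v w + (if v = w then W v else 0)"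

lemma sum_perturb:
  assumes "finite S" "v \<in> S"
  shows "(\<Sum>w\<in>S. perturb A W v w * x w) = (\<Sum>w\<in>S. A v w * x w) + W v * x v"
  using assms
  by (simp add: perturb_def distrib_right sum.distrib if_distrib[of "\<lambda>z. z * _"] cong: if_cong)

section \<open>Comparison of two potentials through their eigenbases\<close>

locale eigenbasis_pair =
  fixes S :: "'a set" and A :: "'a \<Rightarrow> 'a \<Rightarrow> real" and W W' :: "'a \<Rightarrow> real"
    and \<phi> \<psi> :: "'a \<Rightarrow> 'a \<Rightarrow> real" and E F :: "'a \<Rightarrow> real"
  assumes fin: "finite S" and sym: "\<And>v w. v \<in> S \<Longrightarrow> w \<in> S \<Longrightarrow> A v w = A w v"
    and eb: "eigenbasis S (perturb A W) \<phi> E" and eb': "eigenbasis S (perturb A W') \<psi> F"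
begin

definition overlap :: "'a \<Rightarrow> 'a \<Rightarrow> real" where
  "overlap j k = (\<Sum>v\<in>S. \<phi> j v * \<psi> k v)"

lemma ob: "orthobasis S \<phi>" and ob': "orthobasis S \<psi>"
  using eb eb' by (auto simp: eigenbasis_def)

text \<open>The squared overlaps form a doubly stochastic matrix. It transports sums over one
  spectrum to the other without matching up individual eigenvalues.\<close>

lemma sum_overlap_right: "j \<in> S \<Longrightarrow> (\<Sum>k\<in>S. (overlap j k)\<^sup>2) = 1"
  unfolding overlap_def orthobasis_parseval[OF fin ob']
  using orthobasisD(1)[OF ob, of j j] by (simp add: power2_eq_square)

lemma sum_overlap_left: "k \<in> S \<Longrightarrow> (\<Sum>j\<in>S. (overlap j k)\<^sup>2) = 1"
proof -
  assume k: "k \<in> S"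
  have "(\<Sum>j\<in>S. (overlap j k)\<^sup>2) = (\<Sum>j\<in>S. (\<Sum>v\<in>S. \<psi> k v * \<phi> j v)\<^sup>2)"
    by (simp add: overlap_def mult.commute)
  also have "\<dots> = 1"
    unfolding orthobasis_parseval[OF fin ob]
    using orthobasisD(1)[OF ob', of k k] k by (simp add: power2_eq_square)
  finally show ?thesis .
qed

text \<open>Evaluating \<open>A\<close> between the two eigenvectors from either side gives the same
  number by symmetry, so only the difference of the potentials survives.\<close>

lemma overlap_gap:
  assumes "j \<in> S" "k \<in> S"
  shows "(F k - E j) * overlap j k = (\<Sum>v\<in>S. ((W' v - W v) * \<phi> j v) * \<psi> k v)"
proof -
  have 1: "(\<Sum>w\<in>S. A v w * \<phi> j w) = (E j - W v) * \<phi> j v" if "v \<in> S" for v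
    using eigenbasisD(2)[OF eb assms(1) that] sum_perturb[OF fin that, of A W]
    by (simp add: algebra_simps)
  have 2: "(\<Sum>w\<in>S. A v w * \<psi> k w) = (F k - W' v) * \<psi> k v" if "v \<in> S" for v
    using eigenbasisD(2)[OF eb' assms(2) that] sum_perturb[OF fin that, of A W']
    by (simp add: algebra_simps)
  have "(\<Sum>v\<in>S. (F k - W' v) * \<psi> k v * \<phi> j v) = (\<Sum>v\<in>S. (\<Sum>w\<in>S. A v w * \<psi> k w) * \<phi> j v)"
    by (intro sum.cong refl) (simp add: 2)
  also have "\<dots> = (\<Sum>v\<in>S. \<Sum>w\<in>S. A v w * \<psi> k w * \<phi> j v)"
    by (simp add: sum_distrib_right)
  also have "\<dots> = (\<Sum>w\<in>S. \<Sum>v\<in>S. A v w * \<psi> k w * \<phi> j v)"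
    by (rule sum.swap)
  also have "\<dots> = (\<Sum>w\<in>S. \<Sum>v\<in>S. A w v * \<phi> j v * \<psi> k w)"
    by (intro sum.cong refl) (simp add: sym)
  also have "\<dots> = (\<Sum>w\<in>S. (\<Sum>v\<in>S. A w v * \<phi> j v) * \<psi> k w)"
    by (simp add: sum_distrib_right)
  also have "\<dots> = (\<Sum>v\<in>S. (E j - W v) * \<phi> j v * \<psi> k v)"
    by (intro sum.cong refl) (simp add: 1)
  finally have "(\<Sum>v\<in>S. (F k - W' v) * \<psi> k v * \<phi> j v) - (\<Sum>v\<in>S. (E j - W v) * \<phi> j v * \<psi> k v) = 0"
    by simp
  then have "(\<Sum>v\<in>S. (F k - E j) * (\<phi> j v * \<psi> k v) - (W' v - W v) * \<phi> j v * \<psi> k v) = 0"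
    unfolding sum_subtractf[symmetric] by (simp add: algebra_simps)
  then show ?thesis
    by (simp add: overlap_def sum_distrib_left sum_subtractf)
qed

text \<open>Under the weights \<open>(overlap j k)\<^sup>2\<close> the gap \<open>F k - E j\<close>
  is a random variable in \<open>k\<close>; its mean is found here and its second moment next, both
  in terms of the potentials.\<close>

lemma sum_overlap_gap:
  assumes j: "j \<in> S"
  shows "(\<Sum>k\<in>S. (overlap j k)\<^sup>2 * (F k - E j)) = (\<Sum>v\<in>S. (W' v - W v) * (\<phi> j v)\<^sup>2)"
proof -
  have "(\<Sum>k\<in>S. (overlap j k)\<^sup>2 * (F k - E j))
      = (\<Sum>k\<in>S. (\<Sum>v\<in>S. \<phi> j v * \<psi> k v) * (\<Sum>v\<in>S. ((W' v - W v) * \<phi> j v) * \<psi> k v))"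
    by (intro sum.cong refl)
      (simp add: overlap_gap[OF j, symmetric] power2_eq_square flip: overlap_def)
  also have "\<dots> = (\<Sum>v\<in>S. \<phi> j v * ((W' v - W v) * \<phi> j v))"
    by (rule orthobasis_inner[OF fin ob'])
  finally show ?thesis by (simp add: power2_eq_square mult_ac)
qed

lemma sum_overlap_gap_squared:
  assumes j: "j \<in> S"
  shows "(\<Sum>k\<in>S. (overlap j k)\<^sup>2 * (F k - E j)\<^sup>2) = (\<Sum>v\<in>S. (W' v - W v)\<^sup>2 * (\<phi> j v)\<^sup>2)"
proof -
  have "(\<Sum>k\<in>S. (overlap j k)\<^sup>2 * (F k - E j)\<^sup>2)
      = (\<Sum>k\<in>S. (\<Sum>v\<in>S. ((W' v - W v) * \<phi> j v) * \<psi> k v)\<^sup>2)"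
    by (intro sum.cong refl) (simp add: overlap_gap[OF j, symmetric] power_mult_distrib)
  then show ?thesis
    unfolding orthobasis_parseval[OF fin ob'] by (simp add: power_mult_distrib)
qed

lemma sum_overlap_gap_total:
  "(\<Sum>j\<in>S. \<Sum>k\<in>S. (overlap j k)\<^sup>2 * (F k - E j)\<^sup>2) = (\<Sum>v\<in>S. (W' v - W v)\<^sup>2)"
proof -
  have "(\<Sum>j\<in>S. \<Sum>k\<in>S. (overlap j k)\<^sup>2 * (F k - E j)\<^sup>2)
      = (\<Sum>j\<in>S. \<Sum>v\<in>S. (W' v - W v)\<^sup>2 * (\<phi> j v)\<^sup>2)"
    by (rule sum.cong[OF refl]) (rule sum_overlap_gap_squared)
  also have "\<dots> = (\<Sum>v\<in>S. (W' v - W v)\<^sup>2 * (\<Sum>j\<in>S. \<phi> j v * \<phi> j v))"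
    by (subst sum.swap) (simp add: sum_distrib_left power2_eq_square)
  also have "\<dots> = (\<Sum>v\<in>S. (W' v - W v)\<^sup>2)"
    by (intro sum.cong refl) (simp add: orthobasisD(2)[OF ob])
  finally show ?thesis .
qed

text \<open>Klein's inequality: the trace of \<open>g\<close> inherits Taylor's formula from \<open>g\<close>.\<close>

lemma trace_taylor_bound:
  assumes g: "\<And>x y. g y \<le> g x + g' x * (y - x) + M * (y - x)\<^sup>2"
  shows "(\<Sum>k\<in>S. g (F k)) \<le> (\<Sum>j\<in>S. g (E j))
    + (\<Sum>v\<in>S. (W' v - W v) * (\<Sum>j\<in>S. g' (E j) * (\<phi> j v)\<^sup>2)) + M * (\<Sum>v\<in>S. (W' v - W v)\<^sup>2)"
proof -
  have "(\<Sum>k\<in>S. g (F k)) = (\<Sum>k\<in>S. \<Sum>j\<in>S. (overlap j k)\<^sup>2 * g (F k))"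
    by (intro sum.cong refl) (simp add: sum_overlap_left flip: sum_distrib_right)
  also have "\<dots> = (\<Sum>j\<in>S. \<Sum>k\<in>S. (overlap j k)\<^sup>2 * g (F k))"
    by (rule sum.swap)
  also have "\<dots> \<le> (\<Sum>j\<in>S. \<Sum>k\<in>S. (overlap j k)\<^sup>2 * (g (E j) + g' (E j) * (F k - E j) + M * (F k - E j)\<^sup>2))"
    by (intro sum_mono mult_left_mono g) auto
  also have "\<dots> = (\<Sum>j\<in>S. g (E j) * (\<Sum>k\<in>S. (overlap j k)\<^sup>2)
      + g' (E j) * (\<Sum>k\<in>S. (overlap j k)\<^sup>2 * (F k - E j))
      + M * (\<Sum>k\<in>S. (overlap j k)\<^sup>2 * (F k - E j)\<^sup>2))"
    unfolding sum_distrib_left sum.distrib[symmetric]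
    by (intro sum.cong refl) (simp add: algebra_simps)
  also have "\<dots> = (\<Sum>j\<in>S. g (E j) + g' (E j) * (\<Sum>v\<in>S. (W' v - W v) * (\<phi> j v)\<^sup>2)
      + M * (\<Sum>k\<in>S. (overlap j k)\<^sup>2 * (F k - E j)\<^sup>2))"
    by (intro sum.cong refl) (simp add: sum_overlap_right sum_overlap_gap)
  also have "\<dots> = (\<Sum>j\<in>S. g (E j)) + (\<Sum>j\<in>S. \<Sum>v\<in>S. g' (E j) * ((W' v - W v) * (\<phi> j v)\<^sup>2))
      + M * (\<Sum>v\<in>S. (W' v - W v)\<^sup>2)"
    by (simp add: sum.distrib sum_overlap_gap_total sum_distrib_left[symmetric])
  also have "(\<Sum>j\<in>S. \<Sum>v\<in>S. g' (E j) * ((W' v - W v) * (\<phi> j v)\<^sup>2))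
      = (\<Sum>v\<in>S. \<Sum>j\<in>S. g' (E j) * ((W' v - W v) * (\<phi> j v)\<^sup>2))"
    by (rule sum.swap)
  also have "\<dots> = (\<Sum>v\<in>S. (W' v - W v) * (\<Sum>j\<in>S. g' (E j) * (\<phi> j v)\<^sup>2))"
    unfolding sum_distrib_left by (intro sum.cong refl) (simp only: mult_ac)
  finally show ?thesis .
qed

text \<open>
  The difference of the two diagonals is bounded by the Hilbert--Schmidt norm of
  \<open>g(H') - g(H)\<close>, in which a Lipschitz function of the energies can be inserted entrywise.
\<close>

lemma diagonal_lipschitz:
  assumes g: "\<And>x y. \<bar>g x - g y\<bar> \<le> \<Lambda> * \<bar>x - y\<bar>"
  shows "(\<Sum>v\<in>S. ((\<Sum>j\<in>S. g (E j) * (\<phi> j v)\<^sup>2) - (\<Sum>k\<in>S. g (F k) * (\<psi> k v)\<^sup>2))\<^sup>2)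
    \<le> \<Lambda>\<^sup>2 * (\<Sum>v\<in>S. (W' v - W v)\<^sup>2)"
proof -
  \<comment> \<open>\<open>d\<close> is the matrix of g(H) - g(H') between the two
    eigenbases.\<close>
  define d where "d j k = overlap j k * (g (E j) - g (F k))" for j k
  have ex1: "(\<Sum>k\<in>S. overlap j k * \<psi> k v) = \<phi> j v" if "v \<in> S" for j v
    unfolding overlap_def by (rule orthobasis_expansion[OF fin ob' that])
  have ex2: "(\<Sum>j\<in>S. overlap j k * \<phi> j v) = \<psi> k v" if "v \<in> S" for k v
    using orthobasis_expansion[OF fin ob that, of "\<psi> k"] by (simp add: overlap_def mult.commute)
  have diff: "(\<Sum>j\<in>S. g (E j) * (\<phi> j v)\<^sup>2) - (\<Sum>k\<in>S. g (F k) * (\<psi> k v)\<^sup>2)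
      = (\<Sum>j\<in>S. \<phi> j v * (\<Sum>k\<in>S. d j k * \<psi> k v))" if v: "v \<in> S" for v
  proof -
    have "(\<Sum>j\<in>S. \<phi> j v * (\<Sum>k\<in>S. d j k * \<psi> k v))
        = (\<Sum>j\<in>S. \<Sum>k\<in>S. g (E j) * \<phi> j v * (overlap j k * \<psi> k v) - g (F k) * \<psi> k v * (overlap j k * \<phi> j v))"
      unfolding sum_distrib_left by (intro sum.cong refl) (simp add: d_def algebra_simps)
    also have "\<dots> = (\<Sum>j\<in>S. \<Sum>k\<in>S. g (E j) * \<phi> j v * (overlap j k * \<psi> k v))
        - (\<Sum>k\<in>S. \<Sum>j\<in>S. g (F k) * \<psi> k v * (overlap j k * \<phi> j v))"
      unfolding sum_subtractf by (simp add: sum.swap[of "\<lambda>k j. g (F k) * \<psi> k v * (overlap j k * \<phi> j v)"])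
    also have "\<dots> = (\<Sum>j\<in>S. g (E j) * (\<phi> j v)\<^sup>2) - (\<Sum>k\<in>S. g (F k) * (\<psi> k v)\<^sup>2)"
      unfolding sum_distrib_left[symmetric] by (simp add: ex1[OF v] ex2[OF v] power2_eq_square mult.assoc)
    finally show ?thesis by simp
  qed
  have "(\<Sum>v\<in>S. ((\<Sum>j\<in>S. g (E j) * (\<phi> j v)\<^sup>2) - (\<Sum>k\<in>S. g (F k) * (\<psi> k v)\<^sup>2))\<^sup>2)
      = (\<Sum>v\<in>S. (\<Sum>j\<in>S. \<phi> j v * (\<Sum>k\<in>S. d j k * \<psi> k v))\<^sup>2)"
    by (intro sum.cong refl) (simp only: diff)
  also have "\<dots> \<le> (\<Sum>v\<in>S. (\<Sum>j\<in>S. (\<phi> j v)\<^sup>2) * (\<Sum>j\<in>S. (\<Sum>k\<in>S. d j k * \<psi> k v)\<^sup>2))"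
    by (intro sum_mono Cauchy_Schwarz_ineq_sum)
  also have "\<dots> = (\<Sum>v\<in>S. \<Sum>j\<in>S. (\<Sum>k\<in>S. d j k * \<psi> k v)\<^sup>2)"
    by (intro sum.cong refl) (use orthobasisD(2)[OF ob] in \<open>simp add: power2_eq_square\<close>)
  also have "\<dots> = (\<Sum>j\<in>S. \<Sum>v\<in>S. (\<Sum>k\<in>S. d j k * \<psi> k v)\<^sup>2)"
    by (rule sum.swap)
  also have "\<dots> = (\<Sum>j\<in>S. \<Sum>k\<in>S. (d j k)\<^sup>2)"
    using orthobasis_parseval[OF fin orthobasis_swap[OF ob']] by simp
  also have "\<dots> \<le> (\<Sum>j\<in>S. \<Sum>k\<in>S. \<Lambda>\<^sup>2 * ((overlap j k)\<^sup>2 * (F k - E j)\<^sup>2))"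
  proof (intro sum_mono)
    fix j k
    have "(g (E j) - g (F k))\<^sup>2 \<le> \<Lambda>\<^sup>2 * (F k - E j)\<^sup>2"
      using power_mono[OF g[of "E j" "F k"], of 2]
      by (simp add: power_mult_distrib power2_commute)
    then show "(d j k)\<^sup>2 \<le> \<Lambda>\<^sup>2 * ((overlap j k)\<^sup>2 * (F k - E j)\<^sup>2)"
      unfolding d_def power_mult_distrib mult.left_commute[of "\<Lambda>\<^sup>2"]
      by (rule mult_left_mono) simp
  qed
  also have "\<dots> = \<Lambda>\<^sup>2 * (\<Sum>v\<in>S. (W' v - W v)\<^sup>2)"
    by (simp add: sum_overlap_gap_total flip: sum_distrib_left)
  finally show ?thesis .
qed

end

section \<open>Spectral means for a chosen eigensystem\<close>

definition eigensystem :: "'a set \<Rightarrow> ('a \<Rightarrow> 'a \<Rightarrow> real) \<Rightarrow> ('a \<Rightarrow> 'a \<Rightarrow> real) \<times> ('a \<Rightarrow> real)" where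
  "eigensystem S h = (SOME p. eigenbasis S h (fst p) (snd p))"

definition eigenvector_at :: "'a set \<Rightarrow> ('a \<Rightarrow> 'a \<Rightarrow> real) \<Rightarrow> 'a \<Rightarrow> 'a \<Rightarrow> real" where
  "eigenvector_at S h = fst (eigensystem S h)"

definition eigenvalue_at :: "'a set \<Rightarrow> ('a \<Rightarrow> 'a \<Rightarrow> real) \<Rightarrow> 'a \<Rightarrow> real" where
  "eigenvalue_at S h = snd (eigensystem S h)"

text \<open>The diagonal entry at \<open>v\<close> of g(h), that is, the integral of
  \<open>g\<close> against the spectral measure at \<open>v\<close>.\<close>

definition spectral_mean :: "'a set \<Rightarrow> ('a \<Rightarrow> 'a \<Rightarrow> real) \<Rightarrow> (real \<Rightarrow> real) \<Rightarrow> 'a \<Rightarrow> real" where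
  "spectral_mean S h g v = (\<Sum>j\<in>S. g (eigenvalue_at S h j) * (eigenvector_at S h j v)\<^sup>2)"

definition symmetric_on :: "'a set \<Rightarrow> ('a \<Rightarrow> 'a \<Rightarrow> real) \<Rightarrow> bool" where
  "symmetric_on S A \<longleftrightarrow> (\<forall>v\<in>S. \<forall>w\<in>S. A v w = A w v)"

lemma eigenbasis_eigensystem:
  assumes "finite S" "symmetric_on S h"
  shows "eigenbasis S h (eigenvector_at S h) (eigenvalue_at S h)"
proof -
  obtain \<phi> E where "eigenbasis S h \<phi> E"
    using exists_eigenbasis[of S h] assms by (auto simp: symmetric_on_def)
  then have "eigenbasis S h (fst (\<phi>, E)) (snd (\<phi>, E))" by simp
  then show ?thesis
    unfolding eigenvector_at_def eigenvalue_at_def eigensystem_def by (rule someI)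
qed

lemma symmetric_on_perturb: "symmetric_on S A \<Longrightarrow> symmetric_on S (perturb A W)"
  by (auto simp: symmetric_on_def perturb_def)

lemma eigenbasis_pair_eigensystem:
  assumes "finite S" "symmetric_on S A"
  shows "eigenbasis_pair S A W W' (eigenvector_at S (perturb A W)) (eigenvector_at S (perturb A W'))
    (eigenvalue_at S (perturb A W)) (eigenvalue_at S (perturb A W'))"
  using assms eigenbasis_eigensystem[OF assms(1) symmetric_on_perturb[OF assms(2)]]
  by (simp add: eigenbasis_pair_def symmetric_on_def)

lemma spectral_mean_lipschitz:
  assumes "finite S" "symmetric_on S A" "\<And>x y. \<bar>g x - g y\<bar> \<le> \<Lambda> * \<bar>x - y\<bar>"
  shows "(\<Sum>v\<in>S. (spectral_mean S (perturb A W) g v - spectral_mean S (perturb A W') g v)\<^sup>2)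
    \<le> \<Lambda>\<^sup>2 * (\<Sum>v\<in>S. (W' v - W v)\<^sup>2)"
  using eigenbasis_pair.diagonal_lipschitz[OF eigenbasis_pair_eigensystem[OF assms(1,2)] assms(3)]
  unfolding spectral_mean_def .

lemma spectral_mean_add:
  "spectral_mean S h (\<lambda>x. f x + g x) v = spectral_mean S h f v + spectral_mean S h g v"
  by (simp add: spectral_mean_def sum.distrib distrib_right)

lemma spectral_mean_scale: "spectral_mean S h (\<lambda>x. c * f x) v = c * spectral_mean S h f v"
  by (simp add: spectral_mean_def sum_distrib_left mult.assoc)

lemma spectral_mean_one:
  assumes "finite S" "symmetric_on S h" "v \<in> S"
  shows "spectral_mean S h (\<lambda>_. 1) v = 1"
  using orthobasisD(2)[OF eigenbasisD(1)[OF eigenbasis_eigensystem[OF assms(1,2)]] assms(3,3)]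
  by (simp add: spectral_mean_def power2_eq_square)

lemma spectral_mean_mono:
  assumes "\<And>x. f x \<le> g x"
  shows "spectral_mean S h f v \<le> spectral_mean S h g v"
  unfolding spectral_mean_def by (intro sum_mono mult_right_mono assms) auto

lemma spectral_mean_bound:
  assumes "finite S" "symmetric_on S h" "v \<in> S" "\<And>x. \<bar>g x\<bar> \<le> B"
  shows "\<bar>spectral_mean S h g v\<bar> \<le> B"
proof -
  have "spectral_mean S h g v \<le> spectral_mean S h (\<lambda>x. B * 1) v"
    "spectral_mean S h (\<lambda>x. -B * 1) v \<le> spectral_mean S h g v"
    using assms(4) by (auto intro!: spectral_mean_mono simp: abs_le_iff) (smt (verit) assms(4))+
  then show ?thesis
    unfolding spectral_mean_scale using spectral_mean_one[OF assms(1-3)] by auto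
qed

text \<open>Lipschitz continuity of \<open>g'\<close> yields the quadratic Taylor bound for traces,
  boundedness of \<open>g'\<close> the stability of spectral means under later perturbations. The
  class is closed under sums, products and composition, so it contains all node weights.\<close>

definition tame :: "(real \<Rightarrow> real) \<Rightarrow> (real \<Rightarrow> real) \<Rightarrow> bool" where
  "tame g g' \<longleftrightarrow> (\<exists>B>0. \<forall>x y. (g has_real_derivative g' x) (at x) \<and>
     \<bar>g x\<bar> \<le> B \<and> \<bar>g' x\<bar> \<le> B \<and> \<bar>g' x - g' y\<bar> \<le> B * \<bar>x - y\<bar>)"

lemma lipschitz_of_derivative_bound:
  assumes "\<And>x. (g has_real_derivative g' x) (at x)" "\<And>x. \<bar>g' x\<bar> \<le> B"
  shows "\<bar>g x - g y\<bar> \<le> B * \<bar>x - y\<bar>"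
  using field_differentiable_bound[of UNIV g g' B x y] assms by auto

lemma taylor_bound_of_lipschitz_derivative:
  assumes d: "\<And>x. (g has_real_derivative g' x) (at x)"
    and B: "\<And>x y. \<bar>g' x - g' y\<bar> \<le> B * \<bar>x - y\<bar>"
  shows "g y \<le> g x + g' x * (y - x) + B * (y - x)\<^sup>2"
proof (cases "x = y")
  case False
  obtain z where z: "g y - g x = (y - x) * g' z" "\<bar>z - x\<bar> \<le> \<bar>y - x\<bar>"
  proof (cases "x < y")
    case True
    obtain z where "x < z" "z < y" "g y - g x = (y - x) * g' z"
      using MVT2[OF True, of g g'] d by blast
    then show ?thesis using that[of z] by auto
  next
    case F: False
    then have yx: "y < x" using False by simp
    obtain z where "y < z" "z < x" "g x - g y = (x - y) * g' z"
      using MVT2[OF yx, of g g'] d by blast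
    then show ?thesis using that[of z] by (auto simp: algebra_simps)
  qed
  have B0: "0 \<le> B" using B[of 1 0] by simp
  have "(y - x) * (g' z - g' x) \<le> \<bar>y - x\<bar> * \<bar>g' z - g' x\<bar>"
    by (simp flip: abs_mult)
  also have "\<dots> \<le> \<bar>y - x\<bar> * (B * \<bar>y - x\<bar>)"
    using B[of z x] z(2) B0 by (intro mult_left_mono order_trans[OF B]) (auto intro: mult_left_mono)
  also have "\<dots> = B * (y - x)\<^sup>2" by (simp add: power2_eq_square)
  finally show ?thesis using z(1) by (simp add: algebra_simps)
qed simp

lemma exists_near_minimiser:
  fixes F :: "'b \<Rightarrow> real"
  assumes "\<And>x. b \<le> F x" "\<tau> > 0"
  shows "\<exists>x. \<forall>y. F x \<le> F y + \<tau>"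
proof -
  have bdd: "bdd_below (range F)" using assms(1) by (intro bdd_belowI[of _ b]) auto
  have "Inf (range F) < Inf (range F) + \<tau>" using assms(2) by simp
  then obtain x where "F x < Inf (range F) + \<tau>"
    using cInf_lessD[of "range F" "Inf (range F) + \<tau>"] by auto
  then have "\<forall>y. F x \<le> F y + \<tau>" using cInf_lower[OF _ bdd] by (smt (verit) rangeI)
  then show ?thesis by blast
qed

text \<open>
  The potential \<open>W\<close> nearly minimises \<open>Tr g(H\<^sub>W) + a |W - V|\<^sup>2\<close>; a gradient step from \<open>W\<close> shows
  that the gradient is small there.
\<close>

lemma exists_near_critical_potential:
  fixes V :: "'a \<Rightarrow> real"
  assumes S: "finite S" "symmetric_on S A" and g: "tame g g'" "\<And>x. \<bar>g x\<bar> \<le> \<kappa>"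
    and a: "a > 0" and \<xi>: "\<xi> > 0"
  shows "\<exists>W. (\<Sum>v\<in>S. (spectral_mean S (perturb A W) g' v + 2 * a * (W v - V v))\<^sup>2) \<le> \<xi> \<and>
    a * (\<Sum>v\<in>S. (W v - V v)\<^sup>2) \<le> 2 * \<kappa> * card S + \<xi>"
proof -
  obtain B where B: "B > 0" "\<And>x. (g has_real_derivative g' x) (at x)"
    "\<And>x y. \<bar>g' x - g' y\<bar> \<le> B * \<bar>x - y\<bar>"
    using g(1) unfolding tame_def by blast
  note taylor = taylor_bound_of_lipschitz_derivative[of g g' B, OF B(2,3)]
  define tr where "tr W = (\<Sum>j\<in>S. g (eigenvalue_at S (perturb A W) j))" for W
  have tr: "\<bar>tr W\<bar> \<le> \<kappa> * card S" for W
  proof -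
    have "\<bar>tr W\<bar> \<le> (\<Sum>j\<in>S. \<bar>g (eigenvalue_at S (perturb A W) j)\<bar>)"
      unfolding tr_def by (rule sum_abs)
    also have "\<dots> \<le> (\<Sum>j\<in>S. \<kappa>)" by (intro sum_mono g)
    finally show ?thesis by (simp add: mult.commute)
  qed
  define F where "F W = tr W + a * (\<Sum>v\<in>S. (W v - V v)\<^sup>2)" for W
  define c where "c = B + a"
  have c: "c > 0" using a B(1) by (simp add: c_def)
  \<comment> \<open>The gradient step below lowers \<open>F\<close> by the sum of G^2 divided by 4c,
    so near minimality up to \<tau> bounds that sum by 4c\<tau>; the part \<tau> \<le> \<xi> serves
    the estimate of W - V.\<close>
  define \<tau> where "\<tau> = min \<xi> (\<xi> / (4 * c))"
  have \<tau>: "\<tau> > 0" "\<tau> \<le> \<xi>" using \<xi> c by (auto simp: \<tau>_def)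
  have "\<tau> \<le> \<xi> / (4 * c)" by (simp add: \<tau>_def)
  then have \<tau>3: "4 * c * \<tau> \<le> \<xi>" using c by (simp add: field_simps)
  have "- (\<kappa> * card S) \<le> F W" for W
    using tr[of W] a by (simp add: F_def) (smt (verit) mult_nonneg_nonneg sum_nonneg zero_le_power2)
  then obtain W where W: "\<And>W'. F W \<le> F W' + \<tau>"
    using exists_near_minimiser[of _ F \<tau>] \<tau>(1) by blast
  define G where "G v = spectral_mean S (perturb A W) g' v + 2 * a * (W v - V v)" for v
  \<comment> \<open>The step length that minimises -t + c t^2.\<close>
  define t where "t = 1 / (2 * c)"
  have t: "t > 0" "(B + a) * t\<^sup>2 = t / 2"
    using c by (auto simp: t_def power2_eq_square divide_simps simp flip: c_def)
  define W' where "W' v = W v - t * G v" for v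
  have "tr W' \<le> tr W + (\<Sum>v\<in>S. (W' v - W v) * spectral_mean S (perturb A W) g' v)
      + B * (\<Sum>v\<in>S. (W' v - W v)\<^sup>2)"
    unfolding tr_def spectral_mean_def
    by (rule eigenbasis_pair.trace_taylor_bound[OF eigenbasis_pair_eigensystem[OF S] taylor])
  moreover have "a * (\<Sum>v\<in>S. (W' v - V v)\<^sup>2) = a * (\<Sum>v\<in>S. (W v - V v)\<^sup>2)
      + (\<Sum>v\<in>S. (W' v - W v) * (2 * a * (W v - V v))) + a * (\<Sum>v\<in>S. (W' v - W v)\<^sup>2)"
    unfolding sum_distrib_left sum.distrib[symmetric]
    by (intro sum.cong refl) (simp add: power2_eq_square algebra_simps)
  ultimately have "F W' \<le> F W + (\<Sum>v\<in>S. (W' v - W v) * G v) + (B + a) * (\<Sum>v\<in>S. (W' v - W v)\<^sup>2)"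
    by (simp add: F_def G_def distrib_left distrib_right sum.distrib)
  also have "(\<Sum>v\<in>S. (W' v - W v) * G v) = - t * (\<Sum>v\<in>S. (G v)\<^sup>2)"
    unfolding sum_distrib_left by (intro sum.cong refl) (simp add: W'_def power2_eq_square)
  also have "(\<Sum>v\<in>S. (W' v - W v)\<^sup>2) = t\<^sup>2 * (\<Sum>v\<in>S. (G v)\<^sup>2)"
    unfolding sum_distrib_left by (intro sum.cong refl) (simp add: W'_def power_mult_distrib)
  finally have "F W' \<le> F W - t / 2 * (\<Sum>v\<in>S. (G v)\<^sup>2)"
    using t(2) by (simp add: mult.assoc[symmetric])
  then have "t / 2 * (\<Sum>v\<in>S. (G v)\<^sup>2) \<le> \<tau>" using W[of W'] by simp
  then have "(\<Sum>v\<in>S. (G v)\<^sup>2) \<le> 4 * c * \<tau>"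
    using c by (simp add: t_def field_simps)
  then have "(\<Sum>v\<in>S. (G v)\<^sup>2) \<le> \<xi>" using \<tau>3 by simp
  moreover have "F W \<le> tr V + \<tau>" using W[of V] by (simp add: F_def)
  then have "a * (\<Sum>v\<in>S. (W v - V v)\<^sup>2) \<le> 2 * \<kappa> * card S + \<xi>"
    using tr[of V] tr[of W] \<tau>(2) by (simp add: F_def)
  ultimately show ?thesis unfolding G_def by blast
qed

section \<open>Smoothed square waves\<close>

lemma tameI:
  assumes "\<And>x. (g has_real_derivative g' x) (at x)" "\<And>x. \<bar>g x\<bar> \<le> B1" "\<And>x. \<bar>g' x\<bar> \<le> B2"
    "\<And>x y. \<bar>g' x - g' y\<bar> \<le> B3 * \<bar>x - y\<bar>"
  shows "tame g g'"
proof -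
  define B where "B = max 1 (max B1 (max B2 B3))"
  have "\<bar>g' x - g' y\<bar> \<le> B * \<bar>x - y\<bar>" for x y
  proof (rule order_trans[OF assms(4)])
    show "B3 * \<bar>x - y\<bar> \<le> B * \<bar>x - y\<bar>" by (rule mult_right_mono) (auto simp: B_def)
  qed
  moreover have "\<bar>g x\<bar> \<le> B" "\<bar>g' x\<bar> \<le> B" "B > 0" for x
    using assms(2)[of x] assms(3)[of x] by (auto simp: B_def)
  ultimately show ?thesis unfolding tame_def using assms(1) by blast
qed

lemma tameE:
  assumes "tame g g'"
  obtains B where "B > 0" "\<And>x. (g has_real_derivative g' x) (at x)" "\<And>x. \<bar>g x\<bar> \<le> B"
    "\<And>x. \<bar>g' x\<bar> \<le> B" "\<And>x y. \<bar>g' x - g' y\<bar> \<le> B * \<bar>x - y\<bar>" "\<And>x y. \<bar>g x - g y\<bar> \<le> B * \<bar>x - y\<bar>"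
proof -
  obtain B where B: "B > 0" "\<And>x. (g has_real_derivative g' x) (at x)" "\<And>x. \<bar>g x\<bar> \<le> B"
    "\<And>x. \<bar>g' x\<bar> \<le> B" "\<And>x y. \<bar>g' x - g' y\<bar> \<le> B * \<bar>x - y\<bar>"
    using assms unfolding tame_def by blast
  then show ?thesis using that[of B] lipschitz_of_derivative_bound[of g g' B] by blast
qed

lemma lipschitz_mult:
  fixes f g :: "real \<Rightarrow> real"
  assumes "\<And>x. \<bar>f x\<bar> \<le> B" "\<And>x y. \<bar>f x - f y\<bar> \<le> L * \<bar>x - y\<bar>"
    and "\<And>x. \<bar>g x\<bar> \<le> C" "\<And>x y. \<bar>g x - g y\<bar> \<le> M * \<bar>x - y\<bar>"
  shows "\<bar>f x * g x - f y * g y\<bar> \<le> (L * C + B * M) * \<bar>x - y\<bar>"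
proof -
  have "f x * g x - f y * g y = (f x - f y) * g x + f y * (g x - g y)"
    by (simp add: algebra_simps)
  then have "\<bar>f x * g x - f y * g y\<bar> \<le> \<bar>f x - f y\<bar> * \<bar>g x\<bar> + \<bar>f y\<bar> * \<bar>g x - g y\<bar>"
    by (metis abs_mult abs_triangle_ineq)
  also have "\<dots> \<le> (L * \<bar>x - y\<bar>) * C + B * (M * \<bar>x - y\<bar>)"
  proof (intro add_mono mult_mono assms)
    show "0 \<le> L * \<bar>x - y\<bar>" using assms(2)[of x y] by linarith
    show "0 \<le> B" using assms(1)[of 0] by linarith
  qed auto
  finally show ?thesis by (simp add: algebra_simps)
qed

lemma tame_mult:
  assumes "tame f f'" "tame g g'"
  shows "tame (\<lambda>x. f x * g x) (\<lambda>x. f x * g' x + f' x * g x)"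
proof -
  obtain B where B: "B > 0" "\<And>x. (f has_real_derivative f' x) (at x)" "\<And>x. \<bar>f x\<bar> \<le> B"
    "\<And>x. \<bar>f' x\<bar> \<le> B" "\<And>x y. \<bar>f' x - f' y\<bar> \<le> B * \<bar>x - y\<bar>" "\<And>x y. \<bar>f x - f y\<bar> \<le> B * \<bar>x - y\<bar>"
    using tameE[OF assms(1)] by metis
  obtain C where C: "C > 0" "\<And>x. (g has_real_derivative g' x) (at x)" "\<And>x. \<bar>g x\<bar> \<le> C"
    "\<And>x. \<bar>g' x\<bar> \<le> C" "\<And>x y. \<bar>g' x - g' y\<bar> \<le> C * \<bar>x - y\<bar>" "\<And>x y. \<bar>g x - g y\<bar> \<le> C * \<bar>x - y\<bar>"
    using tameE[OF assms(2)] by metis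
  have m: "\<bar>a * b\<bar> \<le> B * C" if "\<bar>a\<bar> \<le> B" "\<bar>b\<bar> \<le> C" for a b
    unfolding abs_mult using that B(1) by (intro mult_mono) auto
  show ?thesis
  proof (rule tameI)
    show "((\<lambda>x. f x * g x) has_real_derivative f x * g' x + f' x * g x) (at x)" for x
      using DERIV_mult[OF B(2) C(2)] by (simp add: add.commute mult.commute)
    show "\<bar>f x * g x\<bar> \<le> B * C" for x by (intro m B C)
    show "\<bar>f x * g' x + f' x * g x\<bar> \<le> B * C + B * C" for x
      using m[OF B(3)[of x] C(4)[of x]] m[OF B(4)[of x] C(3)[of x]] by linarith
    show "\<bar>f x * g' x + f' x * g x - (f y * g' y + f' y * g y)\<bar>
        \<le> ((B * C + B * C) + (B * C + B * C)) * \<bar>x - y\<bar>" for x y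
      using lipschitz_mult[OF B(3,6) C(4,5), of x y] lipschitz_mult[OF B(4,5) C(3,6), of x y]
      unfolding distrib_right[of "B * C + B * C"] by linarith
  qed
qed

lemma tame_const: "tame (\<lambda>x. c) (\<lambda>x. 0)"
  by (rule tameI[of _ _ "\<bar>c\<bar>" 0 0]) auto

lemma tame_add:
  assumes "tame f f'" "tame g g'"
  shows "tame (\<lambda>x. f x + g x) (\<lambda>x. f' x + g' x)"
proof -
  obtain B where B: "B > 0" "\<And>x. (f has_real_derivative f' x) (at x)" "\<And>x. \<bar>f x\<bar> \<le> B"
    "\<And>x. \<bar>f' x\<bar> \<le> B" "\<And>x y. \<bar>f' x - f' y\<bar> \<le> B * \<bar>x - y\<bar>"
    using tameE[OF assms(1)] by metis
  obtain C where C: "C > 0" "\<And>x. (g has_real_derivative g' x) (at x)" "\<And>x. \<bar>g x\<bar> \<le> C"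
    "\<And>x. \<bar>g' x\<bar> \<le> C" "\<And>x y. \<bar>g' x - g' y\<bar> \<le> C * \<bar>x - y\<bar>"
    using tameE[OF assms(2)] by metis
  show ?thesis
  proof (rule tameI)
    show "((\<lambda>x. f x + g x) has_real_derivative f' x + g' x) (at x)" for x
      using B(2) C(2) by (rule DERIV_add)
    show "\<bar>f x + g x\<bar> \<le> B + C" for x using B(3)[of x] C(3)[of x] by linarith
    show "\<bar>f' x + g' x\<bar> \<le> B + C" for x using B(4)[of x] C(4)[of x] by linarith
    show "\<bar>f' x + g' x - (f' y + g' y)\<bar> \<le> (B + C) * \<bar>x - y\<bar>" for x y
      using B(5)[of x y] C(5)[of x y] unfolding distrib_right by linarith
  qed
qed

lemma tame_compose:
  assumes "tame h h'" "tame u u'"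
  shows "tame (\<lambda>x. h (u x)) (\<lambda>x. h' (u x) * u' x)"
proof -
  obtain B where B: "B > 0" "\<And>x. (h has_real_derivative h' x) (at x)" "\<And>x. \<bar>h x\<bar> \<le> B"
    "\<And>x. \<bar>h' x\<bar> \<le> B" "\<And>x y. \<bar>h' x - h' y\<bar> \<le> B * \<bar>x - y\<bar>" "\<And>x y. \<bar>h x - h y\<bar> \<le> B * \<bar>x - y\<bar>"
    using tameE[OF assms(1)] by metis
  obtain C where C: "C > 0" "\<And>x. (u has_real_derivative u' x) (at x)" "\<And>x. \<bar>u x\<bar> \<le> C"
    "\<And>x. \<bar>u' x\<bar> \<le> C" "\<And>x y. \<bar>u' x - u' y\<bar> \<le> C * \<bar>x - y\<bar>" "\<And>x y. \<bar>u x - u y\<bar> \<le> C * \<bar>x - y\<bar>"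
    using tameE[OF assms(2)] by metis
  show ?thesis
  proof (rule tameI)
    show "((\<lambda>x. h (u x)) has_real_derivative h' (u x) * u' x) (at x)" for x
      using DERIV_chain2[OF B(2) C(2)] .
    show "\<bar>h (u x)\<bar> \<le> B" for x by (rule B)
    show "\<bar>h' (u x) * u' x\<bar> \<le> B * C" for x
      unfolding abs_mult using B(1) by (intro mult_mono B C) auto
    have "\<bar>h' (u x) - h' (u y)\<bar> \<le> (B * C) * \<bar>x - y\<bar>" for x y
    proof (rule order_trans[OF B(5)])
      show "B * \<bar>u x - u y\<bar> \<le> B * C * \<bar>x - y\<bar>"
        unfolding mult.assoc using B(1) by (intro mult_left_mono C(6)) auto
    qed
    from lipschitz_mult[OF B(4) this C(4,5)]
    show "\<bar>h' (u x) * u' x - h' (u y) * u' y\<bar> \<le> (B * C * C + B * C) * \<bar>x - y\<bar>" for x y .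
  qed
qed

lemma tame_cos: "tame (\<lambda>x. b * cos (\<omega> * x)) (\<lambda>x. - b * \<omega> * sin (\<omega> * x))"
proof (rule tameI)
  show d: "((\<lambda>x. b * cos (\<omega> * x)) has_real_derivative - b * \<omega> * sin (\<omega> * x)) (at x)" for x
    by (auto intro!: derivative_eq_intros)
  show "\<bar>b * cos (\<omega> * x)\<bar> \<le> \<bar>b\<bar> * 1" for x
    unfolding abs_mult by (intro mult_left_mono) auto
  show "\<bar>- b * \<omega> * sin (\<omega> * x)\<bar> \<le> \<bar>b * \<omega>\<bar> * 1" for x
    unfolding abs_mult by (intro mult_mono) auto
  have "((\<lambda>x. - b * \<omega> * sin (\<omega> * x)) has_real_derivative - b * \<omega> * (cos (\<omega> * x) * \<omega>)) (at x)" for x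
    by (auto intro!: derivative_eq_intros)
  moreover have "\<bar>- b * \<omega> * (cos (\<omega> * x) * \<omega>)\<bar> \<le> \<bar>b * \<omega>\<bar> * (1 * \<bar>\<omega>\<bar>)" for x
    unfolding abs_mult by (intro mult_mono) auto
  ultimately show "\<bar>- b * \<omega> * sin (\<omega> * x) - - b * \<omega> * sin (\<omega> * y)\<bar> \<le> \<bar>b * \<omega>\<bar> * (1 * \<bar>\<omega>\<bar>) * \<bar>x - y\<bar>" for x y
    by (rule lipschitz_of_derivative_bound)
qed

text \<open>A smooth sign function; \<open>wave\<close> is its composite with a cosine, for
  \<open>e = 1 - b\<^sup>2\<close>.\<close>

lemma tame_sigmoid:
  assumes e: "e > 0"
  shows "tame (\<lambda>y. y / sqrt (y\<^sup>2 + e)) (\<lambda>y. e / sqrt (y\<^sup>2 + e) ^ 3)"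
proof -
  define R where "R y = sqrt (y\<^sup>2 + e)" for y
  have R: "R y > 0" "(R y)\<^sup>2 = y\<^sup>2 + e" for y
    using e by (auto simp: R_def add_nonneg_pos)
  have Ry: "\<bar>y\<bar> \<le> R y" for y
    using e unfolding R_def by (intro real_le_rsqrt) auto
  have Re: "sqrt e \<le> R y" for y unfolding R_def by auto
  have dR: "(R has_real_derivative y / R y) (at y)" for y
  proof -
    have "y\<^sup>2 + e > 0" using e by (simp add: add_nonneg_pos)
    then show ?thesis
      unfolding R_def by (auto intro!: derivative_eq_intros simp: divide_simps)
  qed
  have d1: "((\<lambda>y. y / R y) has_real_derivative e / R y ^ 3) (at y)" for y
  proof -
    have "(1 * R y - y * (y / R y)) / (R y * R y) = ((R y)\<^sup>2 - y\<^sup>2) / R y ^ 3"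
      using R(1)[of y] by (simp add: field_simps power2_eq_square power3_eq_cube)
    then show ?thesis
      using DERIV_divide[OF DERIV_ident dR, of y] R(1)[of y] R(2)[of y] by simp
  qed
  have d2: "((\<lambda>y. e / R y ^ 3) has_real_derivative - 3 * e * y / R y ^ 5) (at y)" for y
  proof -
    have "(0 * R y ^ 3 - e * (real 3 * (y / R y * R y ^ (3 - 1)))) / (R y ^ 3 * R y ^ 3) = - 3 * e * y / R y ^ 5"
      using R(1)[of y] by (simp add: divide_simps) (simp add: power_numeral_reduce)
    then show ?thesis
      using DERIV_divide[OF DERIV_const DERIV_power[OF dR, where n = 3], of y e] R(1)[of y]
      by (simp add: mult_ac)
  qed
  have derivative_bound: "\<bar>e / R y ^ 3\<bar> \<le> e / sqrt e ^ 3" for y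
    using e R(1)[of y] power_mono[OF Re[of y], of 3] by (simp add: frac_le)
  have second_derivative_bound: "\<bar>- 3 * e * y / R y ^ 5\<bar> \<le> 3 * e / sqrt e ^ 4" for y
  proof -
    have "\<bar>- 3 * e * y / R y ^ 5\<bar> = 3 * e * \<bar>y\<bar> / R y ^ 5"
      using e R(1)[of y] by (simp add: abs_mult)
    also have "\<dots> \<le> 3 * e * R y / R y ^ 5"
      using e R(1)[of y] Ry[of y] by (intro divide_right_mono mult_left_mono) auto
    also have "\<dots> = 3 * e / R y ^ 4" using R(1)[of y] by (simp add: divide_simps) (simp add: power_numeral_reduce)
    also have "\<dots> \<le> 3 * e / sqrt e ^ 4"
      using e R(1)[of y] power_mono[OF Re[of y], of 4] by (intro divide_left_mono mult_pos_pos) auto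
    finally show ?thesis .
  qed
  have "tame (\<lambda>y. y / R y) (\<lambda>y. e / R y ^ 3)"
  proof (rule tameI)
    show "\<bar>y / R y\<bar> \<le> 1" for y using R(1)[of y] Ry[of y] by (simp add: abs_divide)
  qed (fact d1 derivative_bound lipschitz_of_derivative_bound[OF d2 second_derivative_bound])+
  then show ?thesis by (simp add: R_def)
qed

text \<open>
  As \<open>b\<close> tends to \<open>1\<close> the wave
  is close to \<open>\<plusminus>1\<close> outside ever smaller neighbourhoods of the zeros of \<open>cos (\<omega> x)\<close>, while the size
  of the primitive is controlled by \<open>\<omega>\<close> alone.
\<close>

definition wave :: "real \<Rightarrow> real \<Rightarrow> real \<Rightarrow> real" where
  "wave b \<omega> x = b * cos (\<omega> * x) / sqrt ((b * cos (\<omega> * x))\<^sup>2 + (1 - b\<^sup>2))"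

text \<open>For \<open>b\<close> close to 1 this is a triangle wave with slopes close to 1 and -1
  and rounded corners.\<close>

definition wave_primitive :: "real \<Rightarrow> real \<Rightarrow> real \<Rightarrow> real" where
  "wave_primitive b \<omega> x = arcsin (b * sin (\<omega> * x)) / \<omega>"

context
  fixes b \<omega> :: real
  assumes b: "0 < b" "b < 1" and \<omega>: "0 < \<omega>"
begin

lemma b_squared_less_one: "b\<^sup>2 < 1" using b by (simp add: power_less_one_iff)

lemma tame_wave: "\<exists>w. tame (wave b \<omega>) w"
  using tame_compose[OF tame_sigmoid tame_cos, of "1 - b\<^sup>2" b \<omega>] b_squared_less_one
  by (auto simp: wave_def[abs_def])

lemma wave_bound: "\<bar>wave b \<omega> x\<bar> \<le> 1"
proof -
  have p: "(b * cos (\<omega> * x))\<^sup>2 + (1 - b\<^sup>2) > 0" using b_squared_less_one by (simp add: add_nonneg_pos)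
  have "\<bar>b * cos (\<omega> * x)\<bar> \<le> sqrt ((b * cos (\<omega> * x))\<^sup>2 + (1 - b\<^sup>2))"
    using b_squared_less_one by (intro real_le_rsqrt) auto
  then show ?thesis unfolding wave_def abs_divide using p by simp
qed

lemma abs_b_sin_less: "\<bar>b * sin (\<omega> * x)\<bar> < 1"
proof -
  have "\<bar>b * sin (\<omega> * x)\<bar> \<le> b * 1" unfolding abs_mult using b by (intro mult_mono) auto
  then show ?thesis using b by simp
qed

lemma wave_primitive_bound: "\<bar>wave_primitive b \<omega> x\<bar> \<le> 2 / \<omega>"
proof -
  have "\<bar>arcsin (b * sin (\<omega> * x))\<bar> \<le> pi / 2"
    using abs_b_sin_less[of x] arcsin_bounded[of "b * sin (\<omega> * x)"] by (auto simp: abs_le_iff abs_less_iff)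
  also have "\<dots> \<le> 2" using pi_less_4 by simp
  finally show ?thesis unfolding wave_primitive_def abs_divide using \<omega> by (simp add: divide_right_mono)
qed

text \<open>The identity 1 - b^2 sin^2 = b^2 cos^2 + (1 - b^2) turns the derivative of the arcsine
  into \<open>wave\<close>; this is where the formula for \<open>wave\<close> comes from.\<close>

lemma DERIV_wave_primitive: "(wave_primitive b \<omega> has_real_derivative wave b \<omega> x) (at x)"
proof -
  have s: "-1 < b * sin (\<omega> * x)" "b * sin (\<omega> * x) < 1"
    using abs_b_sin_less[of x] by (auto simp: abs_less_iff)
  have eq: "1 - (b * sin (\<omega> * x))\<^sup>2 = (b * cos (\<omega> * x))\<^sup>2 + (1 - b\<^sup>2)"
    using sin_cos_squared_add[of "\<omega> * x"] by (simp add: power_mult_distrib flip: distrib_left)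
      (simp add: algebra_simps flip: distrib_left)
  have inner: "((\<lambda>x. b * sin (\<omega> * x)) has_real_derivative b * (cos (\<omega> * x) * \<omega>)) (at x)"
    by (auto intro!: derivative_eq_intros)
  have "((\<lambda>x. arcsin (b * sin (\<omega> * x)) / \<omega>) has_real_derivative
      inverse (sqrt (1 - (b * sin (\<omega> * x))\<^sup>2)) * (b * (cos (\<omega> * x) * \<omega>)) / \<omega>) (at x)"
    by (rule DERIV_cdivide[OF DERIV_chain2[OF DERIV_arcsin[OF s] inner]])
  moreover have "inverse (sqrt (1 - (b * sin (\<omega> * x))\<^sup>2)) * (b * (cos (\<omega> * x) * \<omega>)) / \<omega> = wave b \<omega> x"
    unfolding eq wave_def using \<omega> by (simp add: divide_inverse mult_ac)
  ultimately show ?thesis by (simp add: wave_primitive_def[abs_def])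
qed

lemma tame_wave_primitive: "tame (wave_primitive b \<omega>) (wave b \<omega>)"
proof -
  obtain w B where "\<And>x y. \<bar>wave b \<omega> x - wave b \<omega> y\<bar> \<le> B * \<bar>x - y\<bar>"
    using tame_wave tameE by metis
  then show ?thesis
    by (rule tameI[OF DERIV_wave_primitive wave_primitive_bound wave_bound])
qed

end

text \<open>A near critical potential is taken for g = \<eta> q, with q the primitive of the wave s.
  The derivative is \<eta> s + \<eta>' q, and q is small at high frequency, so criticality makes the
  mean of \<eta> s small. As q is bounded in terms of \<omega> alone, \<omega> can precede b, which
  leaves b free for the eigenvalue count.\<close>

lemma exists_balancing_frequency:
  fixes \<delta> c :: real
  assumes \<eta>: "tame \<eta> \<eta>'" "\<And>x. \<bar>\<eta> x\<bar> \<le> 1" and \<delta>: "\<delta> > 0" and c: "c > 0"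
  shows "\<exists>\<omega>>0. \<forall>b. 0 < b \<longrightarrow> b < 1 \<longrightarrow> (\<forall>(S::'a set) A V. finite S \<longrightarrow> symmetric_on S A \<longrightarrow>
    (\<exists>W. (\<forall>v\<in>S. \<bar>W v - V v\<bar> \<le> \<delta>) \<and>
      (\<Sum>v\<in>S. (spectral_mean S (perturb A W) (\<lambda>x. \<eta> x * wave b \<omega> x) v)\<^sup>2) \<le> c * card S))"
proof -
  obtain B where B: "B > 0" "\<And>x. \<bar>\<eta>' x\<bar> \<le> B" using tameE[OF \<eta>(1)] by metis
  \<comment> \<open>A gradient of size at most 1 and two means of size at most 1 give 2a|W - V|
    \<le> 4, hence |W - V| \<le> 2 / a = \<delta> at every vertex.\<close>
  define a where "a = 2 / \<delta>"
  have a: "a > 0" using \<delta> by (simp add: a_def)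
  \<comment> \<open>The final estimate has three contributions, each allotted \<open>c / 3\<close>:
    the term 32a\<kappa> from the distance of W to V, the remainder from \<eta>' q, and the terms in
    \<xi>. The bound \<open>1 / B\<close> keeps the remainder below 1.\<close>
  define \<kappa> where "\<kappa> = min (c / (96 * a)) (min (1 / B) (c / (6 * B)))"
  have \<kappa>: "\<kappa> > 0" using a B c by (auto simp: \<kappa>_def)
  have "\<kappa> \<le> c / (96 * a)" "\<kappa> \<le> 1 / B" "\<kappa> \<le> c / (6 * B)" by (auto simp: \<kappa>_def)
  then have \<kappa>1: "32 * a * \<kappa> \<le> c / 3" and \<kappa>2: "B * \<kappa> \<le> 1" and \<kappa>3: "B * \<kappa> \<le> c / 6"
    using a B by (auto simp: field_simps)
  define \<xi> where "\<xi> = min 1 (c / (3 * (4 + 16 * a)))"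
  have \<xi>: "\<xi> > 0" "\<xi> \<le> 1" using a c by (auto simp: \<xi>_def add_pos_pos)
  have "\<xi> \<le> c / (3 * (4 + 16 * a))" by (simp add: \<xi>_def)
  moreover have "3 * (4 + 16 * a) > 0" using a by simp
  ultimately have \<xi>2: "4 * \<xi> + 16 * a * \<xi> \<le> c / 3"
    by (simp add: pos_le_divide_eq algebra_simps)
  define \<omega> where "\<omega> = 2 / \<kappa>"
  have \<omega>: "\<omega> > 0" "2 / \<omega> = \<kappa>" using \<kappa> by (auto simp: \<omega>_def)
  show ?thesis
  proof (intro exI[of _ \<omega>] conjI allI impI \<omega>(1))
    fix b :: real and S :: "'a set" and A V
    assume b: "0 < b" "b < 1" and S: "finite S" "symmetric_on S A"
    define q where "q = wave_primitive b \<omega>"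
    define s where "s = wave b \<omega>"
    have q: "\<bar>q x\<bar> \<le> \<kappa>" for x
      using wave_primitive_bound[OF b \<omega>(1)] \<omega>(2) by (simp add: q_def)
    have s: "\<bar>s x\<bar> \<le> 1" for x using wave_bound[OF b \<omega>(1)] by (simp add: s_def)
    have tame: "tame (\<lambda>x. \<eta> x * q x) (\<lambda>x. \<eta> x * s x + \<eta>' x * q x)"
      unfolding q_def s_def by (rule tame_mult[OF \<eta>(1) tame_wave_primitive[OF b \<omega>(1)]])
    have "\<bar>\<eta> x * q x\<bar> \<le> 1 * \<kappa>" for x
      unfolding abs_mult by (intro mult_mono \<eta>(2) q) auto
    then have "\<bar>\<eta> x * q x\<bar> \<le> \<kappa>" for x by simp
    from exists_near_critical_potential[OF S tame this a \<xi>(1)]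
    obtain W where W: "(\<Sum>v\<in>S. (spectral_mean S (perturb A W) (\<lambda>x. \<eta> x * s x + \<eta>' x * q x) v
          + 2 * a * (W v - V v))\<^sup>2) \<le> \<xi>"
      "a * (\<Sum>v\<in>S. (W v - V v)\<^sup>2) \<le> 2 * \<kappa> * card S + \<xi>"
      by blast
    define m where "m v = spectral_mean S (perturb A W) (\<lambda>x. \<eta> x * s x) v" for v
    define p where "p v = spectral_mean S (perturb A W) (\<lambda>x. \<eta>' x * q x) v" for v
    define G where "G v = m v + p v + 2 * a * (W v - V v)" for v
    have G: "(\<Sum>v\<in>S. (G v)\<^sup>2) \<le> \<xi>" using W(1) by (simp add: spectral_mean_add G_def m_def p_def)
    note sm = spectral_mean_bound[OF S(1) symmetric_on_perturb[OF S(2)]]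
    have m: "\<bar>m v\<bar> \<le> 1" if "v \<in> S" for v
      unfolding m_def
    proof (rule sm[OF that])
      show "\<bar>\<eta> x * s x\<bar> \<le> 1" for x
        unfolding abs_mult using mult_mono[OF \<eta>(2)[of x] s[of x]] by simp
    qed
    have p: "\<bar>p v\<bar> \<le> B * \<kappa>" if "v \<in> S" for v
      unfolding p_def
    proof (rule sm[OF that])
      show "\<bar>\<eta>' x * q x\<bar> \<le> B * \<kappa>" for x
        unfolding abs_mult using B(1) by (intro mult_mono B(2) q) auto
    qed
    show "\<exists>W. (\<forall>v\<in>S. \<bar>W v - V v\<bar> \<le> \<delta>) \<and>
      (\<Sum>v\<in>S. (spectral_mean S (perturb A W) (\<lambda>x. \<eta> x * wave b \<omega> x) v)\<^sup>2) \<le> c * card S"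
    proof (intro exI[of _ W] conjI ballI)
      fix v assume v: "v \<in> S"
      have "(G v)\<^sup>2 \<le> (\<Sum>v\<in>S. (G v)\<^sup>2)" using S(1) v by (intro member_le_sum) auto
      then have "(G v)\<^sup>2 \<le> 1" using G \<xi>(2) by simp
      then have "\<bar>G v\<bar> \<le> 1" by (simp add: abs_square_le_1)
      then have "\<bar>2 * a * (W v - V v)\<bar> \<le> 4"
        using m[OF v] p[OF v] \<kappa>2 unfolding G_def by linarith
      then have "2 * a * \<bar>W v - V v\<bar> \<le> 4" using a by (simp add: abs_mult)
      then show "\<bar>W v - V v\<bar> \<le> \<delta>" using \<delta> by (simp add: a_def field_simps)
    next
      have "(\<Sum>v\<in>S. (m v)\<^sup>2) \<le> (\<Sum>v\<in>S. 4 * (G v)\<^sup>2 + 16 * a\<^sup>2 * (W v - V v)\<^sup>2 + 2 * (B * \<kappa>))"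
      proof (rule sum_mono)
        fix v assume v: "v \<in> S"
        have "(p v)\<^sup>2 \<le> B * \<kappa>"
        proof -
          have "(p v)\<^sup>2 \<le> (B * \<kappa>)\<^sup>2" using power_mono[OF p[OF v], of 2] by simp
          also have "\<dots> \<le> B * \<kappa>"
            unfolding power2_eq_square using \<kappa>2 B(1) \<kappa> by (intro mult_right_le_one_le) auto
          finally show ?thesis .
        qed
        moreover have mv: "m v = G v - p v - 2 * a * (W v - V v)" by (simp add: G_def)
        have "(m v)\<^sup>2 \<le> 4 * (G v)\<^sup>2 + 4 * (2 * a * (W v - V v))\<^sup>2 + 2 * (p v)\<^sup>2"
        proof -
          have "(x - y - z)\<^sup>2 \<le> 4 * x\<^sup>2 + 4 * z\<^sup>2 + 2 * y\<^sup>2" for x y z :: real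
          proof -
            have "(x - y - z)\<^sup>2 = 4 * x\<^sup>2 + 4 * z\<^sup>2 + 2 * y\<^sup>2 - 2 * (x + z)\<^sup>2 - (x - z + y)\<^sup>2"
              by (simp add: power2_eq_square algebra_simps)
            then show ?thesis using zero_le_power2[of "x + z"] zero_le_power2[of "x - z + y"] by linarith
          qed
          then show ?thesis unfolding mv .
        qed
        ultimately show "(m v)\<^sup>2 \<le> 4 * (G v)\<^sup>2 + 16 * a\<^sup>2 * (W v - V v)\<^sup>2 + 2 * (B * \<kappa>)"
          by (simp add: power_mult_distrib)
      qed
      also have "\<dots> = 4 * (\<Sum>v\<in>S. (G v)\<^sup>2) + 16 * a * (a * (\<Sum>v\<in>S. (W v - V v)\<^sup>2)) + 2 * (B * \<kappa>) * card S"
        by (simp add: sum.distrib sum_distrib_left power2_eq_square mult_ac)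
      also have "\<dots> \<le> 4 * \<xi> + 16 * a * (2 * \<kappa> * card S + \<xi>) + 2 * (c / 6) * card S"
        using G W(2) a \<kappa>3 by (intro add_mono mult_left_mono mult_right_mono) auto
      also have "\<dots> = (4 * \<xi> + 16 * a * \<xi>) + 32 * a * \<kappa> * card S + c / 3 * card S"
        by (simp add: algebra_simps)
      finally have *: "(\<Sum>v\<in>S. (m v)\<^sup>2) \<le> (4 * \<xi> + 16 * a * \<xi>) + 32 * a * \<kappa> * card S + c / 3 * card S" .
      \<comment> \<open>The terms in \<xi> carry no factor \<open>card S\<close>; a nonempty
        \<open>S\<close> absorbs them.\<close>
      show "(\<Sum>v\<in>S. (spectral_mean S (perturb A W) (\<lambda>x. \<eta> x * wave b \<omega> x) v)\<^sup>2) \<le> c * card S"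
      proof (cases "S = {}")
        case False
        then have n: "1 \<le> real (card S)" using S(1) by (simp add: Suc_leI card_gt_0_iff)
        have "c / 3 * 1 \<le> c / 3 * card S" using c by (intro mult_left_mono n) auto
        then have "(4 * \<xi> + 16 * a * \<xi>) \<le> c / 3 * card S" using \<xi>2 by linarith
        moreover have "32 * a * \<kappa> * card S \<le> c / 3 * card S"
          using \<kappa>1 by (intro mult_right_mono) auto
        ultimately have "(\<Sum>v\<in>S. (m v)\<^sup>2) \<le> c / 3 * card S + c / 3 * card S + c / 3 * card S"
          using * by linarith
        then show ?thesis by (simp add: m_def s_def)
      qed simp
    qed
  qed
qed

section \<open>Determinants and the density of eigenvalues\<close>

locale enumeration =
  fixes S :: "'a set" and e :: "nat \<Rightarrow> 'a" and n :: nat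
  assumes bij: "bij_betw e {..<n} S"
begin

text \<open>A simultaneous reordering of rows and columns preserves the determinant;
  \<open>e\<close> matters only for triangularity.\<close>

definition kdet :: "('a \<Rightarrow> 'a \<Rightarrow> real) \<Rightarrow> real" where
  "kdet M = Determinant.det (Matrix.mat n n (\<lambda>(i, j). M (e i) (e j)))"

lemma e_in: "i < n \<Longrightarrow> e i \<in> S"
  using bij by (auto simp: bij_betw_def)

lemma e_eq_iff: "i < n \<Longrightarrow> j < n \<Longrightarrow> e i = e j \<longleftrightarrow> i = j"
  using bij by (auto simp: bij_betw_def inj_on_def)

lemma kdet_cong:
  assumes "\<And>v w. v \<in> S \<Longrightarrow> w \<in> S \<Longrightarrow> M v w = N v w"
  shows "kdet M = kdet N"
proof -
  have "Matrix.mat n n (\<lambda>(i, j). M (e i) (e j)) = Matrix.mat n n (\<lambda>(i, j). N (e i) (e j))"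
    by (rule eq_matI) (auto simp: assms e_in)
  then show ?thesis by (simp add: kdet_def)
qed

lemma kdet_mult: "kdet (\<lambda>v w. \<Sum>u\<in>S. M v u * N u w) = kdet M * kdet N"
proof -
  have *: "Matrix.mat n n (\<lambda>(i, j). \<Sum>u\<in>S. M (e i) u * N u (e j))
      = Matrix.mat n n (\<lambda>(i, j). M (e i) (e j)) * Matrix.mat n n (\<lambda>(i, j). N (e i) (e j))"
    unfolding sum.reindex_bij_betw[OF bij, symmetric]
    by (rule eq_matI) (simp_all add: scalar_prod_def atLeast0LessThan)
  show ?thesis unfolding kdet_def * by (rule det_mult[of _ n]) simp_all
qed

lemma kdet_transpose: "kdet (\<lambda>v w. M w v) = kdet M"
proof -
  have *: "Matrix.mat n n (\<lambda>(i, j). M (e j) (e i))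
      = transpose_mat (Matrix.mat n n (\<lambda>(i, j). M (e i) (e j)))"
    by (rule eq_matI) simp_all
  show ?thesis unfolding kdet_def * by (rule Determinant.det_transpose[of _ n]) simp
qed

lemma kdet_lower_triangular:
  assumes "\<And>i j. i < j \<Longrightarrow> j < n \<Longrightarrow> M (e i) (e j) = 0"
  shows "kdet M = (\<Prod>v\<in>S. M v v)"
proof -
  define K where "K = Matrix.mat n n (\<lambda>(i, j). M (e i) (e j))"
  have "Determinant.det K = prod_list (diag_mat K)"
    by (rule det_lower_triangular[of n]) (auto simp: K_def assms)
  also have "\<dots> = (\<Prod>i<n. M (e i) (e i))"
    unfolding diag_mat_def by (simp add: K_def prod.distinct_set_conv_list[symmetric] atLeast0LessThan)
  also have "\<dots> = (\<Prod>v\<in>S. M v v)" by (rule prod.reindex_bij_betw[OF bij])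
  finally show ?thesis by (simp add: kdet_def K_def)
qed

lemma kdet_diag: "kdet (\<lambda>v w. of_bool (v = w) * d v) = (\<Prod>v\<in>S. d v)"
  by (subst kdet_lower_triangular) (auto simp: e_eq_iff)

lemma finite_S: "finite S"
  using bij bij_betw_finite by blast

lemma kdet_orthobasis:
  assumes "orthobasis S q"
  shows "(kdet q)\<^sup>2 = 1"
proof -
  have "kdet q * kdet (\<lambda>v j. q j v) = kdet (\<lambda>j k. \<Sum>v\<in>S. q j v * q k v)"
    by (rule kdet_mult[symmetric])
  also have "\<dots> = kdet (\<lambda>j k. of_bool (j = k) * 1)"
    by (rule kdet_cong) (simp add: orthobasisD(1)[OF assms])
  also have "\<dots> = 1" unfolding kdet_diag by simp
  finally show ?thesis by (simp add: kdet_transpose[of q] power2_eq_square)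
qed

text \<open>The eigenvalue equations say that \<phi> times the transpose of h is diag(E) \<phi>, and
  det \<phi> is nonzero.\<close>

lemma kdet_eigenbasis:
  assumes "eigenbasis S h \<phi> E"
  shows "kdet h = (\<Prod>j\<in>S. E j)"
proof -
  have "kdet \<phi> * kdet (\<lambda>w v. h v w) = kdet (\<lambda>j v. \<Sum>w\<in>S. \<phi> j w * h v w)"
    by (rule kdet_mult[symmetric])
  also have "\<dots> = kdet (\<lambda>j v. \<Sum>k\<in>S. (of_bool (j = k) * E j) * \<phi> k v)"
  proof (rule kdet_cong)
    fix j v assume jv: "j \<in> S" "v \<in> S"
    have "(\<Sum>w\<in>S. \<phi> j w * h v w) = E j * \<phi> j v"
      using eigenbasisD(2)[OF assms jv] by (simp add: mult.commute)
    also have "\<dots> = (\<Sum>k\<in>S. of_bool (j = k) * (E j * \<phi> k v))"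
      using sum_mult_of_bool(4)[OF finite_S jv(1), of "\<lambda>k. E j * \<phi> k v"] by simp
    finally show "(\<Sum>w\<in>S. \<phi> j w * h v w) = (\<Sum>k\<in>S. (of_bool (j = k) * E j) * \<phi> k v)"
      by (simp add: mult.assoc)
  qed
  also have "\<dots> = (\<Prod>j\<in>S. E j) * kdet \<phi>"
    unfolding kdet_mult kdet_diag ..
  finally show ?thesis
    using kdet_orthobasis[OF eigenbasisD(1)[OF assms]] by (auto simp: kdet_transpose[of h])
qed

text \<open>
  Hadamard's inequality for a matrix of determinant one, from the arithmetic--geometric mean
  inequality for the eigenvalues of the normalised Gram matrix.
\<close>

lemma unit_triangular_hadamard:
  assumes tri: "\<And>i j. i < j \<Longrightarrow> j < n \<Longrightarrow> B (e i) (e j) = 0" and diag: "\<And>v. v \<in> S \<Longrightarrow> B v v = 1"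
    and q: "orthobasis S q" and d: "\<And>j. j \<in> S \<Longrightarrow> d j > 0"
    and Bq: "\<And>j. j \<in> S \<Longrightarrow> (\<Sum>u\<in>S. (\<Sum>w\<in>S. B u w * q j w)\<^sup>2) \<le> d j"
  shows "1 \<le> (\<Prod>j\<in>S. d j)"
proof -
  \<comment> \<open>Dividing the image of \<open>q j\<close> under \<open>B\<close> by
    \<open>sqrt (d j)\<close> gives vectors of length at most 1, the rows of \<open>K\<close>;
    \<open>h\<close> is their Gram matrix, with diagonal entries at most 1.\<close>
  define s where "s j = 1 / sqrt (d j)" for j
  define C where "C j u = (\<Sum>w\<in>S. q j w * B u w)" for j u
  define K where "K j u = (\<Sum>k\<in>S. (of_bool (j = k) * s j) * C k u)" for j u
  have K: "K j u = s j * C j u" if "j \<in> S" for j u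
    using sum_mult_of_bool(4)[OF finite_S that, of "\<lambda>k. s j * C k u"] by (simp add: K_def mult.assoc)
  define h where "h j k = (\<Sum>u\<in>S. K j u * K k u)" for j k
  have "kdet C = kdet q * kdet (\<lambda>w u. B u w)" unfolding C_def[abs_def] by (rule kdet_mult)
  also have "kdet (\<lambda>w u. B u w) = 1"
    using kdet_transpose[of B] kdet_lower_triangular[of B, OF tri] diag by simp
  finally have C: "(kdet C)\<^sup>2 = 1" using kdet_orthobasis[OF q] by simp
  have "kdet K = (\<Prod>j\<in>S. s j) * kdet C"
    unfolding K_def[abs_def] kdet_mult kdet_diag ..
  moreover have "kdet h = kdet K * kdet K"
    unfolding h_def[abs_def] kdet_mult[of K "\<lambda>u k. K k u"] using kdet_transpose[of K] by simp
  ultimately have "kdet h = (\<Prod>j\<in>S. s j)\<^sup>2"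
    using C by (simp add: power2_eq_square)
  also have "\<dots> = (\<Prod>j\<in>S. 1 / d j)"
    unfolding prod_power_distrib by (rule prod.cong) (simp_all add: s_def power_divide less_imp_le[OF d])
  finally have det_h: "kdet h = (\<Prod>j\<in>S. 1 / d j)" .
  obtain \<phi> E where eb: "eigenbasis S h \<phi> E"
    using exists_eigenbasis[OF finite_S, of h] by (auto simp: h_def mult.commute)
  note ob = eigenbasisD(1)[OF eb]
  have E: "E j = (\<Sum>v\<in>S. \<Sum>w\<in>S. \<phi> j v * \<phi> j w * h v w)" if j: "j \<in> S" for j
  proof -
    have "(\<Sum>v\<in>S. \<Sum>w\<in>S. \<phi> j v * \<phi> j w * h v w) = (\<Sum>v\<in>S. \<phi> j v * (\<Sum>w\<in>S. h v w * \<phi> j w))"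
      by (simp add: sum_distrib_left mult_ac)
    also have "\<dots> = (\<Sum>v\<in>S. E j * (\<phi> j v * \<phi> j v))"
      by (intro sum.cong refl) (simp add: eigenbasisD(2)[OF eb j])
    also have "\<dots> = E j"
      using orthobasisD(1)[OF ob j j] by (simp flip: sum_distrib_left)
    finally show ?thesis by simp
  qed
  have E_nonneg: "0 \<le> E j" if j: "j \<in> S" for j
  proof -
    have "E j = (\<Sum>v\<in>S. \<Sum>w\<in>S. \<Sum>u\<in>S. (\<phi> j v * K v u) * (\<phi> j w * K w u))"
      unfolding E[OF j] h_def sum_distrib_left by (simp add: mult_ac)
    also have "\<dots> = (\<Sum>v\<in>S. \<Sum>u\<in>S. \<Sum>w\<in>S. (\<phi> j v * K v u) * (\<phi> j w * K w u))"
      by (intro sum.cong refl sum.swap)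
    also have "\<dots> = (\<Sum>u\<in>S. \<Sum>v\<in>S. \<Sum>w\<in>S. (\<phi> j v * K v u) * (\<phi> j w * K w u))"
      by (rule sum.swap)
    also have "\<dots> = (\<Sum>u\<in>S. (\<Sum>v\<in>S. \<phi> j v * K v u)\<^sup>2)"
      by (simp add: power2_eq_square sum_product)
    finally show ?thesis by (simp add: sum_nonneg)
  qed
  have "(\<Sum>j\<in>S. E j) = (\<Sum>j\<in>S. \<Sum>v\<in>S. \<Sum>w\<in>S. h v w * (\<phi> j v * \<phi> j w))"
    by (intro sum.cong refl) (simp add: E mult_ac)
  also have "\<dots> = (\<Sum>v\<in>S. \<Sum>j\<in>S. \<Sum>w\<in>S. h v w * (\<phi> j v * \<phi> j w))"
    by (rule sum.swap)
  also have "\<dots> = (\<Sum>v\<in>S. \<Sum>w\<in>S. \<Sum>j\<in>S. h v w * (\<phi> j v * \<phi> j w))"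
    by (intro sum.cong refl sum.swap)
  also have "\<dots> = (\<Sum>v\<in>S. \<Sum>w\<in>S. h v w * of_bool (v = w))"
    by (intro sum.cong refl) (simp add: orthobasisD(2)[OF ob] flip: sum_distrib_left)
  also have "\<dots> = (\<Sum>v\<in>S. h v v)"
    by (intro sum.cong refl) (rule sum_mult_of_bool(2)[OF finite_S])
  also have "\<dots> \<le> (\<Sum>v\<in>S. 1)"
  proof (rule sum_mono)
    fix j assume j: "j \<in> S"
    have "h j j = (\<Sum>u\<in>S. (s j)\<^sup>2 * (\<Sum>w\<in>S. B u w * q j w)\<^sup>2)"
      unfolding h_def by (intro sum.cong refl) (simp add: K[OF j] C_def power2_eq_square mult_ac)
    also have "\<dots> = (s j)\<^sup>2 * (\<Sum>u\<in>S. (\<Sum>w\<in>S. B u w * q j w)\<^sup>2)"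
      by (rule sum_distrib_left[symmetric])
    also have "\<dots> \<le> (s j)\<^sup>2 * d j" by (intro mult_left_mono Bq j) auto
    also have "\<dots> = 1" using d[OF j] by (simp add: s_def power_divide)
    finally show "h j j \<le> 1" .
  qed
  finally have trace: "(\<Sum>j\<in>S. E j - 1) \<le> 0" by (simp add: sum_subtractf)
  have "(\<Prod>j\<in>S. 1 / d j) = (\<Prod>j\<in>S. E j)"
    using det_h kdet_eigenbasis[OF eb] by simp
  \<comment> \<open>x \<le> exp (x - 1) is the arithmetic-geometric mean inequality in disguise: a
    trace of at most \<open>card S\<close> forces a determinant of at most 1.\<close>
  also have "\<dots> \<le> (\<Prod>j\<in>S. exp (E j - 1))"
  proof (intro prod_mono conjI E_nonneg)
    show "E j \<le> exp (E j - 1)" for j using exp_ge_add_one_self[of "E j - 1"] by simp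
  qed
  also have "\<dots> = exp (\<Sum>j\<in>S. E j - 1)" by (simp add: exp_sum finite_S)
  also have "\<dots> \<le> 1" using trace by simp
  finally have "1 / (\<Prod>j\<in>S. d j) \<le> 1" by (simp add: prod_dividef)
  moreover have "(\<Prod>j\<in>S. d j) > 0" using d by (intro prod_pos)
  ultimately show ?thesis by simp
qed

end

section \<open>Eigenvalue counts for propagating kernels\<close>

lemma exists_sorted_enumeration:
  fixes \<rho> :: "'a \<Rightarrow> nat"
  assumes "finite S"
  shows "\<exists>e. bij_betw e {..<card S} S \<and> (\<forall>i j. i < j \<longrightarrow> j < card S \<longrightarrow> \<rho> (e i) \<le> \<rho> (e j))"
proof -
  obtain ys where ys: "set ys = S" "distinct ys" using finite_distinct_list[OF assms] by blast
  define xs where "xs = sort_key \<rho> ys"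
  have xs: "set xs = S" "distinct xs" "sorted (map \<rho> xs)" 
    unfolding xs_def using ys by (simp_all only: set_sort distinct_sort sorted_sort_key)
  have len: "length xs = card S" using distinct_card[OF xs(2)] by (simp only: xs(1))
  show ?thesis
  proof (intro exI[of _ "(!) xs"] conjI allI impI)
    show "bij_betw ((!) xs) {..<card S} S"
      by (rule bij_betw_nth[OF xs(2)]) (simp_all only: len xs(1))
    show "\<rho> (xs ! i) \<le> \<rho> (xs ! j)" if "i < j" "j < card S" for i j
    proof -
      have "map \<rho> xs ! i \<le> map \<rho> xs ! j"
        by (rule sorted_nth_mono[OF xs(3)]) (use that len in auto)
      then show ?thesis using that len by simp
    qed
  qed
qed

text \<open>The eigenvalue equation is read at a vertex where the eigenvector is largest in absolute
  value.\<close>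

lemma abs_eigenvalue_le:
  assumes S: "finite S" and eb: "eigenbasis S h \<phi> E" and j: "j \<in> S"
    and R: "\<And>v. v \<in> S \<Longrightarrow> (\<Sum>w\<in>S. \<bar>h v w\<bar>) \<le> R"
  shows "\<bar>E j\<bar> \<le> R"
proof -
  have "\<exists>v\<in>S. \<forall>w\<in>S. \<bar>\<phi> j w\<bar> \<le> \<bar>\<phi> j v\<bar>"
  proof -
    have "Max ((\<lambda>v. \<bar>\<phi> j v\<bar>) ` S) \<in> (\<lambda>v. \<bar>\<phi> j v\<bar>) ` S" using S j by (intro Max_in) auto
    then obtain v where "v \<in> S" "Max ((\<lambda>v. \<bar>\<phi> j v\<bar>) ` S) = \<bar>\<phi> j v\<bar>" by auto
    then show ?thesis using S by (metis Max_ge finite_imageI imageI)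
  qed
  then obtain v where v: "v \<in> S" "\<And>w. w \<in> S \<Longrightarrow> \<bar>\<phi> j w\<bar> \<le> \<bar>\<phi> j v\<bar>" by blast
  have "\<phi> j v \<noteq> 0"
  proof
    assume "\<phi> j v = 0"
    then have "(\<Sum>v\<in>S. \<phi> j v * \<phi> j v) = 0" using v(2) by (intro sum.neutral) auto
    then show False using orthobasisD(1)[OF eigenbasisD(1)[OF eb] j j] by simp
  qed
  have "\<bar>E j\<bar> * \<bar>\<phi> j v\<bar> = \<bar>\<Sum>w\<in>S. h v w * \<phi> j w\<bar>"
    by (simp add: eigenbasisD(2)[OF eb j v(1)] abs_mult)
  also have "\<dots> \<le> (\<Sum>w\<in>S. \<bar>h v w\<bar> * \<bar>\<phi> j v\<bar>)"
    by (rule order_trans[OF sum_abs sum_mono]) (auto simp: abs_mult intro: mult_left_mono v(2))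
  also have "\<dots> \<le> R * \<bar>\<phi> j v\<bar>"
    unfolding sum_distrib_right[symmetric] by (intro mult_right_mono R v(1)) auto
  finally show ?thesis using \<open>\<phi> j v \<noteq> 0\<close> by simp
qed

text \<open>
  The combinatorial content of a truncated propagating graph: \<open>p\<close> is the inverse of the
  translation, \<open>T\<close> the set of initial vertices of the orbits, and \<open>\<rho>\<close> counts predecessors in the
  partial order, so that the eigenvalue equation at \<open>p u\<close> determines the value at \<open>u\<close> from
  vertices of smaller rank.
\<close>

locale propagating_kernel =
  fixes S :: "'a set" and A :: "'a \<Rightarrow> 'a \<Rightarrow> real" and T :: "'a set" and p :: "'a \<Rightarrow> 'a"
    and \<rho> :: "'a \<Rightarrow> nat" and R :: real
  assumes fin: "finite S" and sym: "symmetric_on S A" and T: "T \<subseteq> S"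
    and p_inj: "inj_on p (S - T)" and p_in: "\<And>u. u \<in> S - T \<Longrightarrow> p u \<in> S"
    and p_neq: "\<And>u. u \<in> S - T \<Longrightarrow> p u \<noteq> u"
    and p_entry: "\<And>u. u \<in> S - T \<Longrightarrow> A (p u) u = 1"
    and p_lower: "\<And>u w. u \<in> S - T \<Longrightarrow> w \<in> S \<Longrightarrow> w \<noteq> u \<Longrightarrow> w = p u \<or> A (p u) w \<noteq> 0 \<Longrightarrow> \<rho> w < \<rho> u"
    and row_bound: "\<And>v. v \<in> S \<Longrightarrow> (\<Sum>w\<in>S. \<bar>A v w\<bar>) \<le> R"
begin

lemma abs_eigenvalue_at_le:
  assumes W: "\<And>v. v \<in> S \<Longrightarrow> \<bar>W v\<bar> \<le> \<Lambda>" and j: "j \<in> S"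
  shows "\<bar>eigenvalue_at S (perturb A W) j\<bar> \<le> R + \<Lambda>"
proof (rule abs_eigenvalue_le[OF fin eigenbasis_eigensystem[OF fin symmetric_on_perturb[OF sym]] j])
  fix v assume v: "v \<in> S"
  have "(\<Sum>w\<in>S. \<bar>perturb A W v w\<bar>) \<le> (\<Sum>w\<in>S. \<bar>A v w\<bar> + of_bool (v = w) * \<bar>W v\<bar>)"
    by (intro sum_mono) (auto simp: perturb_def)
  also have "\<dots> \<le> R + \<Lambda>"
    using row_bound[OF v] W[OF v] sum_mult_of_bool(4)[OF fin v, of "\<lambda>_. \<bar>W v\<bar>"]
    by (simp add: sum.distrib)
  finally show "(\<Sum>w\<in>S. \<bar>perturb A W v w\<bar>) \<le> R + \<Lambda>" .
qed

text \<open>Rows in \<open>T\<close> of the test matrix are rows of the identity, and the row at any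
  other \<open>u\<close> is row \<open>p u\<close> of H - x. Its entry at \<open>u\<close> is 1 and
  its other nonzero entries have smaller rank; \<open>W\<close> and \<open>x\<close> enter only in
  column \<open>p u\<close>, below the diagonal. On an eigenvector this row gives
  \<open>(E j - x) * \<phi> j (p u)\<close>, so Hadamard's inequality applies with the bound
  \<open>d j\<close>.\<close>

lemma prod_eigenvalue_distance:
  assumes eb: "eigenbasis S (perturb A W) \<phi> E" and d: "\<And>j. j \<in> S \<Longrightarrow> d j > 0"
    and le: "\<And>j. j \<in> S \<Longrightarrow> (\<Sum>u\<in>T. (\<phi> j u)\<^sup>2) + (E j - x)\<^sup>2 \<le> d j"
  shows "1 \<le> (\<Prod>j\<in>S. d j)"
proof -
  obtain e where e: "bij_betw e {..<card S} S"
    "\<And>i j. i < j \<Longrightarrow> j < card S \<Longrightarrow> \<rho> (e i) \<le> \<rho> (e j)"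
    using exists_sorted_enumeration[OF fin, of \<rho>] by auto
  interpret enumeration S e "card S" by unfold_locales (rule e(1))
  define B where "B u w = (if u \<in> T then of_bool (u = w)
    else perturb A W (p u) w - of_bool (p u = w) * x)" for u w
  have lower: "\<rho> w < \<rho> u" if "u \<in> S" "w \<in> S" "w \<noteq> u" "B u w \<noteq> 0" for u w
    using that p_lower[of u w] by (auto simp: B_def perturb_def split: if_splits)
  show ?thesis
  proof (rule unit_triangular_hadamard[where B = B, OF _ _ eigenbasisD(1)[OF eb] d])
    fix i j assume ij: "i < j" "j < card S"
    show "B (e i) (e j) = 0"
    proof (rule ccontr)
      assume "B (e i) (e j) \<noteq> 0"
      then have "\<rho> (e j) < \<rho> (e i)"
        using ij e_eq_iff[of i j] by (intro lower e_in) auto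
      then show False using e(2)[OF ij] by simp
    qed
  next
    fix v assume "v \<in> S"
    then show "B v v = 1" using p_entry[of v] p_neq[of v] by (auto simp: B_def perturb_def)
  next
    fix j assume j: "j \<in> S"
    have BT: "(\<Sum>w\<in>S. B u w * \<phi> j w) = \<phi> j u" if "u \<in> T" for u
      using that T sum_mult_of_bool(4)[OF fin, of u "\<phi> j"] by (auto simp: B_def)
    have BS: "(\<Sum>w\<in>S. B u w * \<phi> j w) = (E j - x) * \<phi> j (p u)" if u: "u \<in> S - T" for u
    proof -
      have "(\<Sum>w\<in>S. B u w * \<phi> j w) = (\<Sum>w\<in>S. perturb A W (p u) w * \<phi> j w)
          - (\<Sum>w\<in>S. of_bool (p u = w) * (x * \<phi> j w))"
        using u by (simp add: B_def left_diff_distrib sum_subtractf mult.assoc)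
      also have "\<dots> = E j * \<phi> j (p u) - x * \<phi> j (p u)"
        unfolding sum_mult_of_bool(4)[OF fin p_in[OF u]] eigenbasisD(2)[OF eb j p_in[OF u]] ..
      finally show ?thesis by (simp add: algebra_simps)
    qed
    have "(\<Sum>u\<in>S. (\<Sum>w\<in>S. B u w * \<phi> j w)\<^sup>2)
        = (\<Sum>u\<in>T. (\<phi> j u)\<^sup>2) + (\<Sum>u\<in>S - T. ((E j - x) * \<phi> j (p u))\<^sup>2)"
      using sum.subset_diff[OF T fin, of "\<lambda>u. (\<Sum>w\<in>S. B u w * \<phi> j w)\<^sup>2"]
      by (simp add: BT BS add.commute)
    also have "(\<Sum>u\<in>S - T. ((E j - x) * \<phi> j (p u))\<^sup>2) = (E j - x)\<^sup>2 * (\<Sum>w\<in>p ` (S - T). (\<phi> j w)\<^sup>2)"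
      by (simp add: sum.reindex[OF p_inj] power_mult_distrib sum_distrib_left)
    also have "\<dots> \<le> (E j - x)\<^sup>2 * (\<Sum>w\<in>S. (\<phi> j w)\<^sup>2)"
      using p_in by (intro mult_left_mono sum_mono2 fin) auto
    also have "(\<Sum>w\<in>S. (\<phi> j w)\<^sup>2) = 1"
      using orthobasisD(1)[OF eigenbasisD(1)[OF eb] j j] by (simp add: power2_eq_square)
    finally show "(\<Sum>u\<in>S. (\<Sum>w\<in>S. B u w * \<phi> j w)\<^sup>2) \<le> d j" using le[OF j] by simp
  qed
qed

text \<open>A logarithmic bound on the density of states. Eigenvectors with mass above \<theta> on
  \<open>T\<close> number at most \<open>card T / \<theta>\<close>, because the total mass on
  \<open>T\<close> is \<open>card T\<close>. For the k others in the window
  \<open>d j = 2 * \<theta>\<close> is admissible, since \<theta> + \<theta>^2 \<le> 2 \<theta>;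
  with \<open>C\<close> elsewhere, 1 \<le> (2\<theta>)^k C^n for n = \<open>card S\<close>, and
  logarithms bound k.\<close>

lemma card_eigenvalues_window:
  assumes eb: "eigenbasis S (perturb A W) \<phi> E" and \<theta>: "0 < \<theta>" "\<theta> < 1 / 2"
    and C: "\<And>j. j \<in> S \<Longrightarrow> 1 + (E j - x)\<^sup>2 \<le> C" and C1: "1 \<le> C"
  shows "real (card {j\<in>S. \<bar>E j - x\<bar> \<le> \<theta>}) \<le> card S * (ln C / ln (1 / (2 * \<theta>))) + card T / \<theta>"
proof -
  note ob = orthobasisD[OF eigenbasisD(1)[OF eb]]
  define b where "b j = (\<Sum>u\<in>T. (\<phi> j u)\<^sup>2)" for j
  define X where "X = {j\<in>S. \<bar>E j - x\<bar> \<le> \<theta>}"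
  define X1 where "X1 = {j\<in>X. b j \<le> \<theta>}"
  have finX: "finite X" "X \<subseteq> S" "finite X1" "X1 \<subseteq> X" "X1 \<subseteq> S" using fin by (auto simp: X_def X1_def)
  have b_nonneg: "0 \<le> b j" for j by (simp add: b_def sum_nonneg)
  have b_le: "b j \<le> 1" if "j \<in> S" for j
  proof -
    have "b j \<le> (\<Sum>u\<in>S. (\<phi> j u)\<^sup>2)" unfolding b_def using T by (intro sum_mono2 fin) auto
    then show ?thesis using ob(1)[OF that that] by (simp add: power2_eq_square)
  qed
  have "(\<Sum>j\<in>S. b j) = (\<Sum>u\<in>T. \<Sum>j\<in>S. \<phi> j u * \<phi> j u)"
    unfolding b_def by (subst sum.swap) (simp add: power2_eq_square)
  also have "\<dots> = (\<Sum>u\<in>T. 1)" using T by (intro sum.cong refl) (auto simp: ob(2))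
  finally have sum_b: "(\<Sum>j\<in>S. b j) = card T" by simp
  have "\<theta> * card (X - X1) = (\<Sum>j\<in>X - X1. \<theta>)" by simp
  also have "\<dots> \<le> (\<Sum>j\<in>X - X1. b j)" by (intro sum_mono) (auto simp: X1_def)
  also have "\<dots> \<le> (\<Sum>j\<in>S. b j)" using finX by (intro sum_mono2 fin b_nonneg) auto
  finally have "real (card (X - X1)) \<le> card T / \<theta>"
    using \<theta> sum_b by (simp add: field_simps)
  moreover have "card X = card X1 + card (X - X1)"
    using finX by (metis card_Diff_subset card_mono le_add_diff_inverse)
  ultimately have cardX: "real (card X) \<le> card X1 + card T / \<theta>" by simp
  define d where "d j = (if j \<in> X1 then 2 * \<theta> else C)" for j
  have "1 \<le> (\<Prod>j\<in>S. d j)"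
  proof (rule prod_eigenvalue_distance[OF eb])
    show "d j > 0" for j using \<theta> C1 by (auto simp: d_def)
    show "(\<Sum>u\<in>T. (\<phi> j u)\<^sup>2) + (E j - x)\<^sup>2 \<le> d j" if j: "j \<in> S" for j
    proof (cases "j \<in> X1")
      case True
      then have "\<bar>E j - x\<bar> \<le> \<theta>" "b j \<le> \<theta>" by (auto simp: X1_def X_def)
      moreover have "(E j - x)\<^sup>2 \<le> \<theta>\<^sup>2" using power_mono[OF \<open>\<bar>E j - x\<bar> \<le> \<theta>\<close>, of 2] by simp
      moreover have "\<theta>\<^sup>2 \<le> \<theta>" unfolding power2_eq_square using \<theta> by (intro mult_right_le_one_le) auto
      ultimately show ?thesis using True by (simp add: d_def b_def)
    next
      case False
      then show ?thesis using b_le[OF j] C[OF j] by (simp add: d_def b_def)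
    qed
  qed
  also have "(\<Prod>j\<in>S. d j) = (\<Prod>j\<in>X1. 2 * \<theta>) * (\<Prod>j\<in>S - X1. C)"
    using prod.subset_diff[OF finX(5) fin, of d] by (simp add: d_def mult.commute)
  also have "\<dots> \<le> (2 * \<theta>) ^ card X1 * C ^ card S"
    using \<theta> C1 fin by (auto intro!: mult_left_mono power_increasing card_mono)
  finally have "0 \<le> ln ((2 * \<theta>) ^ card X1 * C ^ card S)" by simp
  also have "\<dots> = card X1 * ln (2 * \<theta>) + card S * ln C"
    using \<theta> C1 by (simp add: ln_mult ln_realpow distrib_left)
  also have "ln (2 * \<theta>) = - ln (1 / (2 * \<theta>))" using \<theta> by (simp add: ln_div)
  finally have "card X1 * ln (1 / (2 * \<theta>)) \<le> card S * ln C" by simp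
  moreover have "ln (1 / (2 * \<theta>)) > 0" using \<theta> by (intro ln_gt_zero) simp
  ultimately have "real (card X1) \<le> card S * (ln C / ln (1 / (2 * \<theta>)))"
    by (simp add: field_simps)
  then show ?thesis using cardX by (simp add: X_def)
qed

end

section \<open>Energies at which a wave is far from its extreme values\<close>

lemma small_cos_near_zero:
  assumes \<theta>: "0 < \<theta>" "\<theta> \<le> 1" and y: "\<bar>cos y\<bar> < sin \<theta>"
  shows "\<bar>y - (real_of_int \<lfloor>y / pi\<rfloor> + 1 / 2) * pi\<bar> < \<theta>"
proof -
  define k where "k = \<lfloor>y / pi\<rfloor>"
  \<comment> \<open>The offset of \<open>y\<close> from the zero (k + 1/2) pi of the cosine in the
    same interval [k pi, (k + 1) pi); there |cos y| = sin |s|, which is increasing in |s|.\<close>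
  define s where "s = y - (real_of_int k + 1 / 2) * pi"
  have k: "real_of_int k \<le> y / pi" "y / pi < real_of_int k + 1" by (auto simp: k_def)
  then have "real_of_int k * pi \<le> y" "y < (real_of_int k + 1) * pi"
    by (auto simp: field_simps)
  then have s: "- (pi / 2) \<le> s" "s \<le> pi / 2" by (auto simp: s_def algebra_simps)
  have "y = s + pi / 2 + real_of_int k * pi" by (simp add: s_def algebra_simps)
  then have "\<bar>cos y\<bar> = \<bar>sin s\<bar>"
    by (simp add: cos_add sin_add cos_integer_2pi) (simp add: mult.commute)
  also have "\<bar>sin s\<bar> = sin \<bar>s\<bar>"
    using s sin_ge_zero[of s] sin_ge_zero[of "-s"] by (cases "0 \<le> s") auto
  finally have "sin \<bar>s\<bar> < sin \<theta>" using y by simp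
  moreover have "\<theta> \<le> pi / 2" using \<theta> pi_ge_two by linarith
  ultimately have "\<bar>s\<bar> < \<theta>"
    using sin_monotone_2pi_le[of \<theta> "\<bar>s\<bar>"] s \<theta> by (force simp: abs_le_iff)
  then show ?thesis by (simp add: s_def k_def)
qed


text \<open>The choice of \<open>b\<close> gives 1 - b^2 = 3 s^2 b^2, so the square of the wave is
  C^2 / (C^2 + 3 s^2) with C the cosine. This is below 1/4 exactly when C^2 < s^2, whence the factor
  3.\<close>

lemma cos_small_of_wave_small:
  assumes s: "0 < s" and b: "b = 1 / sqrt (1 + 3 * s\<^sup>2)" and w: "\<bar>wave b \<omega> x\<bar> < 1 / 2"
  shows "\<bar>cos (\<omega> * x)\<bar> < s"
proof -
  define C where "C = cos (\<omega> * x)"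
  have pos: "1 + 3 * s\<^sup>2 > 0" using s by (simp add: add_pos_nonneg)
  have b2: "b\<^sup>2 = 1 / (1 + 3 * s\<^sup>2)" using pos by (simp add: b power_divide)
  have b0: "b\<^sup>2 > 0" using pos b2 by simp
  have "1 - b\<^sup>2 = 3 * s\<^sup>2 * b\<^sup>2" using pos by (simp add: b2 field_simps)
  then have wave: "wave b \<omega> x = b * C / sqrt (b\<^sup>2 * (C\<^sup>2 + 3 * s\<^sup>2))"
    by (simp add: wave_def C_def power_mult_distrib algebra_simps)
  have D: "C\<^sup>2 + 3 * s\<^sup>2 > 0" using s by (simp add: add_nonneg_pos)
  have "(wave b \<omega> x)\<^sup>2 = b\<^sup>2 * C\<^sup>2 / (b\<^sup>2 * (C\<^sup>2 + 3 * s\<^sup>2))"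
    using D b0 unfolding wave by (simp add: power_divide power_mult_distrib real_sqrt_pow2)
  also have "\<dots> = C\<^sup>2 / (C\<^sup>2 + 3 * s\<^sup>2)" using b0 by simp
  finally have "C\<^sup>2 / (C\<^sup>2 + 3 * s\<^sup>2) = \<bar>wave b \<omega> x\<bar>\<^sup>2" by simp
  also have "\<dots> < (1 / 2)\<^sup>2" by (rule power_strict_mono[OF w]) auto
  finally have "C\<^sup>2 * 4 < C\<^sup>2 + 3 * s\<^sup>2" using D by (simp add: power_divide field_simps)
  then have "\<bar>C\<bar>\<^sup>2 < s\<^sup>2" by simp
  then show ?thesis unfolding C_def[symmetric] using s by (simp add: power2_less_imp_less)
qed

text \<open>Energies in [-R, R] where the wave is below 1/2 lie close to one of \<open>N\<close>
  zeros of the cosine, and \<open>N\<close> depends on \<omega> and R alone. The radius \<theta> of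
  the windows around them can therefore be chosen after \<open>N\<close>, small enough for
  \<open>card_eigenvalues_window\<close>.\<close>

lemma exists_sharp_wave:
  fixes R \<omega> c :: real
  assumes R: "0 \<le> R" and \<omega>: "0 < \<omega>" and c: "0 < c"
  shows "\<exists>(b::real) (L::real). 0 < b \<and> b < 1 \<and> 0 \<le> L \<and> (\<forall>(S::'a set) A T p \<rho> R\<^sub>0 \<Lambda> W. propagating_kernel S A T p \<rho> R\<^sub>0 \<longrightarrow>
    (\<forall>v\<in>S. \<bar>W v\<bar> \<le> \<Lambda>) \<longrightarrow> R\<^sub>0 + \<Lambda> \<le> R \<longrightarrow> L * card T \<le> card S \<longrightarrow>
    real (card {j\<in>S. \<bar>wave b \<omega> (eigenvalue_at S (perturb A W) j)\<bar> < 1 / 2}) \<le> c * card S)"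
proof -
  define M where "M = \<lceil>\<omega> * R / pi\<rceil> + 1"
  have M: "\<omega> * R / pi \<le> real_of_int M - 1" unfolding M_def by linarith
  have "0 \<le> \<omega> * R / pi" using R \<omega> by simp
  then have M0: "0 < M" using M by linarith
  define N where "N = real (card {-M..M})"
  have N: "0 < N" using M0 by (simp add: N_def)
  define z where "z k = (real_of_int k + 1 / 2) * pi / \<omega>" for k
  define Z where "Z = (real_of_int M + 1) * pi / \<omega>"
  have Z: "\<bar>z k\<bar> \<le> Z" if "k \<in> {-M..M}" for k
  proof -
    have "\<bar>real_of_int k + 1 / 2\<bar> \<le> real_of_int M + 1" using that by (auto simp: abs_le_iff)
    then show ?thesis using \<omega> by (simp add: z_def Z_def abs_mult divide_right_mono mult_right_mono)
  qed
  define C where "C = 1 + (R + Z)\<^sup>2"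
  have C: "1 \<le> C" by (simp add: C_def)
  \<comment> \<open>\<open>Q\<close> becomes ln (1 / (2 \<theta>)), large enough that the
    logarithmic terms of all \<open>N\<close> windows cost at most \<open>c / 2\<close>; the summand
    1 gives positivity from \<open>1 \<le> C\<close> alone.\<close>
  define Q where "Q = 2 * N * ln C / c + 1"
  have Q: "0 < Q" using N C c by (simp add: Q_def add_nonneg_pos)
  have "2 * N * ln C / c \<le> Q" by (simp add: Q_def)
  then have NQ: "N * (ln C / Q) \<le> c / 2" using c Q by (simp add: field_simps)
  define \<theta> where "\<theta> = exp (- Q) / 2"
  have \<theta>: "0 < \<theta>" "\<theta> < 1 / 2" "ln (1 / (2 * \<theta>)) = Q"
    using Q by (auto simp: \<theta>_def ln_div)
  \<comment> \<open>The terms \<open>card T / \<theta>\<close> of all windows take the other half of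
    \<open>c\<close>.\<close>
  define L where "L = 2 * N / (c * \<theta>)"
  have L: "0 < L" using N c \<theta> by (simp add: L_def)
  \<comment> \<open>A window of radius \<theta> in energy has radius \<omega> \<theta> in phase; the
    cap at 1 stays in the range where the sine is increasing.\<close>
  define \<theta>' where "\<theta>' = min 1 (\<omega> * \<theta>)"
  have \<theta>': "0 < \<theta>'" "\<theta>' \<le> 1" "\<theta>' \<le> \<omega> * \<theta>" using \<omega> \<theta> by (auto simp: \<theta>'_def)
  define s where "s = sin \<theta>'"
  have s: "0 < s" unfolding s_def using \<theta>' pi_ge_two by (intro sin_gt_zero) auto
  define b where "b = 1 / sqrt (1 + 3 * s\<^sup>2)"
  have b: "0 < b" "b < 1" using s by (auto simp: b_def add_pos_nonneg)
  show ?thesis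
  proof (rule exI[of _ b], rule exI[of _ L], intro conjI allI impI b)
    show "0 \<le> L" using L by simp
    fix S :: "'a set" and A T p \<rho> R\<^sub>0 \<Lambda> and W :: "'a \<Rightarrow> real"
    assume pk: "propagating_kernel S A T p \<rho> R\<^sub>0" and W: "\<forall>v\<in>S. \<bar>W v\<bar> \<le> \<Lambda>"
      and R\<^sub>0: "R\<^sub>0 + \<Lambda> \<le> R" and LT: "L * card T \<le> card S"
    interpret propagating_kernel S A T p \<rho> R\<^sub>0 by (rule pk)
    define E where "E = eigenvalue_at S (perturb A W)"
    have eb: "eigenbasis S (perturb A W) (eigenvector_at S (perturb A W)) E"
      unfolding E_def by (rule eigenbasis_eigensystem[OF fin symmetric_on_perturb[OF sym]])
    have E: "\<bar>E j\<bar> \<le> R" if "j \<in> S" for j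
      using abs_eigenvalue_at_le[of W \<Lambda> j] W that R\<^sub>0 by (auto simp: E_def)
    have cover: "{j\<in>S. \<bar>wave b \<omega> (E j)\<bar> < 1 / 2} \<subseteq> (\<Union>k\<in>{-M..M}. {j\<in>S. \<bar>E j - z k\<bar> \<le> \<theta>})"
    proof
      fix j assume "j \<in> {j\<in>S. \<bar>wave b \<omega> (E j)\<bar> < 1 / 2}"
      then have j: "j \<in> S" "\<bar>wave b \<omega> (E j)\<bar> < 1 / 2" by auto
      define k where "k = \<lfloor>\<omega> * E j / pi\<rfloor>"
      have "\<bar>\<omega> * E j - (real_of_int k + 1 / 2) * pi\<bar> < \<theta>'"
        unfolding k_def
        using cos_small_of_wave_small[OF s b_def j(2)] by (intro small_cos_near_zero \<theta>') (simp add: s_def)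
      moreover have "\<omega> * E j - (real_of_int k + 1 / 2) * pi = \<omega> * (E j - z k)"
        using \<omega> by (simp add: z_def right_diff_distrib)
      ultimately have "\<omega> * \<bar>E j - z k\<bar> \<le> \<omega> * \<theta>" using \<omega> \<theta>'(3) by (simp only: abs_mult)
      then have "\<bar>E j - z k\<bar> \<le> \<theta>" using \<omega> by simp
      moreover have "k \<in> {-M..M}"
      proof -
        have "\<bar>\<omega> * E j / pi\<bar> \<le> \<omega> * R / pi"
          using \<omega> E[OF j(1)] by (simp add: abs_mult divide_right_mono)
        then have "\<bar>\<omega> * E j / pi\<bar> \<le> real_of_int M - 1" using M by linarith
        then have "- real_of_int M \<le> \<omega> * E j / pi" "\<omega> * E j / pi \<le> real_of_int M" by linarith+
        then have "- M \<le> k" "k \<le> M" unfolding k_def by linarith+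
        then show ?thesis by simp
      qed
      ultimately show "j \<in> (\<Union>k\<in>{-M..M}. {j\<in>S. \<bar>E j - z k\<bar> \<le> \<theta>})" using j(1) by blast
    qed
    have window: "real (card {j\<in>S. \<bar>E j - z k\<bar> \<le> \<theta>}) \<le> card S * (ln C / Q) + card T / \<theta>"
      if k: "k \<in> {-M..M}" for k
      unfolding \<theta>(3)[symmetric]
    proof (rule card_eigenvalues_window[OF eb \<theta>(1,2) _ C])
      fix j assume j: "j \<in> S"
      have "\<bar>E j - z k\<bar> \<le> R + Z" using E[OF j] Z[OF k] by linarith
      then have "\<bar>E j - z k\<bar>\<^sup>2 \<le> (R + Z)\<^sup>2" by (intro power_mono) auto
      then show "1 + (E j - z k)\<^sup>2 \<le> C" by (simp add: C_def)
    qed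
    have "card {j\<in>S. \<bar>wave b \<omega> (E j)\<bar> < 1 / 2} \<le> card (\<Union>k\<in>{-M..M}. {j\<in>S. \<bar>E j - z k\<bar> \<le> \<theta>})"
      using cover fin by (intro card_mono) auto
    also have "\<dots> \<le> (\<Sum>k\<in>{-M..M}. card {j\<in>S. \<bar>E j - z k\<bar> \<le> \<theta>})"
      by (rule card_UN_le) simp
    finally have "real (card {j\<in>S. \<bar>wave b \<omega> (E j)\<bar> < 1 / 2})
        \<le> real (\<Sum>k\<in>{-M..M}. card {j\<in>S. \<bar>E j - z k\<bar> \<le> \<theta>})"
      by (rule of_nat_mono)
    then have "real (card {j\<in>S. \<bar>wave b \<omega> (E j)\<bar> < 1 / 2})
        \<le> (\<Sum>k\<in>{-M..M}. real (card {j\<in>S. \<bar>E j - z k\<bar> \<le> \<theta>}))"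
      by (simp only: of_nat_sum)
    also have "\<dots> \<le> (\<Sum>k\<in>{-M..M}. card S * (ln C / Q) + card T / \<theta>)"
      by (intro sum_mono window)
    also have "\<dots> = card S * (N * (ln C / Q)) + N / \<theta> * card T"
      by (simp add: N_def algebra_simps)
    also have "N / \<theta> * card T = c / 2 * (L * card T)"
      using c by (simp add: L_def)
    also have "card S * (N * (ln C / Q)) + c / 2 * (L * card T) \<le> card S * (c / 2) + c / 2 * card S"
      using NQ LT c by (intro add_mono mult_left_mono) auto
    finally show "real (card {j\<in>S. \<bar>wave b \<omega> (eigenvalue_at S (perturb A W) j)\<bar> < 1 / 2}) \<le> c * card S"
      by (simp add: E_def field_simps)
  qed
qed

section \<open>Refining partitions of the energy axis\<close>

text \<open>
  The nodes \<open>1, 2, 3, \<dots>\<close> of the infinite binary tree carry a partition of unity that is refined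
  at node \<open>i\<close> by the factors \<open>(1 \<plusminus> s i) / 2\<close> for its children \<open>2 i\<close> and \<open>2 i + 1\<close>.
\<close>

fun node_weight :: "(nat \<Rightarrow> real \<Rightarrow> real) \<Rightarrow> nat \<Rightarrow> real \<Rightarrow> real" where
  "node_weight s j x = (if j \<le> 1 then 1
     else node_weight s (j div 2) x * ((1 + (if even j then 1 else -1) * s (j div 2) x) / 2))"

declare node_weight.simps [simp del]

lemma node_weight_root: "j \<le> 1 \<Longrightarrow> node_weight s j = (\<lambda>x. 1)"
  by (rule ext) (simp add: node_weight.simps)

lemma node_weight_child:
  "1 < j \<Longrightarrow> node_weight s j =
    (\<lambda>x. node_weight s (j div 2) x * ((1 + (if even j then 1 else -1) * s (j div 2) x) / 2))"
  by (rule ext) (subst node_weight.simps, simp)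

text \<open>Only the waves at proper ancestors of \<open>j\<close> enter, and these have smaller
  index. Hence the waves may be chosen in the order of their index without altering weights already
  in use.\<close>

lemma node_weight_cong:
  assumes "\<And>i. i < j \<Longrightarrow> s i = t i"
  shows "node_weight s j = node_weight t j"
  using assms
proof (induction j rule: less_induct)
  case (less j)
  show ?case
  proof (cases "j \<le> 1")
    case False
    then have j: "1 < j" "j div 2 < j" by auto
    have "node_weight s (j div 2) = node_weight t (j div 2)"
      using j(2) by (intro less.IH less.prems) auto
    then show ?thesis
      unfolding node_weight_child[OF j(1)] using less.prems[OF j(2)] by simp
  qed (simp add: node_weight_root)
qed

lemma node_weight_bounds:
  assumes "\<And>i. \<bar>s i x\<bar> \<le> 1"
  shows "0 \<le> node_weight s j x \<and> node_weight s j x \<le> 1"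
proof (induction j rule: less_induct)
  case (less j)
  show ?case
  proof (cases "j \<le> 1")
    case False
    then have j: "1 < j" "j div 2 < j" by auto
    define c where "c = (1 + (if even j then 1 else -1) * s (j div 2) x) / 2"
    have c: "0 \<le> c" "c \<le> 1" using assms[of "j div 2"] by (auto simp: c_def abs_le_iff)
    show ?thesis
      unfolding node_weight_child[OF j(1)] c_def[symmetric]
      using less.IH[OF j(2)] c by (auto intro: mult_le_one)
  qed (simp add: node_weight_root)
qed

lemma tame_node_weight:
  assumes "\<And>i. \<exists>s'. tame (s i) s'"
  shows "\<exists>g. tame (node_weight s j) g"
proof (induction j rule: less_induct)
  case (less j)
  show ?case
  proof (cases "j \<le> 1")
    case True
    then show ?thesis using tame_const[of 1] by (auto simp: node_weight_root)
  next
    case False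
    then have j: "1 < j" "j div 2 < j" by auto
    obtain g where g: "tame (node_weight s (j div 2)) g" using less.IH[OF j(2)] by blast
    obtain s' where s': "tame (s (j div 2)) s'" using assms by blast
    define \<epsilon> :: real where "\<epsilon> = (if even j then 1 else -1)"
    have eq: "(1 + \<epsilon> * y) / 2 = 1 / 2 + \<epsilon> / 2 * y" for y by (simp add: field_simps)
    show ?thesis
      unfolding node_weight_child[OF j(1)] \<epsilon>_def[symmetric] eq
      by (rule exI, rule tame_mult[OF g tame_add[OF tame_const tame_mult[OF tame_const s']]])
  qed
qed

lemma common_lipschitz_constant:
  assumes "finite I" "\<And>i. i \<in> I \<Longrightarrow> \<exists>g. tame (f i) g"
  shows "\<exists>\<Lambda>>0. \<forall>i\<in>I. \<forall>x y. \<bar>f i x - f i y\<bar> \<le> \<Lambda> * \<bar>x - y\<bar>"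
  using assms
proof (induction I rule: finite_induct)
  case empty
  show ?case by (auto intro: exI[of _ 1])
next
  case (insert i I)
  obtain \<Lambda> where \<Lambda>: "\<Lambda> > 0" "\<And>i x y. i \<in> I \<Longrightarrow> \<bar>f i x - f i y\<bar> \<le> \<Lambda> * \<bar>x - y\<bar>"
    using insert by auto
  obtain g where "tame (f i) g" using insert.prems by blast
  then obtain B where B: "B > 0" "\<And>x y. \<bar>f i x - f i y\<bar> \<le> B * \<bar>x - y\<bar>"
    using tameE by metis
  have *: "\<bar>f k x - f k y\<bar> \<le> (\<Lambda> + B) * \<bar>x - y\<bar>" if "k \<in> insert i I" for k x y
  proof -
    have "0 \<le> \<Lambda> * \<bar>x - y\<bar>" "0 \<le> B * \<bar>x - y\<bar>" using \<Lambda>(1) B(1) by simp_all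
    then show ?thesis
      using that \<Lambda>(2)[of k x y] B(2)[of x y] unfolding distrib_right by auto
  qed
  show ?case
  proof (intro exI[of _ "\<Lambda> + B"] conjI ballI allI)
    show "0 < \<Lambda> + B" using \<Lambda>(1) B(1) by simp
  qed (rule *)
qed

text \<open>\<open>ty\<close> only fixes the type of the vertices. The eigenvalue count is demanded
  for all \<open>W\<close> at once, because the final potential is known only after all waves; the
  bound \<open>\<Lambda> + 1\<close> admits any perturbation by at most 1 of a potential bounded by
  \<Lambda>.\<close>

definition balanced_wave_family ::
    "'a itself \<Rightarrow> real \<Rightarrow> real \<Rightarrow> nat \<Rightarrow> real \<Rightarrow> real \<Rightarrow> (nat \<Rightarrow> real \<Rightarrow> real) \<Rightarrow> real \<Rightarrow> bool" where
  "balanced_wave_family (ty :: 'a itself) R \<Lambda> m \<delta> c s L \<longleftrightarrow>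
     (\<forall>i x. \<bar>s i x\<bar> \<le> 1) \<and> (\<forall>i. \<exists>s'. tame (s i) s') \<and>
     (\<forall>(S::'a set) A T p \<rho>. propagating_kernel S A T p \<rho> R \<longrightarrow> L * card T \<le> card S \<longrightarrow>
       (\<forall>i\<in>{1..m}. \<forall>W. (\<forall>v\<in>S. \<bar>W v\<bar> \<le> \<Lambda> + 1) \<longrightarrow>
          real (card {j\<in>S. \<bar>s i (eigenvalue_at S (perturb A W) j)\<bar> < 1 / 2}) \<le> c * card S) \<and>
       (\<forall>V. \<exists>W. (\<forall>v\<in>S. \<bar>W v - V v\<bar> \<le> \<delta>) \<and> (\<forall>i\<in>{1..m}.
          (\<Sum>v\<in>S. (spectral_mean S (perturb A W) (\<lambda>x. node_weight s i x * s i x) v)\<^sup>2) \<le> c * card S)))"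

lemma balanced_wave_familyD:
  assumes "balanced_wave_family TYPE('a) R \<Lambda> m \<delta> c s L"
  shows "\<And>i x. \<bar>s i x\<bar> \<le> 1" "\<And>i. \<exists>s'. tame (s i) s'"
    and "\<And>(S::'a set) A T p \<rho> i W. propagating_kernel S A T p \<rho> R \<Longrightarrow> L * card T \<le> card S \<Longrightarrow>
      i \<in> {1..m} \<Longrightarrow> (\<And>v. v \<in> S \<Longrightarrow> \<bar>W v\<bar> \<le> \<Lambda> + 1) \<Longrightarrow>
      real (card {j\<in>S. \<bar>s i (eigenvalue_at S (perturb A W) j)\<bar> < 1 / 2}) \<le> c * card S"
    and "\<And>(S::'a set) A T p \<rho> V. propagating_kernel S A T p \<rho> R \<Longrightarrow> L * card T \<le> card S \<Longrightarrow>
      \<exists>W. (\<forall>v\<in>S. \<bar>W v - V v\<bar> \<le> \<delta>) \<and> (\<forall>i\<in>{1..m}.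
        (\<Sum>v\<in>S. (spectral_mean S (perturb A W) (\<lambda>x. node_weight s i x * s i x) v)\<^sup>2) \<le> c * card S)"
proof -
  note fam = assms[unfolded balanced_wave_family_def]
  show "\<bar>s i x\<bar> \<le> 1" for i x
    by (rule fam[THEN conjunct1, rule_format])
  show "\<exists>s'. tame (s i) s'" for i
    by (rule fam[THEN conjunct2, THEN conjunct1, rule_format])
  fix S :: "'a set" and A T p \<rho>
  assume "propagating_kernel S A T p \<rho> R" "L * card T \<le> card S"
  note fam' = fam[THEN conjunct2, THEN conjunct2, rule_format, OF this]
  show "\<exists>W. (\<forall>v\<in>S. \<bar>W v - V v\<bar> \<le> \<delta>) \<and> (\<forall>i\<in>{1..m}.
      (\<Sum>v\<in>S. (spectral_mean S (perturb A W) (\<lambda>x. node_weight s i x * s i x) v)\<^sup>2) \<le> c * card S)" for V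
    by (rule fam'[THEN conjunct2, rule_format])
  show "real (card {j\<in>S. \<bar>s i (eigenvalue_at S (perturb A W) j)\<bar> < 1 / 2}) \<le> c * card S"
    if "i \<in> {1..m}" "\<And>v. v \<in> S \<Longrightarrow> \<bar>W v\<bar> \<le> \<Lambda> + 1" for i W
    by (rule fam'[THEN conjunct1, rule_format, OF that])
qed

text \<open>
  The waves are chosen one node at a time. Each later perturbation is so small compared with the
  Lipschitz constants of the earlier observables that the earlier balance survives.
\<close>

lemma exists_balanced_wave_family:
  fixes R \<Lambda> \<delta> c :: real
  assumes R: "0 \<le> R" "0 \<le> \<Lambda>" and \<delta>: "0 < \<delta>" and c: "0 < c"
  shows "\<exists>s L. 0 \<le> L \<and> balanced_wave_family TYPE('a) R \<Lambda> m \<delta> c s L"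
  using \<delta> c
proof (induction m arbitrary: \<delta> c)
  case 0
  have "balanced_wave_family TYPE('a) R \<Lambda> 0 \<delta> c (\<lambda>i x. 0) 0"
    unfolding balanced_wave_family_def
  proof (intro conjI allI impI ballI)
    show "\<exists>W. (\<forall>v\<in>S. \<bar>W v - V v\<bar> \<le> \<delta>) \<and> (\<forall>i\<in>{1..0}.
        (\<Sum>v\<in>S. (spectral_mean S (perturb A W) (\<lambda>x. node_weight (\<lambda>i x. 0) i x * 0) v)\<^sup>2)
          \<le> c * card S)" for S :: "'a set" and A V
      using 0 by (intro exI[of _ V]) auto
  qed (auto intro: tame_const)
  then show ?case by (intro exI[of _ "\<lambda>i x. 0 :: real"] exI[of _ "0::real"] conjI order_refl)
next
  case (Suc m)
  \<comment> \<open>Half of \<delta> is left for the next perturbation. The balance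
    \<open>c / 4\<close> of the old nodes and the change \<open>c / 4\<close> caused by that
    perturbation combine to \<open>c\<close> through a^2 \<le> 2 b^2 + 2 (b - a)^2.\<close>
  obtain s L where L: "0 \<le> L" and "balanced_wave_family TYPE('a) R \<Lambda> m (\<delta> / 2) (c / 4) s L"
    using Suc.IH[of "\<delta> / 2" "c / 4"] Suc.prems by auto
  note fam = balanced_wave_familyD[OF this(2)]
  define f where "f i x = node_weight s i x * s i x" for i x
  have "\<exists>g. tame (f i) g" for i
    unfolding f_def[abs_def] using tame_mult tame_node_weight[of s, OF fam(2)] fam(2) by blast
  then obtain K where K: "K > 0" "\<And>i x y. i \<in> {1..m} \<Longrightarrow> \<bar>f i x - f i y\<bar> \<le> K * \<bar>x - y\<bar>"
    using common_lipschitz_constant[of "{1..m}" f] by auto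
  define \<delta>' where "\<delta>' = min (\<delta> / 2) (sqrt (c / 4) / K)"
  have \<delta>': "0 < \<delta>'" "\<delta>' \<le> \<delta> / 2"
    unfolding \<delta>'_def using Suc.prems K(1) by (simp_all only: min.cobounded1) simp
  have K\<delta>': "K\<^sup>2 * \<delta>'\<^sup>2 \<le> c / 4"
  proof -
    have "K * \<delta>' \<le> sqrt (c / 4)"
      using K(1) mult_left_mono[of \<delta>' "sqrt (c / 4) / K" K] by (simp add: \<delta>'_def)
    then have "(K * \<delta>')\<^sup>2 \<le> (sqrt (c / 4))\<^sup>2" using K(1) \<delta>'(1) by (intro power_mono) auto
    then show ?thesis using Suc.prems by (simp add: power_mult_distrib)
  qed
  define \<eta> where "\<eta> = node_weight s (Suc m)"
  obtain \<eta>' where \<eta>': "tame \<eta> \<eta>'" using tame_node_weight[of s, OF fam(2)] unfolding \<eta>_def by blast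
  have \<eta>1: "\<bar>\<eta> x\<bar> \<le> 1" for x
    using node_weight_bounds[of s x "Suc m", OF fam(1)] by (simp add: \<eta>_def)
  obtain \<omega> where \<omega>: "\<omega> > 0" and balance: "\<forall>b. 0 < b \<longrightarrow> b < 1 \<longrightarrow> (\<forall>(S::'a set) A V. finite S \<longrightarrow>
      symmetric_on S A \<longrightarrow> (\<exists>W. (\<forall>v\<in>S. \<bar>W v - V v\<bar> \<le> \<delta>') \<and>
      (\<Sum>v\<in>S. (spectral_mean S (perturb A W) (\<lambda>x. \<eta> x * wave b \<omega> x) v)\<^sup>2) \<le> c * card S))"
    using exists_balancing_frequency[OF \<eta>' \<eta>1 \<delta>'(1) Suc.prems(2), where ?'a = 'a] by (elim exE conjE)
  have "0 \<le> R + (\<Lambda> + 1)" using R by simp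
  from exists_sharp_wave[OF this \<omega> Suc.prems(2), where ?'a = 'a]
  obtain b and L' :: real where b: "0 < b" "b < 1" and L': "0 \<le> L'"
    and sharp: "\<forall>(S::'a set) A T p \<rho> R\<^sub>0 \<Lambda>' W. propagating_kernel S A T p \<rho> R\<^sub>0 \<longrightarrow>
    (\<forall>v\<in>S. \<bar>W v\<bar> \<le> \<Lambda>') \<longrightarrow> R\<^sub>0 + \<Lambda>' \<le> R + (\<Lambda> + 1) \<longrightarrow> L' * card T \<le> card S \<longrightarrow>
    real (card {j\<in>S. \<bar>wave b \<omega> (eigenvalue_at S (perturb A W) j)\<bar> < 1 / 2}) \<le> c * card S"
    by (elim exE conjE)
  \<comment> \<open>The new wave sits at node m + 1, whose weight \<eta> involves old waves only; so
    \<eta> could be fixed before \<omega> and b.\<close>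
  define t where "t = s(Suc m := wave b \<omega>)"
  have t: "t i = s i" if "i \<le> m" for i using that by (simp add: t_def)
  have t_Suc: "t (Suc m) = wave b \<omega>" by (simp add: t_def)
  have nw: "node_weight t i = node_weight s i" if "i \<le> Suc m" for i
    using that by (intro node_weight_cong) (auto simp: t_def)
  define L'' where "L'' = max L L'"
  have L'': "L * card T \<le> card S" "L' * card T \<le> card S" if "L'' * card T \<le> card S" for S T :: "'a set"
    using that mult_right_mono[of L L'' "card T"] mult_right_mono[of L' L'' "card T"]
    by (auto simp: L''_def)
  have "balanced_wave_family TYPE('a) R \<Lambda> (Suc m) \<delta> c t L''"
    unfolding balanced_wave_family_def
  proof (intro conjI allI impI ballI)
    show "\<bar>t i x\<bar> \<le> 1" for i x using fam(1) wave_bound[OF b \<omega>] by (simp add: t_def)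
    show "\<exists>s'. tame (t i) s'" for i using fam(2)[of i] tame_wave[OF b \<omega>] by (simp add: t_def)
  next
    fix S :: "'a set" and A T p \<rho> i and W :: "'a \<Rightarrow> real"
    assume pk: "propagating_kernel S A T p \<rho> R" and LT: "L'' * card T \<le> card S"
      and i: "i \<in> {1..Suc m}" and W: "\<forall>v\<in>S. \<bar>W v\<bar> \<le> \<Lambda> + 1"
    show "real (card {j\<in>S. \<bar>t i (eigenvalue_at S (perturb A W) j)\<bar> < 1 / 2}) \<le> c * card S"
    proof (cases "i = Suc m")
      case True
      show ?thesis unfolding True t_Suc
        using sharp[rule_format, OF pk, of W "\<Lambda> + 1"] W L''(2)[OF LT] by simp
    next
      case False
      then have i': "i \<in> {1..m}" using i by auto
      have "real (card {j\<in>S. \<bar>s i (eigenvalue_at S (perturb A W) j)\<bar> < 1 / 2}) \<le> c / 4 * card S"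
        using W by (intro fam(3)[OF pk L''(1)[OF LT] i']) auto
      also have "\<dots> \<le> c * card S" using Suc.prems by (intro mult_right_mono) auto
      finally show ?thesis using i' by (simp add: t)
    qed
  next
    fix S :: "'a set" and A T p \<rho> and V :: "'a \<Rightarrow> real"
    assume pk: "propagating_kernel S A T p \<rho> R" and LT: "L'' * card T \<le> card S"
    interpret propagating_kernel S A T p \<rho> R by (rule pk)
    define n where "n = real (card S)"
    obtain W\<^sub>1 where W\<^sub>1: "\<And>v. v \<in> S \<Longrightarrow> \<bar>W\<^sub>1 v - V v\<bar> \<le> \<delta> / 2"
      "\<And>i. i \<in> {1..m} \<Longrightarrow> (\<Sum>v\<in>S. (spectral_mean S (perturb A W\<^sub>1) (f i) v)\<^sup>2) \<le> c / 4 * n"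
      using fam(4)[OF pk L''(1)[OF LT], of V] unfolding f_def[abs_def] n_def by blast
    obtain W where W: "\<And>v. v \<in> S \<Longrightarrow> \<bar>W v - W\<^sub>1 v\<bar> \<le> \<delta>'"
      "(\<Sum>v\<in>S. (spectral_mean S (perturb A W) (\<lambda>x. \<eta> x * wave b \<omega> x) v)\<^sup>2) \<le> c * n"
      using balance[rule_format, OF b fin sym, of W\<^sub>1] unfolding n_def by blast
    show "\<exists>W. (\<forall>v\<in>S. \<bar>W v - V v\<bar> \<le> \<delta>) \<and> (\<forall>i\<in>{1..Suc m}.
        (\<Sum>v\<in>S. (spectral_mean S (perturb A W) (\<lambda>x. node_weight t i x * t i x) v)\<^sup>2) \<le> c * card S)"
    proof (intro exI[of _ W] conjI ballI)
      show "\<bar>W v - V v\<bar> \<le> \<delta>" if "v \<in> S" for v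
        using W\<^sub>1(1)[OF that] W(1)[OF that] \<delta>'(2) by linarith
    next
      fix i assume i: "i \<in> {1..Suc m}"
      show "(\<Sum>v\<in>S. (spectral_mean S (perturb A W) (\<lambda>x. node_weight t i x * t i x) v)\<^sup>2) \<le> c * card S"
      proof (cases "i = Suc m")
        case True
        then show ?thesis using W(2) by (simp add: nw t_Suc \<eta>_def n_def)
      next
        case False
        then have i': "i \<in> {1..m}" using i by auto
        define a where "a v = spectral_mean S (perturb A W) (f i) v" for v
        define b where "b v = spectral_mean S (perturb A W\<^sub>1) (f i) v" for v
        have "(\<Sum>v\<in>S. (b v - a v)\<^sup>2) \<le> K\<^sup>2 * (\<Sum>v\<in>S. (W v - W\<^sub>1 v)\<^sup>2)"
          unfolding a_def b_def by (rule spectral_mean_lipschitz[OF fin sym K(2)[OF i']])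
        also have "\<dots> \<le> K\<^sup>2 * (\<Sum>v\<in>S. \<delta>'\<^sup>2)"
        proof (intro mult_left_mono sum_mono)
          fix v assume "v \<in> S"
          from power_mono[OF W(1)[OF this], of 2] show "(W v - W\<^sub>1 v)\<^sup>2 \<le> \<delta>'\<^sup>2" by simp
        qed simp
        also have "\<dots> = K\<^sup>2 * \<delta>'\<^sup>2 * n" by (simp add: n_def)
        also have "\<dots> \<le> c / 4 * n" using K\<delta>' by (intro mult_right_mono) (auto simp: n_def)
        finally have diff: "(\<Sum>v\<in>S. (b v - a v)\<^sup>2) \<le> c / 4 * n" .
        have "(\<Sum>v\<in>S. (a v)\<^sup>2) \<le> (\<Sum>v\<in>S. 2 * (b v)\<^sup>2 + 2 * (b v - a v)\<^sup>2)"
        proof (rule sum_mono)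
          fix v
          have "2 * (b v)\<^sup>2 + 2 * (b v - a v)\<^sup>2 - (a v)\<^sup>2 = (2 * b v - a v)\<^sup>2"
            by (simp add: power2_eq_square algebra_simps)
          then show "(a v)\<^sup>2 \<le> 2 * (b v)\<^sup>2 + 2 * (b v - a v)\<^sup>2"
            using zero_le_power2[of "2 * b v - a v"] by linarith
        qed
        also have "\<dots> = 2 * (\<Sum>v\<in>S. (b v)\<^sup>2) + 2 * (\<Sum>v\<in>S. (b v - a v)\<^sup>2)"
          by (simp add: sum.distrib sum_distrib_left)
        also have "\<dots> \<le> c * n" using diff W\<^sub>1(2)[OF i'] by (simp add: b_def)
        finally show ?thesis
          using i' by (simp add: a_def[abs_def] f_def[abs_def] nw t n_def)
      qed
    qed
  qed
  moreover have "0 \<le> L''" using L by (simp add: L''_def)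
  ultimately show ?case by blast
qed

text \<open>A child receives half of its parent's mean plus or minus half of a balance term, so an
  error e becomes at most (e + t) / 2 and never exceeds t.\<close>

lemma spectral_mean_node_weight:
  assumes S: "finite S" "symmetric_on S h" "v \<in> S"
    and t: "\<And>i. i \<in> {1..<2 ^ d} \<Longrightarrow> \<bar>spectral_mean S h (\<lambda>x. node_weight s i x * s i x) v\<bar> \<le> t" "0 \<le> t"
    and k: "k \<le> d" and j: "j \<in> {2 ^ k..<2 ^ Suc k}"
  shows "spectral_mean S h (node_weight s j) v \<le> (1 / 2) ^ k + t"
  using k j
proof (induction k arbitrary: j)
  case 0
  then have "j = 1" by auto
  then show ?case using spectral_mean_one[OF S] t(2) by (simp add: node_weight_root)
next
  case (Suc k)
  define i where "i = j div 2"
  define \<epsilon> :: real where "\<epsilon> = (if even j then 1 else -1)"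
  have j: "1 < j" 
    using Suc.prems(2) one_less_power[of "2::nat" "Suc k"] by (auto simp del: power_Suc)
  have i: "i \<in> {2 ^ k..<2 ^ Suc k}" using Suc.prems(2) by (auto simp: i_def)
  have "(2::nat) ^ Suc k \<le> 2 ^ d" using Suc.prems(1) by (intro power_increasing) auto
  then have "i \<in> {1..<2 ^ d}" using i one_le_power[of "2::nat" k] by (auto simp del: power_Suc)
  then have b: "\<bar>spectral_mean S h (\<lambda>x. node_weight s i x * s i x) v\<bar> \<le> t" by (rule t(1))
  have "spectral_mean S h (node_weight s j) v
      = spectral_mean S h (\<lambda>x. 1 / 2 * node_weight s i x + \<epsilon> / 2 * (node_weight s i x * s i x)) v"
    unfolding node_weight_child[OF j] i_def[symmetric] \<epsilon>_def[symmetric] by (simp add: field_simps)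
  also have "\<dots> = 1 / 2 * spectral_mean S h (node_weight s i) v
      + \<epsilon> / 2 * spectral_mean S h (\<lambda>x. node_weight s i x * s i x) v"
    unfolding spectral_mean_add spectral_mean_scale ..
  also have "\<dots> \<le> 1 / 2 * ((1 / 2) ^ k + t) + 1 / 2 * t"
  proof (rule add_mono)
    show "1 / 2 * spectral_mean S h (node_weight s i) v \<le> 1 / 2 * ((1 / 2) ^ k + t)"
      using Suc.IH[OF _ i] Suc.prems(1) by simp
    show "\<epsilon> / 2 * spectral_mean S h (\<lambda>x. node_weight s i x * s i x) v \<le> 1 / 2 * t"
      using b by (auto simp: \<epsilon>_def abs_le_iff)
  qed
  also have "\<dots> = (1 / 2) ^ Suc k + t" by (simp add: field_simps)
  finally show ?case .
qed

text \<open>At each node the child whose sign agrees with that of the wave is taken; its factor is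
  at least (1 + 1/2) / 2 = 3/4.\<close>

lemma exists_heavy_leaf:
  assumes "\<And>i x. \<bar>s i x\<bar> \<le> 1" and E: "\<And>i. i \<in> {1..<2 ^ d} \<Longrightarrow> 1 / 2 \<le> \<bar>s i E\<bar>"
  shows "k \<le> d \<Longrightarrow> \<exists>j\<in>{2 ^ k..<2 ^ Suc k}. (3 / 4) ^ k \<le> node_weight s j E"
proof (induction k)
  case 0
  then show ?case by (auto simp: node_weight_root)
next
  case (Suc k)
  then obtain i where i: "i \<in> {2 ^ k..<2 ^ Suc k}" "(3 / 4) ^ k \<le> node_weight s i E" by auto
  have "(2::nat) ^ Suc k \<le> 2 ^ d" using Suc.prems by (intro power_increasing) auto
  then have i1: "i \<in> {1..<2 ^ d}" using i(1) one_le_power[of "2::nat" k] by (auto simp del: power_Suc)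
  define j where "j = (if 0 \<le> s i E then 2 * i else 2 * i + 1)"
  have j: "j \<in> {2 ^ Suc k..<2 ^ Suc (Suc k)}" "1 < j" "j div 2 = i"
    using i(1) i1 by (auto simp: j_def)
  have "3 / 4 \<le> (1 + (if even j then 1 else -1) * s i E) / 2"
    using E[OF i1] by (auto simp: j_def)
  then have "(3 / 4) ^ k * (3 / 4) \<le> node_weight s i E * ((1 + (if even j then 1 else -1) * s i E) / 2)"
    using i(2) order_trans[OF _ i(2)] by (intro mult_mono) auto
  then have "(3 / 4) ^ Suc k \<le> node_weight s j E"
    unfolding node_weight_child[OF j(2)] j(3) by (simp add: mult.commute)
  then show ?case using j(1) by blast
qed

definition atom_weight :: "'a set \<Rightarrow> ('a \<Rightarrow> 'a \<Rightarrow> real) \<Rightarrow> 'a \<Rightarrow> real \<Rightarrow> real" where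
  "atom_weight S h v E = (\<Sum>j | j \<in> S \<and> eigenvalue_at S h j = E. (eigenvector_at S h j v)\<^sup>2)"

lemma atom_weight_mult_le_spectral_mean:
  assumes "finite S" "\<And>x. 0 \<le> g x"
  shows "g E * atom_weight S h v E \<le> spectral_mean S h g v"
proof -
  have "g E * atom_weight S h v E
      = (\<Sum>j | j \<in> S \<and> eigenvalue_at S h j = E. g (eigenvalue_at S h j) * (eigenvector_at S h j v)\<^sup>2)"
    unfolding atom_weight_def sum_distrib_left by (intro sum.cong) auto
  also have "\<dots> \<le> spectral_mean S h g v"
    unfolding spectral_mean_def using assms by (intro sum_mono2) auto
  finally show ?thesis .
qed

lemma card_Chebyshev:
  fixes f :: "'a \<Rightarrow> real"
  assumes "finite S" "0 < t" "\<And>v. v \<in> S \<Longrightarrow> 0 \<le> f v" "(\<Sum>v\<in>S. f v) \<le> c"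
  shows "real (card {v\<in>S. t < f v}) \<le> c / t"
proof -
  have "t * card {v\<in>S. t < f v} = (\<Sum>v\<in>{v\<in>S. t < f v}. t)" by simp
  also have "\<dots> \<le> (\<Sum>v\<in>{v\<in>S. t < f v}. f v)" by (intro sum_mono) auto
  also have "\<dots> \<le> (\<Sum>v\<in>S. f v)" using assms(1,3) by (intro sum_mono2) auto
  finally show ?thesis using assms(2,4) by (simp add: field_simps)
qed

text \<open>Outside the bad vertices an atom \<open>x\<close> heavier than \<epsilon> has |s i x|
  \<ge> 1/2 at every node: otherwise all its eigenvectors would lie in \<open>Z i\<close> and the
  zone would carry more than \<epsilon>. A leaf of weight at least (3/4)^d at \<open>x\<close> then
  has mass at least \<epsilon> (3/4)^d, against the upper bound (1/2)^d + t.\<close>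

theorem propagating_kernel_delocalization:
  fixes R \<Lambda> \<delta> \<epsilon> :: real
  assumes R: "0 \<le> R" "0 \<le> \<Lambda>" and \<delta>: "0 < \<delta>" "\<delta> \<le> 1" and \<epsilon>: "0 < \<epsilon>"
  shows "\<exists>L::real. \<forall>(S::'a set) A T p \<rho> V. propagating_kernel S A T p \<rho> R \<longrightarrow> L * card T \<le> card S \<longrightarrow>
    (\<forall>v\<in>S. \<bar>V v\<bar> \<le> \<Lambda>) \<longrightarrow> (\<exists>W. (\<forall>v\<in>S. \<bar>W v - V v\<bar> \<le> \<delta>) \<and>
      real (card {v\<in>S. \<exists>E. \<epsilon> < atom_weight S (perturb A W) v E}) \<le> \<delta> * card S)"
proof -
  \<comment> \<open>2/3 is the ratio of 1/2 to 3/4. The leaf bound (1/2)^d and the error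
    \<open>t\<close> each get half of \<epsilon> (3/4)^d.\<close>
  obtain d where d: "(2 / 3 :: real) ^ d < \<epsilon> / 2"
    using real_arch_pow_inv[of "\<epsilon> / 2" "2 / 3"] \<epsilon> by auto
  define m :: nat where "m = 2 ^ d - 1"
  have m: "{1..m} = {1..<2 ^ d}" by (auto simp: m_def)
  define t where "t = \<epsilon> / 2 * (3 / 4) ^ d"
  have t: "0 < t" using \<epsilon> by (simp add: t_def)
  \<comment> \<open>Per node and per unit of \<open>c\<close>, bad vertices have proportion at most
    1 / t^2 from unbalanced means and 1 / \<epsilon> from heavy zones. The m + 1 in \<open>c\<close>
    avoids a division by zero for d = 0.\<close>
  define q where "q = 1 / t\<^sup>2 + 1 / \<epsilon>"
  have q: "0 < q" using t \<epsilon> by (simp add: q_def add_pos_pos)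
  define c where "c = \<delta> / ((m + 1) * q)"
  have c: "0 < c" using \<delta> q by (simp add: c_def)
  have "c * q = \<delta> / (m + 1)" using q by (simp add: c_def)
  then have "(m + 1) * (c * q) = \<delta>" by simp
  moreover have "0 < c * q" using c q by simp
  ultimately have mc: "m * (c * q) \<le> \<delta>" by (simp add: algebra_simps)
  obtain s L where "balanced_wave_family TYPE('a) R \<Lambda> m \<delta> c s L"
    using exists_balanced_wave_family[OF R \<delta>(1) c] by blast
  note fam = balanced_wave_familyD[OF this]
  show ?thesis
  proof (rule exI[of _ L], intro allI impI)
    fix S :: "'a set" and A T p \<rho> and V :: "'a \<Rightarrow> real"
    assume pk: "propagating_kernel S A T p \<rho> R" and LT: "L * card T \<le> card S"
      and V: "\<forall>v\<in>S. \<bar>V v\<bar> \<le> \<Lambda>"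
    interpret propagating_kernel S A T p \<rho> R by (rule pk)
    obtain W where W: "\<And>v. v \<in> S \<Longrightarrow> \<bar>W v - V v\<bar> \<le> \<delta>"
      and bal: "\<And>i. i \<in> {1..m} \<Longrightarrow>
        (\<Sum>v\<in>S. (spectral_mean S (perturb A W) (\<lambda>x. node_weight s i x * s i x) v)\<^sup>2) \<le> c * card S"
      using fam(4)[OF pk LT, of V] by blast
    define h where "h = perturb A W"
    have h: "symmetric_on S h" unfolding h_def by (rule symmetric_on_perturb[OF sym])
    define mean where "mean i v = spectral_mean S h (\<lambda>x. node_weight s i x * s i x) v" for i v
    define E where "E = eigenvalue_at S h"
    define \<phi> where "\<phi> = eigenvector_at S h"
    have eb: "eigenbasis S h \<phi> E" unfolding E_def \<phi>_def by (rule eigenbasis_eigensystem[OF fin h])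
    have W1: "\<bar>W v\<bar> \<le> \<Lambda> + 1" if "v \<in> S" for v using W[OF that] V that \<delta>(2) by fastforce
    define Z where "Z i = {j\<in>S. \<bar>s i (E j)\<bar> < 1 / 2}" for i
    have Z: "real (card (Z i)) \<le> c * card S" if "i \<in> {1..m}" for i
      unfolding Z_def E_def h_def using W1 by (intro fam(3)[OF pk LT that])
    have finZ: "finite (Z i)" "Z i \<subseteq> S" for i using fin by (auto simp: Z_def)
    define zone where "zone i v = (\<Sum>j\<in>Z i. (\<phi> j v)\<^sup>2)" for i v
    have sum_zone: "(\<Sum>v\<in>S. zone i v) = card (Z i)" for i
    proof -
      have "(\<Sum>v\<in>S. zone i v) = (\<Sum>j\<in>Z i. \<Sum>v\<in>S. \<phi> j v * \<phi> j v)"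
        unfolding zone_def by (subst sum.swap) (simp add: power2_eq_square)
      also have "\<dots> = (\<Sum>j\<in>Z i. 1)"
      proof (rule sum.cong[OF refl])
        fix j assume "j \<in> Z i"
        then have "j \<in> S" using finZ by blast
        then show "(\<Sum>v\<in>S. \<phi> j v * \<phi> j v) = 1"
          using orthobasisD(1)[OF eigenbasisD(1)[OF eb], of j j] by simp
      qed
      finally show ?thesis by simp
    qed
    define bad where "bad i = {v\<in>S. t\<^sup>2 < (mean i v)\<^sup>2} \<union> {v\<in>S. \<epsilon> < zone i v}" for i
    have bad: "real (card (bad i)) \<le> c * q * card S" if i: "i \<in> {1..m}" for i
    proof -
      have "real (card {v\<in>S. t\<^sup>2 < (mean i v)\<^sup>2}) \<le> c * card S / t\<^sup>2"
        using t bal[OF i] by (intro card_Chebyshev fin) (auto simp: mean_def h_def)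
      moreover have "real (card {v\<in>S. \<epsilon> < zone i v}) \<le> c * card S / \<epsilon>"
      proof (intro card_Chebyshev fin \<epsilon>)
        show "0 \<le> zone i v" for v unfolding zone_def by (rule sum_nonneg) simp
      qed (use Z[OF i] in \<open>simp add: sum_zone\<close>)
      moreover have "card (bad i) \<le> card {v\<in>S. t\<^sup>2 < (mean i v)\<^sup>2} + card {v\<in>S. \<epsilon> < zone i v}"
        unfolding bad_def by (rule card_Un_le)
      ultimately have "real (card (bad i)) \<le> c * card S / t\<^sup>2 + c * card S / \<epsilon>" by linarith
      also have "\<dots> = c * q * card S" by (simp add: q_def algebra_simps)
      finally show ?thesis .
    qed
    have "{v\<in>S. \<exists>E. \<epsilon> < atom_weight S h v E} \<subseteq> (\<Union>i\<in>{1..m}. bad i)"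
    proof
      fix v assume "v \<in> {v\<in>S. \<exists>E. \<epsilon> < atom_weight S h v E}"
      then obtain x where v: "v \<in> S" and x: "\<epsilon> < atom_weight S h v x" by blast
      show "v \<in> (\<Union>i\<in>{1..m}. bad i)"
      proof (rule ccontr)
        assume "v \<notin> (\<Union>i\<in>{1..m}. bad i)"
        then have good: "(mean i v)\<^sup>2 \<le> t\<^sup>2" "zone i v \<le> \<epsilon>" if "i \<in> {1..m}" for i
          using v that by (force simp: bad_def)+
        have mean: "\<bar>mean i v\<bar> \<le> t" if "i \<in> {1..<2 ^ d}" for i
          using good(1)[of i] that t unfolding m by (simp add: abs_le_square_iff[symmetric])
        have sharp: "1 / 2 \<le> \<bar>s i x\<bar>" if i: "i \<in> {1..<2 ^ d}" for i
        proof (rule ccontr)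
          assume s: "\<not> 1 / 2 \<le> \<bar>s i x\<bar>"
          have "atom_weight S h v x \<le> zone i v"
            unfolding atom_weight_def zone_def E_def[symmetric] \<phi>_def[symmetric]
            by (intro sum_mono2 finZ) (use s in \<open>auto simp: Z_def\<close>)
          then show False using x good(2)[of i] i unfolding m by simp
        qed
        obtain j where j: "j \<in> {2 ^ d..<2 ^ Suc d}" "(3 / 4) ^ d \<le> node_weight s j x"
          using exists_heavy_leaf[of s d x d] fam(1) sharp by auto
        have "\<epsilon> * (3 / 4) ^ d \<le> node_weight s j x * atom_weight S h v x"
          unfolding mult.commute[of \<epsilon>] using x j(2) \<epsilon> order_trans[OF _ j(2), of 0]
          by (intro mult_mono) auto
        also have "\<dots> \<le> spectral_mean S h (node_weight s j) v"
          using node_weight_bounds[of s, OF fam(1)] by (intro atom_weight_mult_le_spectral_mean fin) auto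
        also have "\<dots> \<le> (1 / 2) ^ d + t"
          using t mean unfolding mean_def
          by (intro spectral_mean_node_weight[OF fin h v _ _ order_refl j(1)]) auto
        also have "(1 / 2 :: real) ^ d = (2 / 3) ^ d * (3 / 4) ^ d"
          by (simp flip: power_mult_distrib)
        also have "\<dots> < \<epsilon> / 2 * (3 / 4) ^ d" using d by (intro mult_strict_right_mono) auto
        finally show False by (simp add: t_def)
      qed
    qed
    then have "card {v\<in>S. \<exists>E. \<epsilon> < atom_weight S h v E} \<le> card (\<Union>i\<in>{1..m}. bad i)"
      using fin by (intro card_mono) (auto simp: bad_def)
    also have "\<dots> \<le> (\<Sum>i\<in>{1..m}. card (bad i))" by (rule card_UN_le) simp
    finally have "real (card {v\<in>S. \<exists>E. \<epsilon> < atom_weight S h v E}) \<le> real (\<Sum>i\<in>{1..m}. card (bad i))"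
      by (rule of_nat_mono)
    also have "\<dots> = (\<Sum>i\<in>{1..m}. real (card (bad i)))" by (rule of_nat_sum)
    also have "\<dots> \<le> (\<Sum>i\<in>{1..m}. c * q * card S)" by (intro sum_mono bad)
    also have "\<dots> = m * (c * q) * card S" by simp
    also have "\<dots> \<le> \<delta> * card S" using mc by (intro mult_right_mono) auto
    finally show "\<exists>W. (\<forall>v\<in>S. \<bar>W v - V v\<bar> \<le> \<delta>) \<and>
        real (card {v\<in>S. \<exists>E. \<epsilon> < atom_weight S (perturb A W) v E}) \<le> \<delta> * card S"
      using W unfolding h_def by blast
  qed
qed

section \<open>Spectral measures and truncated graphs\<close>

locale real_symmetric_operator =
  fixes S :: "'a set" and h :: "'a \<Rightarrow> 'a \<Rightarrow> real" and T :: "('a \<Rightarrow> complex) \<Rightarrow> 'a \<Rightarrow> complex"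
  assumes fin: "finite S" and sym: "symmetric_on S h"
    and T: "\<And>\<psi> v. T \<psi> v = (if v \<in> S then \<Sum>w\<in>S. of_real (h v w) * \<psi> w else 0)"
begin

abbreviation "\<phi> \<equiv> eigenvector_at S h"

abbreviation "\<mu> \<equiv> eigenvalue_at S h"

definition coeff :: "('a \<Rightarrow> complex) \<Rightarrow> 'a \<Rightarrow> complex" where
  "coeff \<psi> j = (\<Sum>v\<in>S. of_real (\<phi> j v) * \<psi> v)"

lemma eb: "eigenbasis S h \<phi> \<mu>"
  by (rule eigenbasis_eigensystem[OF fin sym])

lemma orthonormal: "j \<in> S \<Longrightarrow> k \<in> S \<Longrightarrow> (\<Sum>v\<in>S. complex_of_real (\<phi> j v) * of_real (\<phi> k v)) = of_bool (j = k)"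
  using arg_cong[OF orthobasisD(1)[OF eigenbasisD(1)[OF eb], of j k], of complex_of_real] by simp

lemma complete: "v \<in> S \<Longrightarrow> w \<in> S \<Longrightarrow> (\<Sum>j\<in>S. complex_of_real (\<phi> j v) * of_real (\<phi> j w)) = of_bool (v = w)"
  using arg_cong[OF orthobasisD(2)[OF eigenbasisD(1)[OF eb], of v w], of complex_of_real] by simp

lemma eigenvector_eq:
  "j \<in> S \<Longrightarrow> v \<in> S \<Longrightarrow> (\<Sum>w\<in>S. complex_of_real (h v w) * of_real (\<phi> j w)) = of_real (\<mu> j) * of_real (\<phi> j v)"
  using arg_cong[OF eigenbasisD(2)[OF eb, of j v], of complex_of_real] by simp

lemma expansion:
  assumes "w \<in> S"
  shows "\<psi> w = (\<Sum>j\<in>S. coeff \<psi> j * of_real (\<phi> j w))"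
proof -
  have "(\<Sum>j\<in>S. coeff \<psi> j * of_real (\<phi> j w)) = (\<Sum>j\<in>S. \<Sum>v\<in>S. \<psi> v * (of_real (\<phi> j v) * of_real (\<phi> j w)))"
    unfolding coeff_def sum_distrib_right by (intro sum.cong refl) (simp only: mult_ac)
  also have "\<dots> = (\<Sum>v\<in>S. \<Sum>j\<in>S. \<psi> v * (of_real (\<phi> j v) * of_real (\<phi> j w)))"
    by (rule sum.swap)
  also have "\<dots> = (\<Sum>v\<in>S. \<psi> v * of_bool (v = w))"
    using assms by (intro sum.cong refl) (simp only: complete sum_distrib_left[symmetric])
  also have "\<dots> = \<psi> w" by (rule sum_mult_of_bool(1)[OF fin assms])
  finally show ?thesis by simp
qed

text \<open>Symmetry of \<open>h\<close> moves the operator onto the real eigenvector, so the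
  coefficient is multiplied by x and by \<open>\<mu> j\<close> alike.\<close>

lemma coeff_eigenfunction:
  assumes \<eta>: "\<eta> \<in> eigenspace S T x" and j: "j \<in> S" "\<mu> j \<noteq> x"
  shows "coeff \<eta> j = 0"
proof -
  have T\<eta>: "(\<Sum>w\<in>S. of_real (h v w) * \<eta> w) = of_real x * \<eta> v" if "v \<in> S" for v
    using \<eta> that T[of \<eta> v] by (simp add: eigenspace_def)
  have "of_real x * coeff \<eta> j = (\<Sum>v\<in>S. of_real (\<phi> j v) * (\<Sum>w\<in>S. of_real (h v w) * \<eta> w))"
    unfolding coeff_def sum_distrib_left[of "of_real x"]
    by (intro sum.cong refl) (simp only: T\<eta> mult.left_commute)
  also have "\<dots> = (\<Sum>v\<in>S. \<Sum>w\<in>S. of_real (h v w) * of_real (\<phi> j v) * \<eta> w)"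
    unfolding sum_distrib_left by (intro sum.cong refl) (simp only: mult_ac)
  also have "\<dots> = (\<Sum>w\<in>S. \<Sum>v\<in>S. of_real (h v w) * of_real (\<phi> j v) * \<eta> w)"
    by (rule sum.swap)
  also have "\<dots> = (\<Sum>w\<in>S. (\<Sum>v\<in>S. of_real (h w v) * of_real (\<phi> j v)) * \<eta> w)"
    unfolding sum_distrib_right using sym by (intro sum.cong refl) (simp add: symmetric_on_def)
  also have "\<dots> = (\<Sum>w\<in>S. of_real (\<mu> j) * (of_real (\<phi> j w) * \<eta> w))"
    by (intro sum.cong refl) (simp only: eigenvector_eq[OF j(1)] mult.assoc)
  also have "\<dots> = of_real (\<mu> j) * coeff \<eta> j"
    unfolding coeff_def sum_distrib_left ..
  finally show ?thesis using j(2) by simp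
qed

definition proj :: "'a \<Rightarrow> real \<Rightarrow> 'a \<Rightarrow> complex" where
  "proj v x w = (if w \<in> S then \<Sum>j | j \<in> S \<and> \<mu> j = x. of_real (\<phi> j v) * of_real (\<phi> j w) else 0)"

lemma proj_in_eigenspace: "proj v x \<in> eigenspace S T x"
proof -
  have "T (proj v x) u = of_real x * proj v x u" for u
  proof (cases "u \<in> S")
    case True
    have "T (proj v x) u = (\<Sum>w\<in>S. \<Sum>j | j \<in> S \<and> \<mu> j = x. of_real (\<phi> j v) * (of_real (h u w) * of_real (\<phi> j w)))"
      using True unfolding T by (simp add: proj_def sum_distrib_left mult.left_commute)
    also have "\<dots> = (\<Sum>j | j \<in> S \<and> \<mu> j = x. of_real (\<phi> j v) * (\<Sum>w\<in>S. of_real (h u w) * of_real (\<phi> j w)))"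
      unfolding sum_distrib_left by (rule sum.swap)
    also have "\<dots> = (\<Sum>j | j \<in> S \<and> \<mu> j = x. of_real x * (of_real (\<phi> j v) * of_real (\<phi> j u)))"
      using True by (intro sum.cong refl) (auto simp: eigenvector_eq mult.left_commute)
    also have "\<dots> = of_real x * proj v x u"
      using True by (simp add: proj_def sum_distrib_left)
    finally show ?thesis .
  qed (simp add: T proj_def)
  then show ?thesis by (auto simp: eigenspace_def l2_space_def proj_def)
qed

lemma proj_orthogonal:
  assumes v: "v \<in> S" and \<eta>: "\<eta> \<in> eigenspace S T x"
  shows "l2_inner S \<eta> (\<lambda>w. l2_delta v w - proj v x w) = 0"
proof -
  have "l2_inner S \<eta> (l2_delta v) = (\<Sum>w\<in>S. cnj (\<eta> w) * of_bool (w = v))"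
    unfolding l2_inner_def by (intro sum.cong refl) (simp add: l2_delta_def)
  also have "\<dots> = cnj (\<eta> v)" by (rule sum_mult_of_bool(1)[OF fin v])
  also have "\<dots> = cnj (\<Sum>j\<in>S. coeff \<eta> j * of_real (\<phi> j v))" using expansion[OF v, of \<eta>] by simp
  also have "\<dots> = (\<Sum>j\<in>S. cnj (coeff \<eta> j) * of_real (\<phi> j v))" by simp
  also have "\<dots> = (\<Sum>j | j \<in> S \<and> \<mu> j = x. cnj (coeff \<eta> j) * of_real (\<phi> j v))"
    using coeff_eigenfunction[OF \<eta>] fin by (intro sum.mono_neutral_right) auto
  finally have 1: "l2_inner S \<eta> (l2_delta v) = (\<Sum>j | j \<in> S \<and> \<mu> j = x. cnj (coeff \<eta> j) * of_real (\<phi> j v))" .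
  have "l2_inner S \<eta> (proj v x)
      = (\<Sum>w\<in>S. \<Sum>j | j \<in> S \<and> \<mu> j = x. of_real (\<phi> j w) * cnj (\<eta> w) * of_real (\<phi> j v))"
    unfolding l2_inner_def by (intro sum.cong refl) (simp add: proj_def sum_distrib_left mult_ac)
  also have "\<dots> = (\<Sum>j | j \<in> S \<and> \<mu> j = x. \<Sum>w\<in>S. of_real (\<phi> j w) * cnj (\<eta> w) * of_real (\<phi> j v))"
    by (rule sum.swap)
  also have "\<dots> = (\<Sum>j | j \<in> S \<and> \<mu> j = x. cnj (coeff \<eta> j) * of_real (\<phi> j v))"
    by (simp add: coeff_def sum_distrib_right)
  finally show ?thesis
    using 1 by (simp add: l2_inner_def right_diff_distrib sum_subtractf)
qed

text \<open>Uniqueness, which the definite description demands: two candidates differ by a vector of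
  the eigenspace that is orthogonal to itself.\<close>

lemma l2_projection_delta:
  assumes v: "v \<in> S"
  shows "l2_projection S (eigenspace S T x) (l2_delta v) = proj v x"
  unfolding l2_projection_def
proof (rule the_equality)
  show "proj v x \<in> eigenspace S T x \<and>
      (\<forall>\<eta>\<in>eigenspace S T x. l2_inner S \<eta> (\<lambda>w. l2_delta v w - proj v x w) = 0)"
    using proj_in_eigenspace proj_orthogonal[OF v] by blast
next
  fix \<psi> assume \<psi>: "\<psi> \<in> eigenspace S T x \<and>
      (\<forall>\<eta>\<in>eigenspace S T x. l2_inner S \<eta> (\<lambda>w. l2_delta v w - \<psi> w) = 0)"
  define d where "d w = \<psi> w - proj v x w" for w
  have d: "d \<in> eigenspace S T x"
  proof -
    have "T d u = of_real x * d u" for u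
    proof -
      have "T d u = T \<psi> u - T (proj v x) u"
        unfolding T by (simp add: d_def right_diff_distrib sum_subtractf)
      then show ?thesis
        using \<psi> proj_in_eigenspace[of v x] by (simp add: eigenspace_def d_def right_diff_distrib)
    qed
    then show ?thesis
      using \<psi> proj_in_eigenspace[of v x] by (auto simp: eigenspace_def l2_space_def d_def)
  qed
  have "l2_inner S d (\<lambda>w. l2_delta v w - proj v x w) - l2_inner S d (\<lambda>w. l2_delta v w - \<psi> w) = 0"
    using \<psi> d proj_orthogonal[OF v d] by simp
  then have "(\<Sum>w\<in>S. cnj (d w) * d w) = 0"
    unfolding l2_inner_def sum_subtractf[symmetric] by (simp add: d_def algebra_simps)
  also have "(\<Sum>w\<in>S. cnj (d w) * d w) = of_real (\<Sum>w\<in>S. (cmod (d w))\<^sup>2)"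
    unfolding of_real_sum by (intro sum.cong refl) (metis complex_norm_square mult.commute)
  finally have "(\<Sum>w\<in>S. (cmod (d w))\<^sup>2) = 0" by (simp only: of_real_eq_0_iff)
  then have "\<forall>w\<in>S. d w = 0" using fin by (simp add: sum_nonneg_eq_0_iff)
  moreover have "d w = 0" if "w \<notin> S" for w using d that by (simp add: eigenspace_def l2_space_def)
  ultimately have "d w = 0" for w by blast
  then show "\<psi> = proj v x" by (auto simp: d_def)
qed

lemma eigenvalues_eq: "eigenvalues S T = \<mu> ` S"
proof (intro equalityI subsetI)
  fix x assume "x \<in> eigenvalues S T"
  then obtain \<eta> where \<eta>: "\<eta> \<in> eigenspace S T x" "\<eta> \<noteq> (\<lambda>v. 0)" by (auto simp: eigenvalues_def)
  then obtain w where w: "\<eta> w \<noteq> 0" by auto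
  then have "w \<in> S" using \<eta>(1) by (auto simp: eigenspace_def l2_space_def)
  show "x \<in> \<mu> ` S"
  proof (rule ccontr)
    assume "x \<notin> \<mu> ` S"
    then have "coeff \<eta> j = 0" if "j \<in> S" for j using coeff_eigenfunction[OF \<eta>(1) that] that by auto
    then have "\<eta> w = 0" using expansion[OF \<open>w \<in> S\<close>, of \<eta>] by simp
    then show False using w by simp
  qed
next
  fix x assume "x \<in> \<mu> ` S"
  then obtain j where j: "j \<in> S" "\<mu> j = x" by auto
  define \<eta> where "\<eta> v = (if v \<in> S then complex_of_real (\<phi> j v) else 0)" for v
  have "T \<eta> u = of_real x * \<eta> u" for u
    using eigenvector_eq[OF j(1), of u] j(2) by (simp add: T \<eta>_def)
  then have "\<eta> \<in> eigenspace S T x" by (auto simp: eigenspace_def l2_space_def \<eta>_def)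
  moreover have "\<eta> \<noteq> (\<lambda>v. 0)"
  proof
    assume "\<eta> = (\<lambda>v. 0)"
    then have "\<phi> j v = 0" if "v \<in> S" for v using that by (metis \<eta>_def of_real_eq_0_iff)
    then show False using orthonormal[OF j(1,1)] by simp
  qed
  ultimately show "x \<in> eigenvalues S T" by (auto simp: eigenvalues_def)
qed

lemma functional_calculus_delta:
  assumes v: "v \<in> S"
  shows "l2_inner S (l2_delta v) (functional_calculus S T g (l2_delta v))
    = (\<Sum>j\<in>S. of_real ((\<phi> j v)\<^sup>2) * g (\<mu> j))"
proof -
  have "l2_inner S (l2_delta v) (functional_calculus S T g (l2_delta v))
      = (\<Sum>w\<in>S. of_bool (w = v) * functional_calculus S T g (l2_delta v) w)"
    unfolding l2_inner_def by (intro sum.cong refl) (simp add: l2_delta_def)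
  also have "\<dots> = functional_calculus S T g (l2_delta v) v"
    by (rule sum_mult_of_bool(3)[OF fin v])
  also have "\<dots> = (\<Sum>x\<in>\<mu> ` S. g x * (\<Sum>j | j \<in> S \<and> \<mu> j = x. of_real (\<phi> j v) * of_real (\<phi> j v)))"
    unfolding functional_calculus_def eigenvalues_eq l2_projection_delta[OF v] using v by (simp add: proj_def)
  also have "\<dots> = (\<Sum>x\<in>\<mu> ` S. \<Sum>j | j \<in> S \<and> \<mu> j = x. of_real ((\<phi> j v)\<^sup>2) * g (\<mu> j))"
    unfolding sum_distrib_left by (intro sum.cong refl) (auto simp: power2_eq_square mult.commute)
  also have "\<dots> = (\<Sum>j\<in>S. of_real ((\<phi> j v)\<^sup>2) * g (\<mu> j))"
    by (rule sum.image_gen[OF fin, symmetric])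
  finally show ?thesis .
qed

lemma measure_spectral_measure:
  assumes v: "v \<in> S"
  shows "measure (spectral_measure S T v) {E} = atom_weight S h v E"
proof -
  define is_spectral where "is_spectral \<sigma> \<longleftrightarrow> finite_measure \<sigma> \<and> sets \<sigma> = sets borel \<and>
    (\<forall>g\<in>borel_measurable borel. bounded (range g) \<longrightarrow>
      l2_inner S (l2_delta v) (functional_calculus S T g (l2_delta v)) = (LINT E|\<sigma>. g E))" for \<sigma> :: "real measure"
  have measure: "complex_of_real (measure \<sigma> B) = (\<Sum>j\<in>S. of_real ((\<phi> j v)\<^sup>2) * indicator B (\<mu> j))"
    if \<sigma>: "is_spectral \<sigma>" and B: "B \<in> sets borel" for \<sigma> B
  proof -
    interpret finite_measure \<sigma> using \<sigma> by (simp add: is_spectral_def)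
    have sets: "sets \<sigma> = sets borel" using \<sigma> by (simp add: is_spectral_def)
    have B': "B \<in> sets \<sigma>" "B \<inter> space \<sigma> = B" using B sets sets_eq_imp_space_eq[OF sets] by auto
    define g :: "real \<Rightarrow> complex" where "g x = of_real (indicator B x)" for x
    have "g \<in> borel_measurable borel" unfolding g_def using B by measurable
    moreover have "bounded (range g)"
      by (rule boundedI[of _ 1]) (auto simp: g_def indicator_def)
    ultimately have "(\<Sum>j\<in>S. of_real ((\<phi> j v)\<^sup>2) * g (\<mu> j)) = (LINT x|\<sigma>. g x)"
      using \<sigma> functional_calculus_delta[OF v, of g] by (simp add: is_spectral_def)
    also have "\<dots> = of_real (LINT x|\<sigma>. indicator B x)"
      unfolding g_def by (rule integral_complex_of_real)
    also have "(LINT x|\<sigma>. indicator B x) = measure \<sigma> B"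
      using B' by simp
    finally have "(\<Sum>j\<in>S. of_real ((\<phi> j v)\<^sup>2) * g (\<mu> j)) = of_real (measure \<sigma> B)" .
    moreover have "g x = indicator B x" for x by (simp add: g_def indicator_def)
    ultimately show ?thesis by simp
  qed
  define \<sigma>\<^sub>0 where "\<sigma>\<^sub>0 = distr (point_measure S (\<lambda>j. (\<phi> j v)\<^sup>2)) borel \<mu>"
  have \<mu>_meas: "\<mu> \<in> measurable (point_measure S (\<lambda>j. (\<phi> j v)\<^sup>2)) borel"
    by (simp add: measurable_point_measure_eq1)
  have "finite_measure (point_measure S (\<lambda>j. ennreal ((\<phi> j v)\<^sup>2)))"
    by (rule finite_measureI) (simp add: space_point_measure emeasure_point_measure_finite fin)
  then have "finite_measure \<sigma>\<^sub>0"
    unfolding \<sigma>\<^sub>0_def by (rule finite_measure.finite_measure_distr) (rule \<mu>_meas)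
  moreover have "(LINT E|\<sigma>\<^sub>0. g E) = (\<Sum>j\<in>S. of_real ((\<phi> j v)\<^sup>2) * g (\<mu> j))"
    if "g \<in> borel_measurable borel" for g :: "real \<Rightarrow> complex"
    unfolding \<sigma>\<^sub>0_def integral_distr[OF \<mu>_meas that]
    by (simp add: lebesgue_integral_point_measure_finite fin scaleR_conv_of_real)
  ultimately have \<sigma>\<^sub>0: "is_spectral \<sigma>\<^sub>0"
    unfolding is_spectral_def by (auto simp: functional_calculus_delta[OF v] \<sigma>\<^sub>0_def)
  have "spectral_measure S T v = \<sigma>\<^sub>0"
    unfolding spectral_measure_def is_spectral_def[symmetric]
  proof (rule the_equality[where P = is_spectral, OF \<sigma>\<^sub>0])
    fix \<sigma> assume \<sigma>: "is_spectral \<sigma>"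
    show "\<sigma> = \<sigma>\<^sub>0"
    proof (rule measure_eqI)
      show sets: "sets \<sigma> = sets \<sigma>\<^sub>0" using \<sigma> \<sigma>\<^sub>0 by (simp add: is_spectral_def)
      fix B assume "B \<in> sets \<sigma>"
      then have "B \<in> sets borel" using \<sigma> by (simp add: is_spectral_def)
      then have "complex_of_real (measure \<sigma> B) = of_real (measure \<sigma>\<^sub>0 B)"
        using measure[OF \<sigma>] measure[OF \<sigma>\<^sub>0] by simp
      then have "measure \<sigma> B = measure \<sigma>\<^sub>0 B" by simp
      then show "emeasure \<sigma> B = emeasure \<sigma>\<^sub>0 B"
        using \<sigma> \<sigma>\<^sub>0 by (simp add: is_spectral_def finite_measure.emeasure_eq_measure)
    qed
  qed
  then have "complex_of_real (measure (spectral_measure S T v) {E})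
      = (\<Sum>j\<in>S. of_real ((\<phi> j v)\<^sup>2) * indicator {E} (\<mu> j))"
    using measure[OF \<sigma>\<^sub>0, of "{E}"] by simp
  also have "\<dots> = (\<Sum>j\<in>S. if \<mu> j = E then of_real ((\<phi> j v)\<^sup>2) else 0)"
    by (intro sum.cong refl) (simp add: indicator_def)
  also have "\<dots> = of_real (atom_weight S h v E)"
    unfolding atom_weight_def of_real_sum by (rule sum.inter_filter[OF fin, symmetric])
  finally show ?thesis by (simp only: of_real_eq_iff)
qed

end

section \<open>Truncated graphs as propagating kernels\<close>

context truncated_propagating_graph
begin

abbreviation "H \<equiv> G \<restriction> Y"

abbreviation "pred_f \<equiv> inv_into (verts G) f"

text \<open>By convexity an orbit contains at most one such vertex, the first one in
  \<open>Y\<close>.\<close>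

definition initial :: "'a set" where
  "initial = {u \<in> Y. pred_f u \<notin> Y}"

text \<open>A numerical stand-in for a linear extension of the partial order on
  \<open>Y\<close>.\<close>

definition rank_Y :: "'a \<Rightarrow> nat" where
  "rank_Y u = card {w \<in> Y. (w, u) \<in> r}"

text \<open>The degree is counted in the truncation, so this is the operator with zero potential,
  and \<open>perturb kernel W\<close> is the matrix of \<open>schroedinger_op H W\<close>.\<close>

definition kernel :: "'a \<Rightarrow> 'a \<Rightarrow> real" where
  "kernel v w = (of_bool (v \<rightarrow>\<^bsub>H\<^esub> w) :: real) - (if v = w then real (card {u. v \<rightarrow>\<^bsub>H\<^esub> u}) else 0)"

lemma dominates_H_iff: "v \<rightarrow>\<^bsub>H\<^esub> w \<longleftrightarrow> v \<rightarrow>\<^bsub>G\<^esub> w \<and> v \<in> Y \<and> w \<in> Y"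
  by (auto simp: arcs_ends_def arc_to_ends_def)

lemma dominates_sym: "v \<rightarrow>\<^bsub>G\<^esub> w \<Longrightarrow> w \<rightarrow>\<^bsub>G\<^esub> v"
  using sym_arcs by (auto simp: symmetric_def sym_def)

lemma f_bij: "bij_betw f (verts G) (verts G)"
  using automorphism by (simp add: graph_automorphism_def)

lemma f_in: "v \<in> verts G \<Longrightarrow> f v \<in> verts G"
  using f_bij by (auto simp: bij_betw_def)

lemma pred_in: "v \<in> verts G \<Longrightarrow> pred_f v \<in> verts G"
  using f_bij by (metis bij_betw_imp_surj_on inv_into_into)

lemma f_pred: "v \<in> verts G \<Longrightarrow> f (pred_f v) = v"
  using f_bij by (simp add: bij_betw_inv_into_right)

lemma pred_f: "v \<in> verts G \<Longrightarrow> pred_f (f v) = v"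
  using f_bij by (simp add: bij_betw_inv_into_left)

lemma r_refl: "v \<in> verts G \<Longrightarrow> (v, v) \<in> r"
  and r_trans: "(u, v) \<in> r \<Longrightarrow> (v, w) \<in> r \<Longrightarrow> (u, w) \<in> r"
  and r_antisym: "(u, v) \<in> r \<Longrightarrow> (v, u) \<in> r \<Longrightarrow> u = v"
  using partial_order
  by (auto simp: partial_order_on_def preorder_on_def refl_on_def trans_def antisym_def)

lemma rank_Y_less:
  assumes "(w, u) \<in> r" "w \<noteq> u" "u \<in> Y"
  shows "rank_Y w < rank_Y u"
  unfolding rank_Y_def
proof (rule psubset_card_mono)
  show "finite {w \<in> Y. (w, u) \<in> r}" using finite_Y by simp
  have "u \<in> {w \<in> Y. (w, u) \<in> r}" using assms Y_subset r_refl by auto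
  moreover have "u \<notin> {x \<in> Y. (x, w) \<in> r}" using assms r_antisym by auto
  moreover have "{x \<in> Y. (x, w) \<in> r} \<subseteq> {w \<in> Y. (w, u) \<in> r}" using assms r_trans by auto
  ultimately show "{x \<in> Y. (x, w) \<in> r} \<subset> {w \<in> Y. (w, u) \<in> r}" by blast
qed

lemma card_neighbours_le: "card {w. v \<rightarrow>\<^bsub>H\<^esub> w} \<le> out_degree H v"
proof -
  interpret H: graph H by (rule graph_truncation)
  have "{w. v \<rightarrow>\<^bsub>H\<^esub> w} = head H ` out_arcs H v"
    by (auto simp: out_arcs_def arcs_ends_def arc_to_ends_def)
  moreover have "finite (out_arcs H v)" 
    by (rule finite_subset[OF _ H.finite_arcs]) (auto simp: out_arcs_def)
  ultimately show ?thesis unfolding out_degree_def by (simp add: card_image_le)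
qed

lemma sum_dominates: "(\<Sum>w\<in>Y. of_bool (v \<rightarrow>\<^bsub>H\<^esub> w) * g w) = (\<Sum>w | v \<rightarrow>\<^bsub>H\<^esub> w. g w)" for g :: "'a \<Rightarrow> 'c::comm_semiring_1"
proof -
  have "(\<Sum>w\<in>Y. of_bool (v \<rightarrow>\<^bsub>H\<^esub> w) * g w) = (\<Sum>w\<in>Y. if v \<rightarrow>\<^bsub>H\<^esub> w then g w else 0)"
    by (intro sum.cong) auto
  also have "\<dots> = (\<Sum>w | w \<in> Y \<and> v \<rightarrow>\<^bsub>H\<^esub> w. g w)" by (rule sum.inter_filter[OF finite_Y, symmetric])
  also have "{w. w \<in> Y \<and> v \<rightarrow>\<^bsub>H\<^esub> w} = {w. v \<rightarrow>\<^bsub>H\<^esub> w}" by (auto simp: dominates_H_iff)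
  finally show ?thesis .
qed

text \<open>Every neighbour \<open>w\<close> of \<open>pred_f u\<close> satisfies w \<le> f (pred_f
  u) = u, so \<open>u\<close> is the last unknown in the equation at its predecessor. The bound
  \<open>2 * D\<close> counts the degree once off and once on the diagonal.\<close>

lemma propagating_kernel_truncation:
  assumes D: "\<And>v. v \<in> Y \<Longrightarrow> out_degree H v \<le> D"
  shows "propagating_kernel Y kernel initial pred_f rank_Y (2 * D)"
proof
  show "finite Y" by (rule finite_Y)
  show "symmetric_on Y kernel"
    using dominates_sym by (auto simp: symmetric_on_def kernel_def dominates_H_iff)
  show "initial \<subseteq> Y" by (auto simp: initial_def)
  show "inj_on pred_f (Y - initial)"
    using f_pred Y_subset by (intro inj_onI) (metis DiffD1 subsetD)
next
  fix u assume u: "u \<in> Y - initial"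
  then have uY: "u \<in> Y" "u \<in> verts G" "pred_f u \<in> Y" using Y_subset by (auto simp: initial_def)
  show "pred_f u \<in> Y" by (rule uY)
  have pu: "pred_f u \<in> verts G" "f (pred_f u) = u" using uY by (auto simp: pred_in f_pred)
  show neq: "pred_f u \<noteq> u" using increasing[OF pu(1)] pu(2) by auto
  have "u \<rightarrow>\<^bsub>G\<^esub> pred_f u" using adjacent_image[OF pu(1)] pu(2) by simp
  then have "pred_f u \<rightarrow>\<^bsub>H\<^esub> u" using dominates_sym uY by (simp add: dominates_H_iff)
  then show "kernel (pred_f u) u = 1" using neq by (simp add: kernel_def)
  fix w assume w: "w \<in> Y" "w \<noteq> u" "w = pred_f u \<or> kernel (pred_f u) w \<noteq> 0"
  have "(w, u) \<in> r"
  proof (cases "w = pred_f u")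
    case True
    then show ?thesis using increasing[OF pu(1)] pu(2) by simp
  next
    case False
    then have "pred_f u \<rightarrow>\<^bsub>G\<^esub> w" using w by (auto simp: kernel_def dominates_H_iff split: if_splits)
    then show ?thesis using neighbour_bounds pu(2) by force
  qed
  then show "rank_Y w < rank_Y u" using w uY by (intro rank_Y_less)
next
  fix v assume v: "v \<in> Y"
  have "(\<Sum>w\<in>Y. \<bar>kernel v w\<bar>) \<le> (\<Sum>w\<in>Y. of_bool (v \<rightarrow>\<^bsub>H\<^esub> w) * 1 + of_bool (v = w) * real (card {u. v \<rightarrow>\<^bsub>H\<^esub> u}))"
    by (intro sum_mono) (auto simp: kernel_def)
  also have "\<dots> = real (card {u. v \<rightarrow>\<^bsub>H\<^esub> u}) + real (card {u. v \<rightarrow>\<^bsub>H\<^esub> u})"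
    unfolding sum.distrib sum_dominates sum_mult_of_bool(4)[OF finite_Y v] by simp
  also have "\<dots> \<le> real (2 * D)"
    using order_trans[OF card_neighbours_le D[OF v]] by simp
  finally show "(\<Sum>w\<in>Y. \<bar>kernel v w\<bar>) \<le> real (2 * D)" .
qed

lemma schroedinger_op_eq:
  "schroedinger_op H W \<psi> v = (if v \<in> Y then \<Sum>w\<in>Y. of_real (perturb kernel W v w) * \<psi> w else 0)"
proof (cases "v \<in> Y")
  case True
  define k where "k = card {u. v \<rightarrow>\<^bsub>H\<^esub> u}"
  have "(\<Sum>w\<in>Y. of_real (perturb kernel W v w) * \<psi> w)
      = (\<Sum>w\<in>Y. of_bool (v \<rightarrow>\<^bsub>H\<^esub> w) * \<psi> w + of_bool (v = w) * (of_real (W v - k) * \<psi> w))"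
    by (intro sum.cong refl) (auto simp: perturb_def kernel_def k_def algebra_simps)
  also have "\<dots> = (\<Sum>w | v \<rightarrow>\<^bsub>H\<^esub> w. \<psi> w) + of_real (W v - k) * \<psi> v"
    unfolding sum.distrib sum_dominates sum_mult_of_bool(4)[OF finite_Y True] ..
  finally show ?thesis
    using True by (simp add: schroedinger_op_def sum_subtractf k_def algebra_simps)
qed (simp add: schroedinger_op_def)

lemma measure_spectral_measure_truncation:
  assumes "v \<in> Y"
  shows "measure (spectral_measure Y (schroedinger_op H W) v) {E} = atom_weight Y (perturb kernel W) v E"
proof -
  interpret real_symmetric_operator Y "perturb kernel W" "schroedinger_op H W"
  proof
    show "finite Y" by (rule finite_Y)
    show "symmetric_on Y (perturb kernel W)"
      using dominates_sym by (auto simp: symmetric_on_def perturb_def kernel_def dominates_H_iff)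
  qed (rule schroedinger_op_eq)
  show ?thesis by (rule measure_spectral_measure[OF assms])
qed

section \<open>Length of a truncation and the number of initial vertices\<close>

lemma funpow_in: "v \<in> verts G \<Longrightarrow> (f ^^ n) v \<in> verts G"
  by (induction n) (auto intro: f_in)

lemma funpow_above: "v \<in> verts G \<Longrightarrow> (v, (f ^^ n) v) \<in> r"
proof (induction n)
  case (Suc n)
  then show ?case using increasing[OF funpow_in[OF Suc.prems, of n]] r_trans by auto
qed (simp add: r_refl)

lemma funpow_inj:
  assumes "v \<in> verts G" "w \<in> verts G" "(f ^^ n) v = (f ^^ n) w"
  shows "v = w"
  using assms(3)
proof (induction n)
  case (Suc n)
  have "(f ^^ n) v = (f ^^ n) w"
    using Suc.prems pred_f funpow_in[OF assms(1), of n] funpow_in[OF assms(2), of n]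
    by (metis comp_apply funpow.simps(2))
  then show ?case by (rule Suc.IH)
qed simp

text \<open>Negative powers are removed here: two points of an orbit have a common forward
  image.\<close>

lemma zorbit_common:
  assumes v: "v \<in> verts G" and x: "x \<in> zorbit (verts G) f v"
  shows "\<exists>a b. (f ^^ a) x = (f ^^ b) v"
proof -
  obtain n where n: "x = zpower (verts G) f n v" using x by (auto simp: zorbit_def)
  have "(f ^^ k) ((pred_f ^^ k) v) = v \<and> (pred_f ^^ k) v \<in> verts G" for k
  proof (induction k)
    case (Suc k)
    then show ?case by (simp add: funpow_swap1[of f] f_pred pred_in)
  qed (use v in simp)
  then have "(f ^^ nat (- n)) ((pred_f ^^ nat (- n)) v) = (f ^^ 0) v" by simp
  moreover have "(f ^^ 0) ((f ^^ nat n) v) = (f ^^ nat n) v" by simp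
  ultimately show ?thesis unfolding n zpower_def by (cases "0 \<le> n") (simp_all only: if_True if_False, blast+)
qed

text \<open>Otherwise the predecessor of \<open>v\<close> on the way from \<open>u\<close> lies
  between \<open>u\<close> and \<open>v\<close>, and convexity puts it into
  \<open>Y\<close>.\<close>

lemma initial_unique_aux:
  assumes u: "u \<in> initial" and v: "v \<in> initial" and eq: "(f ^^ n) u = v"
  shows "u = v"
proof (cases n)
  case (Suc k)
  have uv: "u \<in> Y" "v \<in> Y" "pred_f v \<notin> Y" "u \<in> verts G"
    using u v Y_subset by (auto simp: initial_def)
  define w where "w = (f ^^ k) u"
  have w: "w \<in> verts G" "f w = v" "(u, w) \<in> r"
    using uv(4) eq Suc by (auto simp: w_def funpow_in funpow_above)
  then have "(w, v) \<in> r" using increasing[of w] by simp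
  then have "w \<in> Y" using convex_Y uv w unfolding order_convex_def by blast
  then show ?thesis using uv(3) pred_f[OF w(1)] w(2) by simp
qed (use eq in simp)

lemma initial_unique:
  assumes u: "u \<in> initial" and v: "v \<in> initial"
    and x: "x \<in> zorbit (verts G) f u" "x \<in> zorbit (verts G) f v"
  shows "u = v"
proof -
  have uv: "u \<in> verts G" "v \<in> verts G" using u v Y_subset by (auto simp: initial_def)
  obtain a b c d where "(f ^^ a) x = (f ^^ b) u" "(f ^^ c) x = (f ^^ d) v"
    using zorbit_common[OF uv(1) x(1)] zorbit_common[OF uv(2) x(2)] by blast
  then have "(f ^^ (c + b)) u = (f ^^ (a + d)) v"
    by (metis add.commute comp_apply funpow_add)
  moreover define m n where "m = c + b" and "n = a + d"
  ultimately have mn: "(f ^^ m) u = (f ^^ n) v" by simp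
  show ?thesis
  proof (cases "n \<le> m")
    case True
    then have "(f ^^ n) ((f ^^ (m - n)) u) = (f ^^ n) v"
      using mn by (metis comp_apply funpow_add le_add_diff_inverse)
    then show ?thesis using funpow_inj[OF funpow_in[OF uv(1)] uv(2)] initial_unique_aux[OF u v] by blast
  next
    case False
    then have "(f ^^ m) ((f ^^ (n - m)) v) = (f ^^ m) u"
      using mn by (metis comp_apply funpow_add le_add_diff_inverse nat_le_linear)
    then show ?thesis using funpow_inj[OF funpow_in[OF uv(2)] uv(1)] initial_unique_aux[OF v u] by blast
  qed
qed

text \<open>A fundamental domain inside \<open>Y\<close> meets the orbit of every initial vertex,
  and distinct initial vertices have disjoint orbits. Disjoint domains therefore use up at least
  \<open>card initial\<close> vertices of \<open>Y\<close> each.\<close>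

lemma truncation_length_mult_initial: "truncation_length G f Y * card initial \<le> card Y"
proof -
  define \<P> where "\<P> = {P. disjoint P \<and> (\<forall>X\<in>P. fundamental_domain G f X \<and> X \<subseteq> Y)}"
  have "\<P> \<subseteq> Pow (Pow Y)" by (auto simp: \<P>_def)
  then have "finite (card ` \<P>)" using finite_Y by (meson finite_Pow_iff finite_imageI finite_subset)
  moreover have "{} \<in> \<P>" by (simp add: \<P>_def)
  ultimately have "Max (card ` \<P>) \<in> card ` \<P>" by (intro Max_in) auto
  then obtain P where P: "P \<in> \<P>" "truncation_length G f Y = card P"
    by (auto simp: truncation_length_def \<P>_def)
  have dom: "card initial \<le> card X" "finite X" if "X \<in> P" for X
  proof -
    have "fundamental_domain G f X" and X: "X \<subseteq> Y" using P(1) that by (auto simp: \<P>_def)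
    then have ex: "\<exists>x. x \<in> X \<inter> zorbit (verts G) f v" if "v \<in> verts G" for v
      using that unfolding fundamental_domain_def by (elim conjE) (drule bspec, assumption, erule ex1_implies_ex)
    show "finite X" using X finite_Y finite_subset by blast
    define g where "g v = (SOME x. x \<in> X \<inter> zorbit (verts G) f v)" for v
    have g: "g v \<in> X \<inter> zorbit (verts G) f v" if "v \<in> initial" for v
      unfolding g_def
    proof (rule someI_ex[OF ex])
      show "v \<in> verts G" using that Y_subset by (auto simp: initial_def)
    qed
    have "inj_on g initial"
    proof (rule inj_onI)
      fix u v assume uv: "u \<in> initial" "v \<in> initial" "g u = g v"
      then show "u = v" using initial_unique[OF uv(1,2), of "g u"] g[OF uv(1)] g[OF uv(2)] by simp
    qed
    then show "card initial \<le> card X"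
      using g \<open>finite X\<close> by (intro card_inj_on_le[of g]) auto
  qed
  have "card P * card initial = (\<Sum>X\<in>P. card initial)" by simp
  also have "\<dots> \<le> (\<Sum>X\<in>P. card X)" by (intro sum_mono dom)
  also have "\<dots> = card (\<Union>P)"
    using P(1) dom(2) by (intro card_Union_disjoint[symmetric]) (auto simp: \<P>_def)
  also have "\<dots> \<le> card Y" using P(1) finite_Y by (intro card_mono) (auto simp: \<P>_def)
  finally show ?thesis by (simp add: P(2))
qed

end

theorem theorem3p2p6:
  fixes G :: "nat \<Rightarrow> ('a, 'b) pre_digraph"
    and f :: "nat \<Rightarrow> 'a \<Rightarrow> 'a"
    and r :: "nat \<Rightarrow> 'a rel"
    and Y :: "nat \<Rightarrow> 'a set"
    and D :: nat
  assumes "\<And>N. truncated_propagating_graph (G N) (f N) (r N) (Y N)"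
    and "strict_mono (\<lambda>N. truncation_length (G N) (f N) (Y N))"
    and "\<And>N v. v \<in> Y N \<Longrightarrow> out_degree (G N \<restriction> Y N) v \<le> D"
  shows "asymptotically_dense_delocalization (range (\<lambda>N. G N \<restriction> Y N))"
  unfolding asymptotically_dense_delocalization_def
proof (intro allI impI)
  fix lam eps \<delta> :: real
  assume pos: "0 < lam" "0 < eps" "0 < \<delta>"
  \<comment> \<open>W differs from V by at most 2d < \<delta>: clipping costs d and balancing
    another d. The bound \<open>lam\<close> keeps the clipping interval nonempty.\<close>
  define d where "d = min 1 (min (\<delta> / 4) lam)"
  have d: "0 < d" "d \<le> 1" "d \<le> \<delta> / 4" "d \<le> lam" using pos by (auto simp: d_def)
  have "0 \<le> real (2 * D)" "0 \<le> lam" using pos by auto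
  from propagating_kernel_delocalization[OF this d(1,2) pos(2), where ?'a = 'a]
  obtain L :: real where L: "\<forall>(S::'a set) A T p \<rho> V. propagating_kernel S A T p \<rho> (real (2 * D)) \<longrightarrow>
    L * card T \<le> card S \<longrightarrow> (\<forall>v\<in>S. \<bar>V v\<bar> \<le> lam) \<longrightarrow> (\<exists>W. (\<forall>v\<in>S. \<bar>W v - V v\<bar> \<le> d) \<and>
      real (card {v\<in>S. \<exists>E. eps < atom_weight S (perturb A W) v E}) \<le> d * card S)"
    by (rule exE)
  \<comment> \<open>The k-th length is at least k, so from index \<open>k\<^sub>0\<close> on the
    lengths are at least \<open>L\<close>.\<close>
  define k\<^sub>0 where "k\<^sub>0 = nat \<lceil>L\<rceil>"
  \<comment> \<open>A graph with more than \<open>N\<close> vertices cannot have an index below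
    \<open>k\<^sub>0\<close>, as those sizes are all smaller than \<open>N\<close>.\<close>
  define N where "N = Suc (\<Sum>k<k\<^sub>0. card (Y k))"
  show "\<exists>N>0. \<forall>H\<in>range (\<lambda>N. G N \<restriction> Y N). N < card (verts H) \<longrightarrow>
      (\<forall>V\<in>verts H \<rightarrow> {- lam..lam}. \<exists>W\<in>verts H \<rightarrow> {- lam..lam}.
        (SUP v\<in>verts H. \<bar>V v - W v\<bar>) < \<delta> \<and>
        (1 - \<delta>) * real (card (verts H)) \<le> real (card {v\<in>verts H.
          \<not> (\<exists>E. eps < measure (spectral_measure (verts H) (schroedinger_op H W) v) {E})}))"
  proof (intro exI[of _ N] conjI ballI impI)
    show "N > 0" by (simp add: N_def)
    fix H and V :: "'a \<Rightarrow> real"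
    assume "H \<in> range (\<lambda>N. G N \<restriction> Y N)" and card_H: "N < card (verts H)"
      and V: "V \<in> verts H \<rightarrow> {- lam..lam}"
    then obtain k where H: "H = G k \<restriction> Y k" by auto
    interpret truncated_propagating_graph "G k" "f k" "r k" "Y k" by (rule assms(1))
    have verts: "verts H = Y k" by (simp add: H)
    have "k\<^sub>0 \<le> k"
    proof (rule ccontr)
      assume "\<not> k\<^sub>0 \<le> k"
      then have "card (Y k) \<le> (\<Sum>k<k\<^sub>0. card (Y k))" by (intro member_le_sum) auto
      then show False using card_H by (simp add: N_def verts)
    qed
    also have "k \<le> truncation_length (G k) (f k) (Y k)" by (rule strict_mono_imp_increasing[OF assms(2)])
    finally have "L \<le> truncation_length (G k) (f k) (Y k)" unfolding k\<^sub>0_def by linarith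
    then have "L * card initial \<le> real (truncation_length (G k) (f k) (Y k)) * real (card initial)"
      by (intro mult_right_mono) auto
    also have "\<dots> \<le> card (Y k)"
      using of_nat_mono[OF truncation_length_mult_initial] by simp
    finally have LT: "L * card initial \<le> card (Y k)" .
    \<comment> \<open>Clipping to [-(lam - d), lam - d] leaves room for a perturbation by d inside
      [-lam, lam].\<close>
    define V' where "V' v = max (- (lam - d)) (min (lam - d) (V v))" for v
    have V': "\<bar>V' v\<bar> \<le> lam - d" "\<bar>V' v - V v\<bar> \<le> d" if "v \<in> Y k" for v
    proof -
      have "V v \<in> {- lam..lam}" using V that by (auto simp: verts)
      then show "\<bar>V' v\<bar> \<le> lam - d" "\<bar>V' v - V v\<bar> \<le> d"
        using d by (auto simp: V'_def max_def min_def abs_le_iff)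
    qed
    have "\<forall>v\<in>Y k. \<bar>V' v\<bar> \<le> lam" using V'(1) d(1) by fastforce
    from L[THEN spec, THEN spec, THEN spec, THEN spec, THEN spec, THEN spec, THEN mp, THEN mp, THEN mp,
        OF propagating_kernel_truncation[OF assms(3)] LT this]
    have "\<exists>W. (\<forall>v\<in>Y k. \<bar>W v - V' v\<bar> \<le> d) \<and>
      real (card {v\<in>Y k. \<exists>E. eps < atom_weight (Y k) (perturb kernel W) v E}) \<le> d * card (Y k)"
      by simp
    then obtain W where W: "\<And>v. v \<in> Y k \<Longrightarrow> \<bar>W v - V' v\<bar> \<le> d"
      and bad: "real (card {v\<in>Y k. \<exists>E. eps < atom_weight (Y k) (perturb kernel W) v E}) \<le> d * card (Y k)"
      by blast
    show "\<exists>W\<in>verts H \<rightarrow> {- lam..lam}. (SUP v\<in>verts H. \<bar>V v - W v\<bar>) < \<delta> \<and>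
        (1 - \<delta>) * real (card (verts H)) \<le> real (card {v\<in>verts H.
          \<not> (\<exists>E. eps < measure (spectral_measure (verts H) (schroedinger_op H W) v) {E})})"
    proof (intro bexI[of _ W] conjI)
      show "W \<in> verts H \<rightarrow> {- lam..lam}"
      proof
        fix v assume "v \<in> verts H"
        then have "v \<in> Y k" by (simp add: verts)
        from W[OF this] V'(1)[OF this] show "W v \<in> {- lam..lam}" by (auto simp: abs_le_iff)
      qed
      have "(SUP v\<in>verts H. \<bar>V v - W v\<bar>) \<le> 2 * d"
      proof (rule cSUP_least)
        show "verts H \<noteq> {}" using card_H by auto
        fix v assume "v \<in> verts H"
        then have "v \<in> Y k" by (simp add: verts)
        from W[OF this] V'(2)[OF this] show "\<bar>V v - W v\<bar> \<le> 2 * d" by linarith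
      qed
      then show "(SUP v\<in>verts H. \<bar>V v - W v\<bar>) < \<delta>" using d pos by linarith
      define B where "B = {v\<in>Y k. \<exists>E. eps < atom_weight (Y k) (perturb kernel W) v E}"
      have "{v\<in>verts H. \<not> (\<exists>E. eps < measure (spectral_measure (verts H) (schroedinger_op H W) v) {E})} = Y k - B"
        unfolding B_def verts H using measure_spectral_measure_truncation[of _ W] by auto
      moreover have "card (Y k - B) = card (Y k) - card B" "card B \<le> card (Y k)"
        using finite_Y by (auto simp: B_def intro!: card_Diff_subset card_mono)
      moreover have "d * card (Y k) \<le> \<delta> * card (Y k)" using d pos by (intro mult_right_mono) auto
      ultimately show "(1 - \<delta>) * real (card (verts H)) \<le> real (card {v\<in>verts H.
          \<not> (\<exists>E. eps < measure (spectral_measure (verts H) (schroedinger_op H W) v) {E})})"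
        using bad unfolding B_def[symmetric] verts by (simp add: of_nat_diff algebra_simps)
    qed
  qed
qed

end
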